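(* Let $(W,S)$ be a Coxeter system with an involutive automorphism $\theta$. For $\theta$-stable $J\subseteq S$ of one of the types below, with the elements of $J$ labelled as described in the context, consider the following moves (in both directions), each replacing a prefix of a reduced $\underline{S}$-expression: \begin{itemize} \item When $W_J$ is of type $A_3$ and $\theta_J\neq\mathrm{id}$: $[\underline{s}_2\underline{s}_3\underline{s}_1\underline{s}_2]\longleftrightarrow[\underline{s}_2\underline{s}_3\underline{s}_2\underline{s}_1]$. \item When $W_J$ is of type $B_3$: $[\underline{s}_1\underline{s}_2\underline{s}_3\underline{s}_1\underline{s}_2\underline{s}_1]\longleftrightarrow[\underline{s}_1\underline{s}_2\underline{s}_3\underline{s}_2\underline{s}_1\underline{s}_2]$. \item When $W_J$ is of type $D_4$ and $\theta_J=\mathrm{id}$: $[\underline{s}_4\underline{s}_2\underline{s}_1\underline{s}_3\underline{s}_2\underline{s}_1\underline{s}_3\underline{s}_4]\longleftrightarrow[\underline{s}_4\underline{s}_2\underline{s}_1\underline{s}_3\underline{s}_2\underline{s}_1\underline{s}_4\underline{s}_3]$. \item When $W_J$ is of type $H_3$: $[\underline{s}_1\underline{s}_3\underline{s}_2\underline{s}_1\underline{s}_3\underline{s}_2\underline{s}_1\underline{s}_3\underline{s}_2]\longleftrightarrow[\underline{s}_1\underline{s}_3\underline{s}_2\underline{s}_1\underline{s}_3\underline{s}_2\underline{s}_1\underline{s}_2\underline{s}_3]$. \item When $W_J$ is of type $I_2(m)$, $3\le m<\infty$, and $\theta_J=\mathrm{id}$: $[\underline{s}_1\underline{s}_2\underline{s}_1\cdots]\longleftrightarrow[\underline{s}_2\underline{s}_1\underline{s}_2\cdots]$,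 where both alternating words have $\lceil (m(s_1,s_2)+1)/2\rceil$ letters. \item When $W_J$ is of type $I_2(m)$, $2\le m<\infty$, and $\theta_J\neq\mathrm{id}$: $[\underline{s}_1\underline{s}_2\underline{s}_1\cdots]\longleftrightarrow[\underline{s}_2\underline{s}_1\underline{s}_2\cdots]$, where both alternating words have $\lceil m(s_1,s_2)/2\rceil$ letters. \end{itemize} If $w\in\mathfrak{I}(\theta)$, then any two reduced $\underline{S}$-expressions for $w$ can be connected by a finite sequence of braid moves and initial moves of the listed kinds.
   Context: Let $(W,S)$ be a Coxeter system; $m(s,s')$ denotes the order of $ss'$ and $e\in W$ the identity. An involutive automorphism $\theta$ of $(W,S)$ is a group automorphism of $W$ with $\theta(S)=S$ and $\theta^2=\mathrm{id}$ (the identity is allowed). The set of twisted involutions is $\mathfrak{I}(\theta)=\{w\in W\mid\theta(w)=w^{-1}\}$. Let $\underline{S}=\{\underline{s}\mid s\in S\}$ be an alphabet in bijection with $S$. The free monoid $\underline{S}^*$ acts from the right on the set $W$ by $w\underline{s}=ws$ if $\theta(s)ws=w$, and $w\underline{s}=\theta(s)ws$ otherwise; $w\underline{s}_1\cdots\underline{s}_k=(\cdots((w\underline{s}_1)\underline{s}_2)\cdots)\underline{s}_k$. The orbit of $e$ is $\mathfrak{I}(\theta)$. A word $[\underline{s}_1\cdots\underline{s}_k]\in\underline{S}^*$ with $e\underline{s}_1\cdots\underline{s}_k=w$ is called an $\underline{S}$-expression for $w$; it is reduced if no $\underline{S}$-expression for $w$ has fewer letters. A braid move is the replacement, anywhere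 in a word in $\underline{S}^*$, of a consecutive subword $\underline{s}\,\underline{s}'\underline{s}\cdots$ ($m(s,s')$ letters) by $\underline{s}'\underline{s}\,\underline{s}'\cdots$ ($m(s,s')$ letters), where $s\neq s'$ in $S$ and $m(s,s')<\infty$. An initial move is the replacement, at the beginning of a reduced $\underline{S}$-expression for some element of $\mathfrak{I}(\theta)$, of one reduced $\underline{S}$-expression for some $v\in\mathfrak{I}(\theta)$ by another reduced $\underline{S}$-expression for the same $v$ (here $v$ is the longest element of $W_J$). For $J\subseteq S$, $W_J$ is the parabolic subgroup generated by $J$, with the type of the Coxeter system $(W_J,J)$; $J$ is $\theta$-stable if $\theta(J)=J$, and then $\theta_J$ is the restriction of $\theta$ to $W_J$. For each $J$ a labelling of its elements is fixed as follows (pairs not mentioned commute). $A_3$: $J=\{s_1,s_2,s_3\}$, $m(s_1,s_2)=m(s_2,s_3)=3$. $B_3$: $J=\{s_1,s_2,s_3\}$, $m(s_1,s_2)=4$, $m(s_2,s_3)=3$. $D_4$: $J=\{s_1,s_2,s_3,s_4\}$, $m(s_1,s_3)=m(s_2,s_3)=m(s_4,s_3)=3$. $H_3$: $J=\{s_1,s_2,s_3\}$, $m(s_1,s_2)=5$, $m(s_2,s_3)=3$. $I_2(m)$: $J=\{s_1,s_2\}$, $m(s_1,s_2)=m$ (so $I_2(2)=A_1\times A_1$). *)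

theory Defs
  imports "HOL-Algebra.Multiplicative_Group"
begin

section \<open>Coxeter systems\<close>

text \<open>Since \<^const>\<open>group.ord\<close> is 0 for elements of infinite order,
  \<open>cox_m W s t = 0\<close> encodes \<open>m(s,t) = \<infinity>\<close>.\<close>

definition cox_m :: "('a, 'b) monoid_scheme \<Rightarrow> 'a \<Rightarrow> 'a \<Rightarrow> nat" where
  "cox_m W s t = group.ord W (s \<otimes>\<^bsub>W\<^esub> t)"

definition word_prod :: "('a, 'b) monoid_scheme \<Rightarrow> 'a list \<Rightarrow> 'a" where
  "word_prod W us = foldr (\<lambda>x y. x \<otimes>\<^bsub>W\<^esub> y) us \<one>\<^bsub>W\<^esub>"

definition relator_deletion :: "('a, 'b) monoid_scheme \<Rightarrow> 'a set \<Rightarrow> ('a list \<times> 'a list) set" where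
  "relator_deletion W S =
     {(us @ concat (replicate (cox_m W s t) [s, t]) @ vs, us @ vs) | us vs s t.
        us \<in> lists S \<and> vs \<in> lists S \<and> s \<in> S \<and> t \<in> S \<and> 0 < cox_m W s t}"

definition presentation_cong :: "('a, 'b) monoid_scheme \<Rightarrow> 'a set \<Rightarrow> ('a list \<times> 'a list) set" where
  "presentation_cong W S = (relator_deletion W S \<union> (relator_deletion W S)\<inverse>)\<^sup>*"

text \<open>The last assumption says that the relations \<open>(s t) ^ m(s,t) = 1\<close>, for \<open>m(s,t)\<close> finite,
  present \<open>W\<close> on the generators \<open>S\<close>. They include the relations \<open>s s = 1\<close>, so no formal
  inverses are needed: the presentation as a monoid is the presentation as a group.\<close>

locale coxeter_system = group W for W (structure) +
  fixes S :: "'a set"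
  assumes gens_closed: "S \<subseteq> carrier W"
    and gens_generate: "generate W S = carrier W"
    and gens_involutive: "s \<in> S \<Longrightarrow> ord s = 2"
    and presentation: "us \<in> lists S \<Longrightarrow> vs \<in> lists S \<Longrightarrow>
      word_prod W us = word_prod W vs \<longleftrightarrow> (us, vs) \<in> presentation_cong W S"

text \<open>The identity is allowed.\<close>

definition involutive_automorphism ::
    "('a, 'b) monoid_scheme \<Rightarrow> 'a set \<Rightarrow> ('a \<Rightarrow> 'a) \<Rightarrow> bool" where
  "involutive_automorphism W S \<theta> \<longleftrightarrow>
     \<theta> \<in> iso W W \<and> \<theta> ` S = S \<and> (\<forall>w\<in>carrier W. \<theta> (\<theta> w) = w)"


section \<open>Twisted involutions and expressions\<close>

definition twisted_involutions :: "('a, 'b) monoid_scheme \<Rightarrow> ('a \<Rightarrow> 'a) \<Rightarrow> 'a set" where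
  "twisted_involutions W \<theta> = {w \<in> carrier W. \<theta> w = inv\<^bsub>W\<^esub> w}"

text \<open>The underlined letters are represented by the elements of \<open>S\<close> themselves, so that the
  free monoid on them is \<^term>\<open>lists S\<close>.\<close>

definition letter_act :: "('a, 'b) monoid_scheme \<Rightarrow> ('a \<Rightarrow> 'a) \<Rightarrow> 'a \<Rightarrow> 'a \<Rightarrow> 'a" where
  "letter_act W \<theta> w s =
     (if \<theta> s \<otimes>\<^bsub>W\<^esub> w \<otimes>\<^bsub>W\<^esub> s = w then w \<otimes>\<^bsub>W\<^esub> s else \<theta> s \<otimes>\<^bsub>W\<^esub> w \<otimes>\<^bsub>W\<^esub> s)"

definition word_act :: "('a, 'b) monoid_scheme \<Rightarrow> ('a \<Rightarrow> 'a) \<Rightarrow> 'a \<Rightarrow> 'a list \<Rightarrow> 'a" where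
  "word_act W \<theta> w us = foldl (letter_act W \<theta>) w us"

definition expression ::
    "('a, 'b) monoid_scheme \<Rightarrow> 'a set \<Rightarrow> ('a \<Rightarrow> 'a) \<Rightarrow> 'a \<Rightarrow> 'a list \<Rightarrow> bool" where
  "expression W S \<theta> w us \<longleftrightarrow> us \<in> lists S \<and> word_act W \<theta> \<one>\<^bsub>W\<^esub> us = w"

definition reduced_expression ::
    "('a, 'b) monoid_scheme \<Rightarrow> 'a set \<Rightarrow> ('a \<Rightarrow> 'a) \<Rightarrow> 'a \<Rightarrow> 'a list \<Rightarrow> bool" where
  "reduced_expression W S \<theta> w us \<longleftrightarrow>
     expression W S \<theta> w us \<and> (\<forall>vs. expression W S \<theta> w vs \<longrightarrow> length us \<le> length vs)"


section \<open>Braid moves\<close>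

text \<open>\<open>alternating n s t\<close> is the word \<open>s t s \<dots>\<close> with \<open>n\<close> letters.\<close>

fun alternating :: "nat \<Rightarrow> 'a \<Rightarrow> 'a \<Rightarrow> 'a list" where
  "alternating 0 s t = []"
| "alternating (Suc n) s t = s # alternating n t s"

definition braid_moves :: "('a, 'b) monoid_scheme \<Rightarrow> 'a set \<Rightarrow> ('a list \<times> 'a list) set" where
  "braid_moves W S =
     {(us @ alternating (cox_m W s t) s t @ vs, us @ alternating (cox_m W s t) t s @ vs) | us vs s t.
        us \<in> lists S \<and> vs \<in> lists S \<and> s \<in> S \<and> t \<in> S \<and> s \<noteq> t \<and> 0 < cox_m W s t}"


section \<open>Parabolic subgroups and their types\<close>

abbreviation parabolic :: "('a, 'b) monoid_scheme \<Rightarrow> 'a set \<Rightarrow> 'a set" where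
  "parabolic W J \<equiv> generate W J"

definition restricts_to_id :: "('a, 'b) monoid_scheme \<Rightarrow> ('a \<Rightarrow> 'a) \<Rightarrow> 'a set \<Rightarrow> bool" where
  "restricts_to_id W \<theta> J \<longleftrightarrow> (\<forall>w\<in>parabolic W J. \<theta> w = w)"

datatype cox_type = Type_A3 | Type_B3 | Type_D4 | Type_H3 | Type_I2 nat

text \<open>\<open>labelled_type W T J ss\<close>: the Coxeter system \<open>(W\<^sub>J, J)\<close> has type \<open>T\<close> (with finite bond in
  the case \<open>I\<^sub>2(m)\<close>), and \<open>ss = [s\<^sub>1, s\<^sub>2, \<dots>]\<close> is an admissible labelling of \<open>J\<close>.\<close>

inductive labelled_type ::
    "('a, 'b) monoid_scheme \<Rightarrow> cox_type \<Rightarrow> 'a set \<Rightarrow> 'a list \<Rightarrow> bool" for W where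
  A3: "\<lbrakk>distinct [s1, s2, s3];
        cox_m W s1 s2 = 3; cox_m W s2 s3 = 3; cox_m W s1 s3 = 2\<rbrakk>
       \<Longrightarrow> labelled_type W Type_A3 {s1, s2, s3} [s1, s2, s3]"
| B3: "\<lbrakk>distinct [s1, s2, s3];
        cox_m W s1 s2 = 4; cox_m W s2 s3 = 3; cox_m W s1 s3 = 2\<rbrakk>
       \<Longrightarrow> labelled_type W Type_B3 {s1, s2, s3} [s1, s2, s3]"
| D4: "\<lbrakk>distinct [s1, s2, s3, s4];
        cox_m W s1 s3 = 3; cox_m W s2 s3 = 3; cox_m W s4 s3 = 3;
        cox_m W s1 s2 = 2; cox_m W s1 s4 = 2; cox_m W s2 s4 = 2\<rbrakk>
       \<Longrightarrow> labelled_type W Type_D4 {s1, s2, s3, s4} [s1, s2, s3, s4]"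
| H3: "\<lbrakk>distinct [s1, s2, s3];
        cox_m W s1 s2 = 5; cox_m W s2 s3 = 3; cox_m W s1 s3 = 2\<rbrakk>
       \<Longrightarrow> labelled_type W Type_H3 {s1, s2, s3} [s1, s2, s3]"
| I2: "\<lbrakk>distinct [s1, s2]; cox_m W s1 s2 = m; 2 \<le> m\<rbrakk>
       \<Longrightarrow> labelled_type W (Type_I2 m) {s1, s2} [s1, s2]"

definition theta_stable :: "'a set \<Rightarrow> ('a \<Rightarrow> 'a) \<Rightarrow> 'a set \<Rightarrow> bool" where
  "theta_stable S \<theta> J \<longleftrightarrow> J \<subseteq> S \<and> \<theta> ` J = J"

text \<open>\<open>lab\<close> fixes one admissible labelling of each \<open>\<theta>\<close>-stable \<open>J\<close> of one of the above types.\<close>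

definition labelling_choice ::
    "('a, 'b) monoid_scheme \<Rightarrow> 'a set \<Rightarrow> ('a \<Rightarrow> 'a) \<Rightarrow> ('a set \<Rightarrow> 'a list) \<Rightarrow> bool" where
  "labelling_choice W S \<theta> lab \<longleftrightarrow>
     (\<forall>J T. theta_stable S \<theta> J \<and> (\<exists>ss. labelled_type W T J ss) \<longrightarrow> labelled_type W T J (lab J))"


section \<open>Initial moves\<close>

text \<open>The listed pairs of prefixes, each in one direction.\<close>

inductive_set listed_pairs ::
    "('a, 'b) monoid_scheme \<Rightarrow> 'a set \<Rightarrow> ('a \<Rightarrow> 'a) \<Rightarrow> ('a set \<Rightarrow> 'a list) \<Rightarrow> ('a list \<times> 'a list) set"
  for W S \<theta> lab where
  A3: "\<lbrakk>theta_stable S \<theta> J; labelled_type W Type_A3 J (lab J); lab J = [s1, s2, s3];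
        \<not> restricts_to_id W \<theta> J\<rbrakk>
       \<Longrightarrow> ([s2, s3, s1, s2], [s2, s3, s2, s1]) \<in> listed_pairs W S \<theta> lab"
| B3: "\<lbrakk>theta_stable S \<theta> J; labelled_type W Type_B3 J (lab J); lab J = [s1, s2, s3]\<rbrakk>
       \<Longrightarrow> ([s1, s2, s3, s1, s2, s1], [s1, s2, s3, s2, s1, s2]) \<in> listed_pairs W S \<theta> lab"
| D4: "\<lbrakk>theta_stable S \<theta> J; labelled_type W Type_D4 J (lab J); lab J = [s1, s2, s3, s4];
        restricts_to_id W \<theta> J\<rbrakk>
       \<Longrightarrow> ([s4, s2, s1, s3, s2, s1, s3, s4], [s4, s2, s1, s3, s2, s1, s4, s3])
             \<in> listed_pairs W S \<theta> lab"
| H3: "\<lbrakk>theta_stable S \<theta> J; labelled_type W Type_H3 J (lab J); lab J = [s1, s2, s3]\<rbrakk>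
       \<Longrightarrow> ([s1, s3, s2, s1, s3, s2, s1, s3, s2], [s1, s3, s2, s1, s3, s2, s1, s2, s3])
             \<in> listed_pairs W S \<theta> lab"
| I2_id: "\<lbrakk>theta_stable S \<theta> J; labelled_type W (Type_I2 m) J (lab J); lab J = [s1, s2];
        3 \<le> m; restricts_to_id W \<theta> J\<rbrakk>
       \<Longrightarrow> (alternating (nat \<lceil>(real m + 1) / 2\<rceil>) s1 s2, alternating (nat \<lceil>(real m + 1) / 2\<rceil>) s2 s1)
             \<in> listed_pairs W S \<theta> lab"
| I2_nonid: "\<lbrakk>theta_stable S \<theta> J; labelled_type W (Type_I2 m) J (lab J); lab J = [s1, s2];
        2 \<le> m; \<not> restricts_to_id W \<theta> J\<rbrakk>
       \<Longrightarrow> (alternating (nat \<lceil>real m / 2\<rceil>) s1 s2, alternating (nat \<lceil>real m / 2\<rceil>) s2 s1)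
             \<in> listed_pairs W S \<theta> lab"

definition initial_moves ::
    "('a, 'b) monoid_scheme \<Rightarrow> 'a set \<Rightarrow> ('a \<Rightarrow> 'a) \<Rightarrow> ('a list \<times> 'a list) set \<Rightarrow> ('a list \<times> 'a list) set"
  where
  "initial_moves W S \<theta> P =
     {(us @ xs, vs @ xs) | us vs xs.
        (us, vs) \<in> P \<union> P\<inverse> \<and>
        (\<exists>w\<in>twisted_involutions W \<theta>. reduced_expression W S \<theta> w (us @ xs)) \<and>
        (\<exists>v\<in>twisted_involutions W \<theta>. reduced_expression W S \<theta> v us \<and> reduced_expression W S \<theta> v vs)}"

end

theory Submission
  imports Defs
begin

text \<open>Call \<open>s\<close> a descent of \<open>w\<close> if \<open>\<ell>(ws) < \<ell>(w)\<close>. Reduced expressions are the words along which every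
  letter is an ascent, so induction on the length shows that all reduced expressions of \<open>w\<close> ending
  in the same letter are connected, and it remains to connect the descents of \<open>w\<close> with each other.
  For two descents \<open>s\<close>, \<open>t\<close> let \<open>u\<close> be the minimal element of the orbit of \<open>w\<close> under \<open>s\<close> and \<open>t\<close>.
  Climbing from \<open>u\<close> to \<open>w\<close> takes \<open>m(s,t)\<close> steps on both sides, and a braid move connects \<open>s\<close> and \<open>t\<close>,
  unless \<open>u {s,t} u\<^sup>-\<^sup>1 = \<theta>({s,t})\<close>. In the exceptional case either \<open>u = 1\<close> and the dihedral initial move
  applies, or \<open>u\<close> has a descent \<open>r\<close>, which is a third descent of \<open>w\<close>. If \<open>r\<close> does not connect \<open>s\<close> with
  \<open>t\<close>, then \<open>w x w\<^sup>-\<^sup>1 = \<theta>(x)\<close> for \<open>x = s, t, r\<close>. Repeating the argument with the minimal element of the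
  coset \<open>w W\<^sub>K\<close> in place of \<open>u\<close> adds descents to \<open>K\<close> until \<open>w\<close> is the longest element of \<open>W\<^sub>K\<close>.
  Since a set of descents never supports a vector \<open>\<delta> \<ge> 0\<close> that pairs nonpositively with all simple
  roots, only the types \<open>A\<^sub>3\<close>, \<open>B\<^sub>3\<close>, \<open>H\<^sub>3\<close> and \<open>D\<^sub>4\<close> survive, and there the listed moves connect the
  descents.\<close>

section \<open>Coxeter groups and the numbers game\<close>

text \<open>The letters act on twisted involutions without satisfying the braid relations, so it is
  not clear that the two climbs from \<open>u\<close> reach the same element. In the Hecke monoid,
  where a letter multiplies only if the length grows, left and right factors separate: the two sides
  commute, and each satisfies the braid relation. A single listed move per diagram is enough for the
  following reason. Two unconnected descents with \<open>w\<close> x \<open>w\<close>^-1 =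
  \<theta>(x) satisfy m(s,t) >= 3, so nonadjacent nodes are connected anyway, and connecting one
  edge at the central node connects the whole diagram. The conditions on \<theta> in the listed
  moves are forced: if \<open>w\<close> is the longest element of \<open>W_K\<close> and conjugates
  each x in \<open>K\<close> to \<theta>(x), then \<theta> is the opposition involution of
  \<open>K\<close>, which is nontrivial in type A3 and trivial in types B3, H3 and D4.\<close>

context coxeter_system
begin

abbreviation wp :: "'a list \<Rightarrow> 'a" where "wp \<equiv> word_prod W"
abbreviation m :: "'a \<Rightarrow> 'a \<Rightarrow> nat" where "m \<equiv> cox_m W"

lemma S_carrier [simp]: "s \<in> S \<Longrightarrow> s \<in> carrier W"
  using gens_closed by blast

lemma S_square [simp]: "s \<in> S \<Longrightarrow> s \<otimes> s = \<one>"
  using pow_ord_eq_1[of s] gens_involutive[of s] by (simp add: numeral_2_eq_2)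

lemma S_inv [simp]: "s \<in> S \<Longrightarrow> inv s = s"
  by (simp add: inv_equality)

lemma S_cancel_left [simp]: "s \<in> S \<Longrightarrow> x \<in> carrier W \<Longrightarrow> s \<otimes> (s \<otimes> x) = x"
  by (simp flip: m_assoc)

lemma S_cancel_right [simp]: "s \<in> S \<Longrightarrow> x \<in> carrier W \<Longrightarrow> x \<otimes> s \<otimes> s = x"
  by (simp add: m_assoc)

lemma wp_Nil [simp]: "wp [] = \<one>"
  by (simp add: word_prod_def)

lemma wp_Cons [simp]: "wp (s # us) = s \<otimes> wp us"
  by (simp add: word_prod_def)

lemma wp_closed [simp]: "us \<in> lists S \<Longrightarrow> wp us \<in> carrier W"
  by (induction us) auto

lemma wp_append [simp]: "us \<in> lists S \<Longrightarrow> vs \<in> lists S \<Longrightarrow> wp (us @ vs) = wp us \<otimes> wp vs"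
  by (induction us) (auto simp: m_assoc)

lemma wp_rev: "us \<in> lists S \<Longrightarrow> wp (rev us) = inv (wp us)"
  by (induction us) (auto simp: inv_mult_group in_lists_conv_set)

lemma ex_word: 
  assumes "w \<in> carrier W" obtains us where "us \<in> lists S" "wp us = w"
proof -
  have "w \<in> generate W S" using assms gens_generate by simp
  hence "\<exists>us\<in>lists S. wp us = w"
  proof (induction rule: generate.induct)
    case one then show ?case by (auto intro: bexI[of _ "[]"])
  next
    case (incl h) then show ?case by (auto intro!: bexI[of _ "[h]"])
  next
    case (inv h) then show ?case by (auto intro!: bexI[of _ "[h]"])
  next
    case (eng h1 h2)
    then obtain us vs where "us \<in> lists S" "wp us = h1" "vs \<in> lists S" "wp vs = h2" by auto
    then show ?case by (intro bexI[of _ "us @ vs"]) auto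
  qed
  thus ?thesis using that by blast
qed

lemma m_sym: "s \<in> S \<Longrightarrow> t \<in> S \<Longrightarrow> m s t = m t s"
  using ord_inv[of "s \<otimes> t"] by (simp add: cox_m_def inv_mult_group)

lemma m_self [simp]: "s \<in> S \<Longrightarrow> m s s = 1"
  by (simp add: cox_m_def)

lemma m_neq_1: "s \<in> S \<Longrightarrow> t \<in> S \<Longrightarrow> s \<noteq> t \<Longrightarrow> m s t \<noteq> 1"
  by (metis cox_m_def m_closed ord_eq_1 S_carrier S_cancel_left r_one)

text \<open>\<open>c s s = -2\<close>, as \<open>m s s = 1\<close>; and \<open>c s t = 2\<close> if \<open>m s t = 0\<close>, that is \<open>m(s,t) = \<infinity>\<close>, as
  \<open>pi / 0 = 0\<close>.\<close>

definition c :: "'a \<Rightarrow> 'a \<Rightarrow> real" where "c s t = 2 * cos (pi / real (m s t))"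

lemma c_sym: "s \<in> S \<Longrightarrow> t \<in> S \<Longrightarrow> c s t = c t s"
  by (simp add: c_def m_sym)

lemma c_self [simp]: "s \<in> S \<Longrightarrow> c s s = -2"
  by (simp add: c_def)

lemma c_nonneg: assumes "s \<in> S" "t \<in> S" "s \<noteq> t" shows "c s t \<ge> 0"
proof (cases "m s t = 0")
  case True then show ?thesis by (simp add: c_def)
next
  case False
  hence "m s t \<ge> 2" using m_neq_1[OF assms] by linarith
  hence "pi / real (m s t) \<le> pi / 2" by (intro divide_left_mono) auto
  moreover have "- (pi / 2) \<le> pi / real (m s t)" by (rule order_trans[of _ 0]) auto
  ultimately have "cos (pi / real (m s t)) \<ge> 0" by (intro cos_ge_zero)
  then show ?thesis by (simp add: c_def)
qed

lemma c_mono: assumes "k > 0" "m s t = 0 \<or> m s t \<ge> k" shows "c s t \<ge> 2 * cos (pi / real k)"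
proof (cases "m s t = 0")
  case True thus ?thesis by (simp add: c_def)
next
  case False
  hence "m s t \<ge> k" using assms by auto
  hence "pi / real (m s t) \<le> pi / real k" using assms False by (intro divide_left_mono) auto
  moreover have "pi / real k \<le> pi" using assms by (simp add: field_simps)
  ultimately have "cos (pi / real (m s t)) \<ge> cos (pi / real k)" 
    by (intro cos_monotone_0_pi_le) auto
  thus ?thesis by (simp add: c_def)
qed

text \<open>The contragredient geometric representation, as a right action on positions \<open>f\<close> of the
  numbers game. No finite support is needed, so \<open>S\<close> may be infinite.\<close>

definition fire :: "('a \<Rightarrow> real) \<Rightarrow> 'a \<Rightarrow> 'a \<Rightarrow> real" where
  "fire f s = (\<lambda>r. f r + c s r * f s)"

definition play :: "('a \<Rightarrow> real) \<Rightarrow> 'a list \<Rightarrow> 'a \<Rightarrow> real" where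
  "play f us = foldl fire f us"

lemma play_Nil [simp]: "play f [] = f" by (simp add: play_def)
lemma play_Cons [simp]: "play f (s # us) = play (fire f s) us" by (simp add: play_def)
lemma play_append [simp]: "play f (us @ vs) = play (play f us) vs" by (simp add: play_def)

lemma fire_fire [simp]: "s \<in> S \<Longrightarrow> fire (fire f s) s = f"
  by (auto simp: fire_def fun_eq_iff)

end

text \<open>Where \<open>n\<close> letters of the word \<open>s t s \<dots>\<close> have been written, the next letter is \<open>ltr n s t\<close>.\<close>

definition ltr :: "nat \<Rightarrow> 'a \<Rightarrow> 'a \<Rightarrow> 'a" where "ltr n s t = (if even n then s else t)"

lemma alternating_snoc: "alternating (Suc n) s t = alternating n s t @ [ltr n s t]"
  by (induction n arbitrary: s t) (auto simp: ltr_def)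

lemma ltr_Suc_Suc [simp]: "ltr (Suc (Suc n)) s t = ltr n s t"
  by (simp add: ltr_def)

lemma ltr_0 [simp]: "ltr 0 s t = s" "ltr (Suc 0) s t = t"
  by (simp_all add: ltr_def)

lemma ltr_cases: "ltr n s t = s \<and> ltr (Suc n) s t = t \<or> ltr n s t = t \<and> ltr (Suc n) s t = s"
  by (simp add: ltr_def)

lemma length_alternating [simp]: "length (alternating n s t) = n"
  by (induction n arbitrary: s t) auto

lemma alternating_lists: "s \<in> A \<Longrightarrow> t \<in> A \<Longrightarrow> alternating n s t \<in> lists A"
  by (induction n arbitrary: s t) auto

lemma alternating_add: "alternating (j + n) s t = alternating j s t @ alternating n (ltr j s t) (ltr (Suc j) s t)"
proof (induction n)
  case (Suc n)
  have "ltr (j + n) s t = ltr n (ltr j s t) (ltr (Suc j) s t)" by (auto simp: ltr_def)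
  then show ?case using Suc by (simp del: alternating.simps(2) add: alternating_snoc)
qed simp

lemma rev_alternating: "rev (alternating n s t) = (if even n then alternating n t s else alternating n s t)"
proof (induction n arbitrary: s t)
  case (Suc n)
  have "rev (alternating (Suc n) s t) = ltr n s t # rev (alternating n s t)"
    by (simp del: alternating.simps(2) add: alternating_snoc)
  then show ?case using Suc by (auto simp: ltr_def)
qed simp

lemma alternating_even: "alternating (2 * n) s t = concat (replicate n [s, t])"
  by (induction n) auto

text \<open>Chebyshev polynomials of the second kind with shifted index:
  \<open>cheb c (Suc n)\<close> is U_n(c/2). They are the coefficients of the roots of a dihedral
  group with bond value \<open>c\<close>; an infinite bond is the case \<open>c = 2\<close>.\<close>

fun cheb :: "real \<Rightarrow> nat \<Rightarrow> real" where
  "cheb c 0 = 0"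
| "cheb c (Suc 0) = 1"
| "cheb c (Suc (Suc n)) = c * cheb c (Suc n) - cheb c n"

lemma cheb_two: "cheb 2 n = real n"
  by (induction "2::real" n rule: cheb.induct) auto

lemma cheb_sin: "cheb (2 * cos x) n * sin x = sin (real n * x)"
proof (induction "2 * cos x" n rule: cheb.induct)
  case (3 n)
  have "sin (real (Suc (Suc n)) * x) + sin (real n * x) = 2 * cos x * sin (real (Suc n) * x)"
    using sin_add[of "real (Suc n) * x" x] sin_diff[of "real (Suc n) * x" x] 
    by (simp add: algebra_simps)
  then show ?case using 3 by (simp add: algebra_simps)
qed auto

context
  fixes k :: nat and x :: real and C :: real
  assumes k: "k \<ge> 2" and C_def: "C = 2 * cos x" and x_def: "x = pi / real k"
begin

lemma sin_x_pos: "sin x > 0"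
  using k by (auto simp: x_def intro!: sin_gt_zero) (simp add: field_simps)

lemma cheb_cos_eq: "cheb C n = sin (real n * x) / sin x"
  using cheb_sin[of x n] sin_x_pos by (simp add: C_def field_simps)

lemma cheb_cos_pos: assumes "0 < n" "n < k" shows "cheb C n > 0"
proof -
  have "real n * x < pi" "real n * x > 0" using assms k by (auto simp: x_def field_simps)
  thus ?thesis using sin_x_pos by (simp add: cheb_cos_eq sin_gt_zero)
qed

text \<open>The values at \<open>k\<close> and \<open>k - 1\<close> serve for the longest element of
  the dihedral group of order 2k, those at \<open>2 * k\<close> and its successor for the relator
  with 2k letters.\<close>

lemma cheb_cos_zero: "cheb C k = 0" "cheb C (k - 1) = 1"
  "cheb C (2 * k) = 0" "cheb C (Suc (2 * k)) = 1"
proof -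
  have kx: "real k * x = pi" using k by (simp add: x_def)
  show "cheb C k = 0" by (simp add: cheb_cos_eq kx)
  have "real (k - 1) * x = pi - x" using k kx by (simp add: of_nat_diff algebra_simps)
  thus "cheb C (k - 1) = 1" using sin_x_pos by (simp add: cheb_cos_eq)
  have *: "real (2 * k) * x = 2 * pi" using kx by simp
  thus "cheb C (2 * k) = 0" by (simp only: cheb_cos_eq sin_two_pi div_0)
  have "real (Suc (2 * k)) * x = x + 2 * pi" using * by (simp add: algebra_simps)
  thus "cheb C (Suc (2 * k)) = 1" using sin_x_pos by (simp add: cheb_cos_eq)
qed

text \<open>4 - C^2 is the determinant of the form on the two roots (scaled by 2); a finite bond
  makes it nonzero.\<close>

lemma C_bound: "C^2 \<noteq> 4"
proof -
  have "(cos x)^2 < 1" using sin_x_pos cos_squared_eq[of x] by simp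
  thus ?thesis by (simp add: C_def power_mult_distrib)
qed

end

section \<open>The action of dihedral words, and why the numbers game is defined on
  \<open>W\<close>\<close>

context coxeter_system
begin

lemma play_lin: "play (\<lambda>r. x * f r + y * g r) us r = x * play f us r + y * play g us r"
proof (induction us arbitrary: f g)
  case (Cons a us)
  have "fire (\<lambda>r. x * f r + y * g r) a = (\<lambda>r. x * fire f a r + y * fire g a r)"
    by (auto simp: fire_def algebra_simps)
  thus ?case using Cons by simp
qed simp

text \<open>Firing negates a letter's own value, so when the letter is due again its old value
  enters with a minus sign: each new value is \<open>c s t\<close> times the current one minus the
  preceding one, which is the recursion of \<open>cheb\<close>. The second conjunct records the
  negated value for the induction.\<close>

lemma play_alternating:
  assumes "s \<in> S" "t \<in> S"
  shows "play f (alternating n s t) (ltr n s t) = cheb (c s t) (Suc n) * f s + cheb (c s t) n * f t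
    \<and> play f (alternating (Suc n) s t) (ltr n s t) = - (cheb (c s t) (Suc n) * f s + cheb (c s t) n * f t)"
proof (induction n rule: less_induct)
  case (less n)
  have L: "ltr n s t \<in> S" using assms by (simp add: ltr_def)
  have 1: "play f (alternating n s t) (ltr n s t) = cheb (c s t) (Suc n) * f s + cheb (c s t) n * f t"
  proof (cases n)
    case 0 thus ?thesis by simp
  next
    case (Suc k)
    have ck: "c (ltr k s t) (ltr (Suc k) s t) = c s t"
      using ltr_cases[of k s t] c_sym[OF assms] by auto
    have k: "play f (alternating k s t) (ltr k s t) = cheb (c s t) (Suc k) * f s + cheb (c s t) k * f t"
      using less[of k] Suc by simp
    \<comment> \<open>The letter due next was the last one fired, except at \<open>k = 0\<close>,
      where it still carries \<open>f t\<close>.\<close>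
    have "play f (alternating k s t) (ltr (Suc k) s t) = c s t * cheb (c s t) 0 * f s + f t \<and> k = 0 \<or> 
      play f (alternating k s t) (ltr (Suc k) s t) = - (cheb (c s t) k * f s + cheb (c s t) (k - 1) * f t) \<and> k > 0"
    proof (cases k)
      case (Suc j)
      thus ?thesis using less[of j] \<open>n = Suc k\<close> by simp
    qed simp
    moreover have "play f (alternating n s t) (ltr n s t) = play f (alternating k s t) (ltr (Suc k) s t)
        + c s t * (cheb (c s t) (Suc k) * f s + cheb (c s t) k * f t)"
      unfolding Suc alternating_snoc by (simp add: fire_def ck k del: alternating.simps)
    ultimately show ?thesis unfolding Suc by (cases k) (auto simp: algebra_simps)
  qed
  show ?case using 1 L by (simp add: alternating_snoc fire_def del: alternating.simps)
qed

text \<open>Reduces a relator to its effect at \<open>s\<close> and \<open>t\<close>: if the form on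
  the two roots is nondegenerate, the values there determine \<open>x\<close> and
  \<open>y\<close>.\<close>

lemma play_two_letters:
  assumes "us \<in> lists {s, t}"
  shows "\<exists>x y. \<forall>r. play f us r = f r + c s r * x + c t r * y"
  using assms
proof (induction us arbitrary: f)
  case Nil
  show ?case by (auto intro: exI[of _ 0])
next
  case (Cons u us)
  then obtain x y where xy: "\<And>r. play (fire f u) us r = fire f u r + c s r * x + c t r * y" by force
  from Cons have "u = s \<or> u = t" by auto
  thus ?case
  proof
    assume "u = s" thus ?thesis using xy 
      by - (rule exI[of _ "x + f s"], rule exI[of _ y], auto simp: fire_def algebra_simps)
  next
    assume "u = t" thus ?thesis using xy 
      by - (rule exI[of _ x], rule exI[of _ "y + f t"], auto simp: fire_def algebra_simps)
  qed
qed

lemma m_ge_2: "s \<in> S \<Longrightarrow> t \<in> S \<Longrightarrow> s \<noteq> t \<Longrightarrow> m s t > 0 \<Longrightarrow> m s t \<ge> 2"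
  using m_neq_1[of s t] by linarith

lemma play_relator:
  assumes "s \<in> S" "t \<in> S" "m s t > 0"
  shows "play f (concat (replicate (m s t) [s, t])) = f"
proof (cases "s = t")
  case True
  thus ?thesis using assms by simp
next
  case False
  let ?k = "m s t" and ?c = "c s t"
  have k: "?k \<ge> 2" using m_ge_2 assms False by blast
  note U0 = cheb_cos_zero[OF k c_def refl] 
  have 1: "alternating (2 * ?k) s t = concat (replicate ?k [s, t])" by (rule alternating_even)
  obtain x y where xy: "\<And>r. play f (alternating (2 * ?k) s t) r = f r + c s r * x + c t r * y" 
    using play_two_letters[OF alternating_lists[of s "{s,t}" t]] by (metis insertCI)
  \<comment> \<open>Counting from 0, letter \<open>j\<close> is the last of the 2k letters and
    equals \<open>t\<close>, so the second conjunct of \<open>play_alternating\<close> gives the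
    value at \<open>t\<close>.\<close>
  obtain j where j: "2 * ?k = Suc j" using k by (metis Suc_pred' assms(3) nat_0_less_mult_iff zero_less_numeral)
  have "odd j" using j by (metis even_Suc even_mult_iff even_numeral)
  hence "ltr j s t = t" by (simp add: ltr_def)
  have "cheb ?c (Suc (Suc j)) = 1" "cheb ?c (Suc j) = 0" using U0 j by metis+
  hence "cheb ?c j = -1" by simp
  have "play f (alternating (2 * ?k) s t) s = f s"
    using play_alternating[OF assms(1,2), of f "2 * ?k"] U0 by (simp add: ltr_def)
  hence e1: "?c * y = 2 * x" using xy[of s] assms c_sym[of s t] by simp
  have "play f (alternating (2 * ?k) s t) t = f t"
    using play_alternating[OF assms(1,2), of f j] \<open>cheb ?c j = -1\<close> \<open>cheb ?c (Suc j) = 0\<close> \<open>ltr j s t = t\<close> 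
    unfolding j by simp
  hence e2: "?c * x = 2 * y" using xy[of t] assms by simp
  have "?c * (?c * x) = 4 * x" unfolding e2 using e1 by (simp add: mult.commute)
  hence "(?c^2 - 4) * x = 0" by (simp add: power2_eq_square algebra_simps)
  hence "x = 0" using C_bound[OF k c_def refl] by simp
  moreover have "y = 0" using e2 calculation by simp
  ultimately show ?thesis using xy 1 by auto
qed

text \<open>Relators act trivially and have even length, so the action and the parity of word length
  both descend from words to elements of \<open>W\<close>.\<close>

lemma presentation_invariant:
  assumes "(us, vs) \<in> presentation_cong W S"
  shows "play f us = play f vs \<and> even (length us) = even (length vs)"
proof -
  have rel: "play f us = play f vs \<and> even (length us) = even (length vs)" 
    if "(us, vs) \<in> relator_deletion W S" for us vs
    using that unfolding relator_deletion_def
    by (clarsimp simp: play_relator length_concat sum_list_replicate)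
  show ?thesis using assms unfolding presentation_cong_def
    by (induction rule: rtrancl_induct) (auto dest: rel)
qed

text \<open>The root \<open>w \<alpha>\<^sub>s\<close> is represented by the functional \<open>\<lambda>f. A f w s\<close>.\<close>

definition A :: "('a \<Rightarrow> real) \<Rightarrow> 'a \<Rightarrow> 'a \<Rightarrow> real" where
  "A f w = play f (SOME us. us \<in> lists S \<and> wp us = w)"

lemma A_wp: assumes "us \<in> lists S" shows "A f (wp us) = play f us"
proof -
  let ?P = "\<lambda>vs. vs \<in> lists S \<and> wp vs = wp us"
  have "?P (SOME vs. ?P vs)" by (rule someI[of ?P us]) (use assms in auto)
  thus ?thesis using presentation[of us] presentation_invariant[of us] assms unfolding A_def by metis
qed

lemma A_one [simp]: "A f \<one> = f"
  using A_wp[of "[]"] by simp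

lemma A_mult: assumes "x \<in> carrier W" "y \<in> carrier W" shows "A f (x \<otimes> y) = A (A f x) y"
proof -
  obtain us vs where "us \<in> lists S" "wp us = x" "vs \<in> lists S" "wp vs = y" using assms ex_word by metis
  thus ?thesis using A_wp[of us] A_wp[of vs] A_wp[of "us @ vs"] by auto
qed

lemma A_gen: "s \<in> S \<Longrightarrow> A f s = fire f s"
  using A_wp[of "[s]" f] by simp

lemma A_mult_gen: "x \<in> carrier W \<Longrightarrow> s \<in> S \<Longrightarrow> A f (x \<otimes> s) = fire (A f x) s"
  by (simp add: A_mult A_gen)

lemma A_gen_mult: "x \<in> carrier W \<Longrightarrow> s \<in> S \<Longrightarrow> A f (s \<otimes> x) = A (fire f s) x"
  by (simp add: A_mult A_gen)

lemma A_mult_gen_same: "x \<in> carrier W \<Longrightarrow> s \<in> S \<Longrightarrow> A f (x \<otimes> s) s = - A f x s"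
  by (simp add: A_mult_gen fire_def)

lemma A_mult_inv [simp]: "x \<in> carrier W \<Longrightarrow> A (A f x) (inv x) = f"
  by (simp flip: A_mult)

lemma A_inv_mult [simp]: "x \<in> carrier W \<Longrightarrow> A (A f (inv x)) x = f"
  by (simp flip: A_mult)

lemma A_lin: "A (\<lambda>r. x * f r + y * g r) w s = x * A f w s + y * A g w s"
  by (simp add: A_def play_lin)

section \<open>Length, descents and positivity of roots\<close>

definition len :: "'a \<Rightarrow> nat" where
  "len w = (LEAST n. \<exists>us\<in>lists S. length us = n \<and> wp us = w)"

lemma len_le: "us \<in> lists S \<Longrightarrow> len (wp us) \<le> length us"
  unfolding len_def by (rule Least_le) auto

lemma len_word: assumes "w \<in> carrier W" obtains us where "us \<in> lists S" "wp us = w" "length us = len w"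
proof -
  let ?P = "\<lambda>n. \<exists>us\<in>lists S. length us = n \<and> wp us = w"
  have "\<exists>n. ?P n" using ex_word[OF assms] by metis
  hence "?P (len w)" unfolding len_def by (rule LeastI_ex)
  thus ?thesis using that by auto
qed

lemma len_one [simp]: "len \<one> = 0"
  using len_le[of "[]"] by simp

lemma len_mult_le: assumes "x \<in> carrier W" "y \<in> carrier W" shows "len (x \<otimes> y) \<le> len x + len y"
proof -
  obtain us vs where "us \<in> lists S" "wp us = x" "length us = len x" "vs \<in> lists S" "wp vs = y" "length vs = len y"
    using assms len_word by metis
  thus ?thesis using len_le[of "us @ vs"] by auto
qed

lemma len_gen_le: "s \<in> S \<Longrightarrow> len s \<le> 1"
  using len_le[of "[s]"] by simp

lemma len_inv_le: assumes "x \<in> carrier W" shows "len (inv x) \<le> len x"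
proof -
  obtain us where "us \<in> lists S" "wp us = x" "length us = len x" using assms len_word by metis
  thus ?thesis using len_le[of "rev us"] wp_rev[of us] by (auto simp: in_lists_conv_set)
qed

lemma len_inv [simp]: "x \<in> carrier W \<Longrightarrow> len (inv x) = len x"
  using len_inv_le[of x] len_inv_le[of "inv x"] by simp

lemma len_parity: assumes "us \<in> lists S" shows "even (len (wp us)) = even (length us)"
proof -
  obtain vs where "vs \<in> lists S" "wp vs = wp us" "length vs = len (wp us)" using len_word[of "wp us"] assms by auto
  thus ?thesis using presentation[of us vs] presentation_invariant assms by metis
qed

lemma len_mult_gen: assumes "x \<in> carrier W" "s \<in> S"
  shows "len (x \<otimes> s) = len x + 1 \<or> len x = len (x \<otimes> s) + 1"
proof -
  obtain us where us: "us \<in> lists S" "wp us = x" using assms ex_word by metis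
  have "even (len (x \<otimes> s)) \<noteq> even (len x)" 
    using len_parity[of us] len_parity[of "us @ [s]"] us assms by auto
  hence "len (x \<otimes> s) \<noteq> len x" by metis
  moreover have "len (x \<otimes> s) \<le> len x + 1" using len_mult_le[of x s] len_gen_le[of s] assms by simp
  moreover have "len x \<le> len (x \<otimes> s) + 1" 
    using len_mult_le[of "x \<otimes> s" s] len_gen_le[of s] assms by simp
  ultimately show ?thesis by linarith
qed

definition desc :: "'a \<Rightarrow> 'a \<Rightarrow> bool" where "desc w s \<longleftrightarrow> len (w \<otimes> s) < len w"

lemma len_desc: "x \<in> carrier W \<Longrightarrow> s \<in> S \<Longrightarrow> desc x s \<Longrightarrow> len x = len (x \<otimes> s) + 1"
  using len_mult_gen[of x s] by (auto simp: desc_def)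

lemma len_asc: "x \<in> carrier W \<Longrightarrow> s \<in> S \<Longrightarrow> \<not> desc x s \<Longrightarrow> len (x \<otimes> s) = len x + 1"
  using len_mult_gen[of x s] by (auto simp: desc_def)

lemma desc_mult_gen: "x \<in> carrier W \<Longrightarrow> s \<in> S \<Longrightarrow> desc (x \<otimes> s) s \<longleftrightarrow> \<not> desc x s"
  using len_mult_gen[of x s] by (auto simp: desc_def)

lemma ex_desc: assumes "w \<in> carrier W" "w \<noteq> \<one>" obtains s where "s \<in> S" "desc w s"
proof -
  obtain us where us: "us \<in> lists S" "wp us = w" "length us = len w" using assms len_word by metis
  hence "us \<noteq> []" using assms by auto
  then obtain vs s where vs: "us = vs @ [s]" by (metis rev_exhaust)
  hence "wp vs = w \<otimes> s" using us assms by (auto simp: in_lists_conv_set)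
  hence "len (w \<otimes> s) \<le> length vs" using len_le[of vs] us vs by auto
  thus ?thesis using that[of s] us vs by (auto simp: desc_def)
qed

lemma braid: assumes "s \<in> S" "t \<in> S" "m s t > 0"
  shows "wp (alternating (m s t) s t) = wp (alternating (m s t) t s)"
proof -
  let ?k = "m s t"
  have L: "alternating n x y \<in> lists S" if "x \<in> {s,t}" "y \<in> {s,t}" for n x y
    using that assms by (intro alternating_lists) auto
  have "(alternating (2 * ?k) s t, []) \<in> relator_deletion W S"
    unfolding relator_deletion_def alternating_even
    by (rule CollectI, rule exI[of _ "[]"], rule exI[of _ "[]"], rule exI[of _ s], rule exI[of _ t]) (use assms in auto)
  hence "wp (alternating (2 * ?k) s t) = \<one>"
    using presentation[of "alternating (2 * ?k) s t" "[]"] L by (auto simp: presentation_cong_def)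
  moreover have "alternating (2 * ?k) s t = alternating ?k s t @ (alternating ?k (ltr ?k s t) (ltr (Suc ?k) s t))"
    using alternating_add[of ?k ?k s t] by (simp add: mult_2)
  ultimately have "wp (alternating ?k s t) \<otimes> wp (alternating ?k (ltr ?k s t) (ltr (Suc ?k) s t)) = \<one>"
    using L ltr_cases[of ?k s t] by auto
  hence "wp (alternating ?k s t) = inv (wp (alternating ?k (ltr ?k s t) (ltr (Suc ?k) s t)))"
    using L ltr_cases[of ?k s t] by (intro inv_equality[symmetric]) auto
  also have "\<dots> = wp (alternating ?k t s)"
    using L by (subst wp_rev[symmetric]) (auto simp: rev_alternating ltr_def)
  finally show ?thesis .
qed

text \<open>Dividing by the descent \<open>y\<close> makes \<open>y\<close> an ascent, so the two
  letters exchange roles and the induction continues until neither is a descent.\<close>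

lemma strip:
  assumes "w \<in> carrier W" "x \<in> S" "y \<in> S" "\<not> desc w x"
  shows "\<exists>v n. v \<in> carrier W \<and> w = v \<otimes> wp (rev (alternating n y x)) \<and> len w = len v + n \<and> \<not> desc v x \<and> \<not> desc v y"
  using assms
proof (induction "len w" arbitrary: w x y rule: less_induct)
  case less
  show ?case
  proof (cases "desc w y")
    case False
    thus ?thesis using less by (intro exI[of _ w] exI[of _ 0]) auto
  next
    case True
    let ?w = "w \<otimes> y"
    have l: "len w = len ?w + 1" using len_desc less True by blast
    have "\<not> desc ?w y" using desc_mult_gen less True by blast
    hence "\<exists>v n. v \<in> carrier W \<and> ?w = v \<otimes> wp (rev (alternating n x y)) \<and> len ?w = len v + n 
        \<and> \<not> desc v y \<and> \<not> desc v x" by (intro less(1)) (use l less(2-) in auto)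
    then obtain v n where v: "v \<in> carrier W" "?w = v \<otimes> wp (rev (alternating n x y))" "len ?w = len v + n"
      "\<not> desc v x" "\<not> desc v y" by blast
    have L: "rev (alternating n x y) \<in> lists S" using alternating_lists[of x S y n] less by (auto simp: in_lists_conv_set)
    have "w = ?w \<otimes> y" using less by simp
    hence "w = v \<otimes> wp (rev (alternating n x y)) \<otimes> y" unfolding v(2) .
    hence "w = v \<otimes> wp (rev (alternating (Suc n) y x))" using L less v by (simp add: m_assoc)
    thus ?thesis using v l by (intro exI[of _ v] exI[of _ "Suc n"]) auto
  qed
qed

lemma cheb_dihedral:
  assumes "s \<in> S" "t \<in> S" "s \<noteq> t" "m s t = 0 \<or> n < m s t"
  shows "cheb (c s t) (Suc n) \<ge> 0" "cheb (c s t) n \<ge> 0" "cheb (c s t) (Suc n) > 0 \<or> cheb (c s t) n > 0"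
    "m s t = 0 \<or> Suc n < m s t \<Longrightarrow> cheb (c s t) (Suc n) > 0"
proof -
  show 1: "cheb (c s t) (Suc n) > 0" if "m s t = 0 \<or> Suc n < m s t" for n
  proof (cases "m s t = 0")
    case True
    thus ?thesis by (simp add: c_def cheb_two)
  next
    case False
    hence "m s t \<ge> 2" using m_ge_2 assms by blast
    from cheb_cos_pos[OF this c_def refl] False that show ?thesis by auto
  qed
  show 2: "cheb (c s t) n \<ge> 0" using 1[of "n - 1"] assms(4) by (cases n) (auto intro: less_imp_le)
  have z: "cheb (c s t) (m s t) = 0 \<and> cheb (c s t) (m s t - 1) = 1" if "m s t > 0"
    using cheb_cos_zero[OF m_ge_2[OF assms(1-3) that] c_def refl] by simp
  show "cheb (c s t) (Suc n) \<ge> 0" using 1[of n] z assms(4) 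
    by (cases "m s t = 0 \<or> Suc n < m s t") (auto simp: not_less le_less_Suc_eq dest: le_antisym)
  show "cheb (c s t) (Suc n) > 0 \<or> cheb (c s t) n > 0" using 1[of n] z assms(4) 
    by (cases "m s t = 0 \<or> Suc n < m s t") (auto simp: not_less le_less_Suc_eq dest: le_antisym)
qed

text \<open>The root \<open>w \<alpha>\<^sub>s\<close> of an ascent \<open>s\<close> is positive: strip a maximal alternating word in \<open>s\<close> and a
  descent \<open>t\<close> off the right end of \<open>w\<close>.\<close>

lemma asc_pos:
  assumes "w \<in> carrier W" "s \<in> S" "\<not> desc w s" "\<And>r. f r > 0"
  shows "A f w s > 0"
  using assms
proof (induction "len w" arbitrary: w s rule: less_induct)
  case less
  show ?case
  proof (cases "w = \<one>")
    case True thus ?thesis using less by simp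
  next
    case False
    then obtain t where t: "t \<in> S" "desc w t" using ex_desc less by blast
    hence st: "s \<noteq> t" using less by auto
    obtain v n where v: "v \<in> carrier W" "w = v \<otimes> wp (rev (alternating n t s))" "len w = len v + n"
      "\<not> desc v s" "\<not> desc v t" using strip[of w s t] less t by auto
    have "n > 0" using v t by (cases n) auto
    obtain p q where pq: "rev (alternating n t s) = alternating n p q" "ltr n p q = s" "p \<in> {s,t}" "q \<in> {s,t}" "p \<noteq> q"
      using st by (cases "even n") (auto simp: rev_alternating ltr_def)
    have pS: "p \<in> S" "q \<in> S" using pq less t by auto
    have L: "alternating j x y \<in> lists S" if "x \<in> {p,q}" "y \<in> {p,q}" for j x y
      using that pS by (intro alternating_lists) auto
    let ?k = "m p q"
    \<comment> \<open>A suffix of at least \<open>m p q\<close> letters could be rewritten by the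
      braid relation so that it ends in \<open>s\<close>, and \<open>s\<close> would be a
      descent.\<close>
    have "n < ?k" if k: "?k > 0"
    proof (rule ccontr)
      assume "\<not> n < ?k"
      define x y j where "x = ltr (n - ?k) p q" and "y = ltr (Suc (n - ?k)) p q" and "j = n - ?k"
      have n: "n = j + ?k" using \<open>\<not> n < ?k\<close> by (simp add: j_def)
      have xy: "x \<in> {p,q}" "y \<in> {p,q}" "x \<in> S" "y \<in> S" "m x y = ?k" 
        using pS ltr_cases[of "n - ?k" p q] m_sym[of p q] by (auto simp: x_def y_def)
      obtain i where i: "?k = Suc i" using k by (cases ?k) auto
      have "ltr i y x = s" using pq(2) n i by (auto simp: ltr_def x_def y_def split: if_splits)
      have "wp (alternating n p q) = wp (alternating j p q) \<otimes> wp (alternating ?k x y)"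
        unfolding n alternating_add using L xy by (simp add: x_def y_def j_def)
      also have "\<dots> = wp (alternating j p q) \<otimes> wp (alternating ?k y x)" using braid[of x y] xy k by simp
      also have "\<dots> = wp (alternating j p q) \<otimes> wp (alternating i y x) \<otimes> s"
        unfolding i alternating_snoc using L xy \<open>ltr i y x = s\<close> less by (simp add: m_assoc)
      finally have "w \<otimes> s = v \<otimes> (wp (alternating j p q) \<otimes> wp (alternating i y x))"
        using v(1,2) pq(1) L xy less by (simp add: m_assoc)
      also have "\<dots> = v \<otimes> wp (alternating j p q @ alternating i y x)" using L xy by simp
      finally have "len (w \<otimes> s) \<le> len v + (j + i)"
        using len_mult_le[of v "wp (alternating j p q @ alternating i y x)"] 
          len_le[of "alternating j p q @ alternating i y x"] L xy v by auto
      thus False using v(3) n i less by (simp add: desc_def)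
    qed
    note Up = cheb_dihedral[OF pS pq(5), of n]
    have pos: "A f v p > 0" "A f v q > 0" using less(1)[of v s] less(1)[of v t] v pq(3,4) \<open>n > 0\<close> less t by auto
    have "A f w s = play (A f v) (alternating n p q) (ltr n p q)"
      using v L by (simp add: A_mult A_wp pq)
    also have "\<dots> = cheb (c p q) (Suc n) * A f v p + cheb (c p q) n * A f v q"
      using play_alternating pS by blast
    also have "\<dots> > 0" using Up pos \<open>?k > 0 \<Longrightarrow> n < ?k\<close>
      by (cases "?k = 0") (auto intro: add_pos_nonneg add_nonneg_pos mult_pos_pos mult_nonneg_nonneg less_imp_le)
    finally show ?thesis .
  qed
qed

lemma desc_neg: "w \<in> carrier W \<Longrightarrow> s \<in> S \<Longrightarrow> desc w s \<Longrightarrow> (\<And>r. f r > 0) \<Longrightarrow> A f w s < 0"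
  using asc_pos[of "w \<otimes> s" s f] by (simp add: desc_mult_gen A_mult_gen_same)

text \<open>The constant functional 1 is the height of a root, so the sign of one number decides
  whether a letter is a descent.\<close>

lemma desc_iff: "w \<in> carrier W \<Longrightarrow> s \<in> S \<Longrightarrow> desc w s \<longleftrightarrow> A (\<lambda>_. 1) w s < 0"
  
proof (cases "desc w s")
  case True
  thus ?thesis if "w \<in> carrier W" "s \<in> S" using desc_neg[OF that, of "\<lambda>_. 1"] by simp
next
  case False
  thus ?thesis if "w \<in> carrier W" "s \<in> S" using asc_pos[OF that, of "\<lambda>_. 1"] by simp
qed

text \<open>Adding a small multiple of the constant functional 1 makes \<open>f\<close> strictly
  positive, and the multiple can tend to 0.\<close>

lemma asc_nonneg:
  assumes "w \<in> carrier W" "s \<in> S" "\<not> desc w s" "\<And>r. f r \<ge> 0"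
  shows "A f w s \<ge> 0"
proof (rule field_le_epsilon)
  fix e :: real assume e: "e > 0"
  have p: "A (\<lambda>_. 1) w s > 0" using asc_pos assms by simp
  define d where "d = e / A (\<lambda>_. 1) w s"
  have d: "d > 0" using e p by (simp add: d_def)
  have "A (\<lambda>r. 1 * f r + d * 1) w s > 0" using assms d by (intro asc_pos) (auto intro: add_nonneg_pos)
  thus "0 \<le> A f w s + e" using p e unfolding A_lin by (simp add: d_def)
qed

lemma desc_nonpos: "w \<in> carrier W \<Longrightarrow> s \<in> S \<Longrightarrow> desc w s \<Longrightarrow> (\<And>r. f r \<ge> 0) \<Longrightarrow> A f w s \<le> 0"
  using asc_nonneg[of "w \<otimes> s" s f] by (simp add: desc_mult_gen A_mult_gen_same)

text \<open>\<open>- c s t\<close> is twice the standard form \<open>B(\<alpha>\<^sub>s, \<alpha>\<^sub>t)\<close>, so this says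
  \<open>B(\<alpha>\<^sub>t, w \<alpha>\<^sub>r) = B(w\<^sup>-\<^sup>1 \<alpha>\<^sub>t, \<alpha>\<^sub>r)\<close>.\<close>

lemma form_invariant:
  assumes "w \<in> carrier W" "r \<in> S" "t \<in> S"
  shows "A (c t) w r = A (c r) (inv w) t"
proof -
  obtain us where us: "us \<in> lists S" "wp us = w" using assms ex_word by metis
  have "\<forall>r\<in>S. play (c t) us r = play (c r) (rev us) t"
    using us(1)
  proof (induction us rule: rev_induct)
    case Nil
    show ?case using c_sym assms by auto
  next
    case (snoc s us)
    show ?case
    proof
      fix r assume r: "r \<in> S"
      have "play (c t) (us @ [s]) r = play (c r) (rev us) t + c s r * play (c s) (rev us) t"
        using snoc r by (simp add: fire_def)
      also have "\<dots> = play (\<lambda>q. 1 * c r q + c s r * c s q) (rev us) t" unfolding play_lin by simp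
      also have "(\<lambda>q. 1 * c r q + c s r * c s q) = fire (c r) s" 
        using c_sym[of s r] r snoc by (auto simp: fire_def)
      finally show "play (c t) (us @ [s]) r = play (c r) (rev (us @ [s])) t" by simp
    qed
  qed
  thus ?thesis using us assms A_wp[of us] A_wp[of "rev us"] wp_rev[of us] by (auto simp: in_lists_conv_set)
qed

section \<open>Elements that send simple roots to simple roots up to sign\<close>

lemma faithful: assumes "w \<in> carrier W" "\<And>s. s \<in> S \<Longrightarrow> \<not> desc w s" shows "w = \<one>"
  using ex_desc assms by blast

text \<open>All roots have the same norm under the invariant form, so the square of a
  proportionality factor is 1.\<close>

lemma root_scale:
  assumes "w \<in> carrier W" "s \<in> S" "t \<in> S" "\<And>f. A f w s = k * f t"
  shows "k = 1 \<or> k = -1"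
proof -
  have 1: "A (c s) (inv w) t * k = -2" using assms(4)[of "A (c s) (inv w)"] assms(1-3) by (simp add: mult.commute)
  have "A (c s) (inv w) t = A (c t) w s" using form_invariant[of w s t] assms by simp
  also have "\<dots> = -2 * k" using assms(4)[of "c t"] assms by simp
  finally have "k * k = 1" using 1 by simp
  thus ?thesis by (metis square_eq_1_iff)
qed

text \<open>Conjugating the reflection \<open>s\<close> by \<open>w\<close> gives the reflection in
  the root w \<alpha>_s. Both sides act alike on all functionals; their quotient therefore fixes the
  constant functional 1, has no descents and is the identity.\<close>

lemma root_transport:
  assumes "w \<in> carrier W" "s \<in> S" "t \<in> S" "\<And>f. A f w s = f t"
  shows "w \<otimes> s = t \<otimes> w"
proof -
  have inv: "A f (inv w) t = f s" for f using assms(4)[of "A f (inv w)"] assms by simp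
  have "A f (w \<otimes> s) r = A f (t \<otimes> w) r" if "r \<in> S" for f r
  proof -
    have "A (c t) w r = c s r" using form_invariant[of w r t] inv[of "c r"] assms that c_sym by simp
    have "A f (t \<otimes> w) r = A (\<lambda>q. 1 * f q + f t * c t q) w r"
      using assms by (simp add: A_gen_mult fire_def mult.commute)
    also have "\<dots> = A f w r + f t * c s r" unfolding A_lin using \<open>A (c t) w r = c s r\<close> by simp
    finally show ?thesis using assms by (simp add: A_mult_gen fire_def)
  qed
  note eq = this
  have "inv (t \<otimes> w) \<otimes> (w \<otimes> s) = \<one>"
  proof -
    let ?x = "w \<otimes> s" and ?y = "t \<otimes> w"
    have "?y \<otimes> inv ?x = \<one>" if "inv ?y \<otimes> ?x = \<one>" using that assms 
      by (metis inv_closed inv_equality inv_inv l_inv m_closed S_carrier r_inv)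
    have "A f (inv ?y \<otimes> ?x) r = f r" if "r \<in> S" for f r
    proof -
      have "A f (inv ?y \<otimes> ?x) r = A (A f (inv ?y)) ?x r" using assms by (subst A_mult) auto
      also have "\<dots> = A (A f (inv ?y)) ?y r" by (rule eq[OF that])
      finally show ?thesis using assms by simp
    qed
    hence "\<not> desc (inv ?y \<otimes> ?x) r" if "r \<in> S" for r using assms that by (subst desc_iff) auto
    thus ?thesis using assms by (intro faithful) auto
  qed
  thus ?thesis using assms by (metis inv_closed inv_equality inv_inv m_closed S_carrier)
qed

lemma root_transport_neg:
  assumes "w \<in> carrier W" "s \<in> S" "t \<in> S" "\<And>f. A f w s = - f t"
  shows "w \<otimes> s = t \<otimes> w"
proof -
  have "w \<otimes> s \<otimes> s = t \<otimes> (w \<otimes> s)"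
    using assms by (intro root_transport) (auto simp: A_mult_gen_same)
  hence "t \<otimes> w = t \<otimes> (t \<otimes> (w \<otimes> s))" using assms by simp
  thus ?thesis using assms by simp
qed

text \<open>Evaluating both sides of w s = t w at \<open>s\<close> yields -w \<alpha>_s on one side
  and w \<alpha>_s plus a multiple of \<alpha>_t on the other. So w \<alpha>_s is proportional to
  \<alpha>_t, with factor 1 because \<open>s\<close> is an ascent.\<close>

lemma transport_root:
  assumes "w \<in> carrier W" "s \<in> S" "t \<in> S" "w \<otimes> s = t \<otimes> w" "\<not> desc w s"
  shows "A f w s = f t"
proof -
  define k where "k = - A (c t) w s / 2"
  have *: "A g w s = k * g t" for g
  proof -
    have "A g (t \<otimes> w) s = A (\<lambda>q. 1 * g q + g t * c t q) w s"
      using assms by (simp add: A_gen_mult fire_def mult.commute)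
    also have "\<dots> = A g w s + g t * A (c t) w s" unfolding A_lin by simp
    finally have "2 * A g w s = - (g t * A (c t) w s)" using assms A_mult_gen_same[of w s g] by simp
    thus ?thesis by (simp add: k_def field_simps)
  qed
  have "k \<ge> 0" using *[of "\<lambda>_. 1"] asc_pos[of w s "\<lambda>_. 1"] assms by simp
  thus ?thesis using root_scale[of w s t k] assms * by auto
qed

text \<open>In terms of roots: if only the coefficients of \<open>\<alpha>\<^sub>p\<close> and \<open>\<alpha>\<^sub>q\<close> in \<open>w \<alpha>\<^sub>s\<close> can be nonzero, then
  \<open>w \<alpha>\<^sub>s\<close> is the corresponding combination.\<close>

lemma span_two:
  assumes "\<And>f. (\<And>r. f r \<ge> 0) \<Longrightarrow> f p = 0 \<Longrightarrow> f q = 0 \<Longrightarrow> A f w s = 0" "p \<noteq> q"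
  shows "A f w s = A (\<lambda>r. if r = p then 1 else 0) w s * f p + A (\<lambda>r. if r = q then 1 else 0) w s * f q"
proof -
  let ?g = "\<lambda>r. if r = p \<or> r = q then 0 else f r"
  let ?ep = "\<lambda>r. if r = p then 1 else 0 :: real" and ?eq = "\<lambda>r. if r = q then 1 else 0 :: real"
  \<comment> \<open>The hypothesis speaks of nonnegative functionals only, so the part of
    \<open>f\<close> away from \<open>p\<close> and \<open>q\<close> is split into its positive and
    negative parts.\<close>
  have 0: "A (\<lambda>r. 1 * max (?g r) 0 + (-1) * max (- ?g r) 0) w s = 0"
    unfolding A_lin using assms(1)[of "\<lambda>r. max (?g r) 0"] assms(1)[of "\<lambda>r. max (- ?g r) 0"] by simp
  have "f = (\<lambda>r. 1 * (1 * max (?g r) 0 + (-1) * max (- ?g r) 0) + 1 * (f p * ?ep r + f q * ?eq r))"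
    using assms(2) by (auto simp: fun_eq_iff)
  hence "A f w s = A (\<lambda>r. 1 * (1 * max (?g r) 0 + (-1) * max (- ?g r) 0) + 1 * (f p * ?ep r + f q * ?eq r)) w s"
    by (rule arg_cong[where f = "\<lambda>g. A g w s"])
  also have "\<dots> = f p * A ?ep w s + f q * A ?eq w s" 
    unfolding A_lin[of 1 _ 1] 0 A_lin[of "f p"] by simp
  finally show ?thesis by (simp add: mult.commute)
qed

lemma span_one:
  assumes "\<And>f. (\<And>r. f r \<ge> 0) \<Longrightarrow> f p = 0 \<Longrightarrow> A f w s = 0"
  shows "A f w s = A (\<lambda>r. if r = p then 1 else 0) w s * f p"
proof -
  let ?g = "\<lambda>r. if r = p then 0 else f r"
  let ?ep = "\<lambda>r. if r = p then 1 else 0 :: real"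
  have 0: "A (\<lambda>r. 1 * max (?g r) 0 + (-1) * max (- ?g r) 0) w s = 0"
    unfolding A_lin using assms(1)[of "\<lambda>r. max (?g r) 0"] assms(1)[of "\<lambda>r. max (- ?g r) 0"] by simp
  have "f = (\<lambda>r. 1 * (1 * max (?g r) 0 + (-1) * max (- ?g r) 0) + f p * ?ep r)"
    by (auto simp: fun_eq_iff)
  hence "A f w s = A (\<lambda>r. 1 * (1 * max (?g r) 0 + (-1) * max (- ?g r) 0) + f p * ?ep r) w s"
    by (rule arg_cong[where f = "\<lambda>g. A g w s"])
  also have "\<dots> = f p * A ?ep w s" 
    unfolding A_lin[of 1 _ "f p"] 0 by simp
  finally show ?thesis by (simp add: mult.commute)
qed

text \<open>With y = z^-1, the root y \<alpha>_t is positive and s y \<alpha>_t is negative. The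
  reflection \<open>s\<close> changes only the coefficient of \<alpha>_s, so y \<alpha>_t is a
  multiple of \<alpha>_s, hence equal to it.\<close>

lemma exchange_sides:
  assumes "z \<in> carrier W" "s \<in> S" "t \<in> S" "len (t \<otimes> z) > len z" "len (t \<otimes> z \<otimes> s) < len (z \<otimes> s)"
  shows "t \<otimes> z = z \<otimes> s"
proof -
  let ?y = "inv z"
  have "len (?y \<otimes> t) = len (t \<otimes> z)" "len (s \<otimes> ?y \<otimes> t) = len (t \<otimes> z \<otimes> s)" "len (s \<otimes> ?y) = len (z \<otimes> s)"
    using assms len_inv[of "t \<otimes> z"] len_inv[of "t \<otimes> z \<otimes> s"] len_inv[of "z \<otimes> s"]
    by (simp_all add: inv_mult_group m_assoc)
  hence asc: "\<not> desc ?y t" and dsc: "desc (s \<otimes> ?y) t" using assms by (auto simp: desc_def)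
  have 0: "A f ?y t = 0" if f: "\<And>r. f r \<ge> 0" "f s = 0" for f
  proof -
    have "fire f s = f" using f by (auto simp: fire_def)
    hence "A f ?y t \<le> 0" using desc_nonpos[OF _ _ dsc, of f] f(1) assms by (simp add: A_gen_mult)
    thus ?thesis using asc_nonneg[OF _ _ asc, of f] f(1) assms by simp
  qed
  define k where "k = A (\<lambda>r. if r = s then 1 else 0) ?y t"
  have k: "A f ?y t = k * f s" for f unfolding k_def by (rule span_one[OF 0])
  have "k \<ge> 0" unfolding k_def using asc assms by (intro asc_nonneg) auto
  hence "k = 1" using root_scale[OF _ _ _ k] assms by fastforce
  hence "?y \<otimes> t = s \<otimes> ?y" using root_transport[of ?y t s] k assms by simp
  hence "inv (?y \<otimes> t) = inv (s \<otimes> ?y)" by simp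
  thus ?thesis using assms by (simp add: inv_mult_group)
qed

text \<open>The vector \<open>\<delta> = \<Sum> d\<^sub>k \<alpha>\<^sub>k\<close> pairs nonpositively with all simple roots, hence \<open>w \<delta> - \<delta>\<close> is a
  nonnegative combination of simple roots for all \<open>w\<close>; but \<open>w \<delta>\<close> is negative.\<close>

lemma no_degenerate_descents:
  assumes K: "finite K" "K \<subseteq> S" "k0 \<in> K" "d k0 > 0" "\<And>k. k \<in> K \<Longrightarrow> d k \<ge> 0"
    and nonneg: "\<And>k. k \<in> K \<Longrightarrow> (\<Sum>j\<in>K. d j * c j k) \<ge> 0"
    and w: "w \<in> carrier W" "\<And>k. k \<in> K \<Longrightarrow> desc w k"
  shows False
proof -
  let ?one = "\<lambda>_. 1 :: real"
  \<comment> \<open>Outside \<open>K\<close> every \<open>c j k\<close> is nonnegative, so the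
    hypothesis extends to all of \<open>S\<close>.\<close>
  have nn: "(\<Sum>j\<in>K. d j * c j k) \<ge> 0" if "k \<in> S" for k
  proof (cases "k \<in> K")
    case False
    thus ?thesis using K that by (intro sum_nonneg mult_nonneg_nonneg c_nonneg) auto
  qed (use nonneg in auto)
  have "(\<Sum>k\<in>K. d k * A ?one w k) \<ge> (\<Sum>k\<in>K. d k)" if "w \<in> carrier W" for w
    using that
  proof (induction "len w" arbitrary: w rule: less_induct)
    case less
    show ?case
    proof (cases "w = \<one>")
      case False
      then obtain s where s: "s \<in> S" "desc w s" using ex_desc less by blast
      let ?v = "w \<otimes> s"
      have l: "len ?v < len w" and v: "?v \<in> carrier W" using s less by (auto simp: desc_def)
      have "A ?one ?v s > 0" using asc_pos[of ?v s ?one] s less by (simp add: desc_mult_gen)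
      \<comment> \<open>The height of w \<delta> exceeds that of \<open>?v\<close> \<delta> by the
        pairing sum at \<open>s\<close> times the positive height of the root of \<open>s\<close>
        under \<open>?v\<close>.\<close>
      hence "0 \<le> (\<Sum>k\<in>K. d k * c k s) * A ?one ?v s" using nn[OF s(1)] by (intro mult_nonneg_nonneg) auto
      moreover have "(\<Sum>k\<in>K. d k * A ?one w k) = (\<Sum>k\<in>K. d k * A ?one ?v k) + (\<Sum>k\<in>K. d k * c k s) * A ?one ?v s"
      proof -
        have w: "?v \<otimes> s = w" using less s by simp
        have "A ?one w k = A ?one ?v k + c k s * A ?one ?v s" if "k \<in> K" for k
          using A_mult_gen[OF v s(1), of ?one] that K(2) c_sym[of s k] s(1) 
          unfolding w by (auto simp: fire_def)
        hence "(\<Sum>k\<in>K. d k * A ?one w k) = (\<Sum>k\<in>K. d k * A ?one ?v k + d k * c k s * A ?one ?v s)"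
          by (intro sum.cong) (auto simp: algebra_simps)
        thus ?thesis by (simp add: sum.distrib sum_distrib_right)
      qed
      ultimately show ?thesis using less(1)[OF l v] by linarith
    qed simp
  qed
  from this[OF w(1)] have "(\<Sum>k\<in>K. d k) \<le> (\<Sum>k\<in>K. d k * A ?one w k)" .
  moreover have "(\<Sum>k\<in>K. d k * A ?one w k) \<le> 0"
  proof (rule sum_nonpos)
    fix k assume "k \<in> K"
    hence "A ?one w k < 0" using desc_neg w K by auto
    thus "d k * A ?one w k \<le> 0" using K(5)[OF \<open>k \<in> K\<close>] by (simp add: mult_nonneg_nonpos)
  qed
  moreover have "(\<Sum>k\<in>K. d k) > 0" using K by (intro sum_pos2[of K k0]) auto
  ultimately show False by linarith
qed

end

lemma map_alternating: "map f (alternating n s t) = alternating n (f s) (f t)"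
  by (induction n arbitrary: s t) auto

section \<open>Twisted involutions\<close>

locale twisted_coxeter = coxeter_system W S for W (structure) and S +
  fixes \<theta> :: "'a \<Rightarrow> 'a"
  assumes involutive: "involutive_automorphism W S \<theta>"
begin

lemma theta_hom: "\<theta> \<in> hom W W"
  using involutive by (simp add: involutive_automorphism_def iso_def)

lemma theta_closed [simp]: "x \<in> carrier W \<Longrightarrow> \<theta> x \<in> carrier W"
  using theta_hom by (auto simp: hom_def)

lemma theta_mult [simp]: "x \<in> carrier W \<Longrightarrow> y \<in> carrier W \<Longrightarrow> \<theta> (x \<otimes> y) = \<theta> x \<otimes> \<theta> y"
  using theta_hom by (auto simp: hom_def)

lemma theta_theta [simp]: "x \<in> carrier W \<Longrightarrow> \<theta> (\<theta> x) = x"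
  using involutive by (auto simp: involutive_automorphism_def)

lemma theta_S [simp]: "s \<in> S \<Longrightarrow> \<theta> s \<in> S"
  using involutive by (auto simp: involutive_automorphism_def)

lemma theta_one [simp]: "\<theta> \<one> = \<one>"
  by (metis theta_closed theta_mult one_closed l_cancel_one' r_one)

lemma theta_inv [simp]: "x \<in> carrier W \<Longrightarrow> \<theta> (inv x) = inv (\<theta> x)"
  by (metis inv_closed inv_equality l_inv theta_closed theta_mult theta_one)

lemma theta_eq_iff [simp]: "s \<in> S \<Longrightarrow> t \<in> S \<Longrightarrow> \<theta> s = \<theta> t \<longleftrightarrow> s = t"
  by (metis theta_theta S_carrier)

lemma theta_lists [simp]: "us \<in> lists S \<Longrightarrow> map \<theta> us \<in> lists S"
  by (auto simp: in_lists_conv_set)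

lemma theta_wp: "us \<in> lists S \<Longrightarrow> \<theta> (wp us) = wp (map \<theta> us)"
  by (induction us) auto

lemma theta_m: assumes "s \<in> S" "t \<in> S" shows "m (\<theta> s) (\<theta> t) = m s t"
proof -
  have "ord (\<theta> x) dvd ord x" if x: "x \<in> carrier W" for x
  proof -
    have "\<theta> (x [^] n) = \<theta> x [^] n" for n :: nat
      using x by (induction n) auto
    from this[of "ord x"] have "\<theta> x [^] ord x = \<one>" using x by simp
    thus ?thesis using x pow_eq_id by simp
  qed
  from this[of "s \<otimes> t"] this[of "\<theta> (s \<otimes> t)"] show ?thesis
    using assms by (simp add: cox_m_def dvd_antisym)
qed

lemma theta_c: "s \<in> S \<Longrightarrow> t \<in> S \<Longrightarrow> c (\<theta> s) (\<theta> t) = c s t"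
  by (simp add: c_def theta_m)

lemma A_theta: assumes "w \<in> carrier W" "r \<in> S" shows "A f (\<theta> w) (\<theta> r) = A (\<lambda>x. f (\<theta> x)) w r"
proof -
  obtain us where us: "us \<in> lists S" "wp us = w" using assms ex_word by metis
  have "\<forall>r\<in>S. play f (map \<theta> us) (\<theta> r) = play (\<lambda>x. f (\<theta> x)) us r"
    using us(1) by (induction us rule: rev_induct) (auto simp: fire_def theta_c)
  thus ?thesis using us assms A_wp[of us] A_wp[of "map \<theta> us"] theta_wp[of us] by auto
qed

lemma len_theta_le: assumes "w \<in> carrier W" shows "len (\<theta> w) \<le> len w"
proof -
  obtain us where us: "us \<in> lists S" "wp us = w" "length us = len w" using assms len_word by metis
  thus ?thesis using len_le[of "map \<theta> us"] theta_wp[of us] by auto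
qed

lemma len_theta [simp]: "w \<in> carrier W \<Longrightarrow> len (\<theta> w) = len w"
  using len_theta_le[of w] len_theta_le[of "\<theta> w"] by simp

text \<open>An anti-automorphism whose fixed points are the twisted involutions. It turns right
  multiplication by \<open>s\<close> into left multiplication by \<open>\<theta> s\<close>, so
  statements about one side carry over to the other.\<close>

definition \<tau> :: "'a \<Rightarrow> 'a" where "\<tau> z = \<theta> (inv z)"

lemma tau_closed [simp]: "z \<in> carrier W \<Longrightarrow> \<tau> z \<in> carrier W"
  by (simp add: \<tau>_def)

lemma tau_mult [simp]: "x \<in> carrier W \<Longrightarrow> y \<in> carrier W \<Longrightarrow> \<tau> (x \<otimes> y) = \<tau> y \<otimes> \<tau> x"
  by (simp add: \<tau>_def inv_mult_group)

lemma tau_tau [simp]: "x \<in> carrier W \<Longrightarrow> \<tau> (\<tau> x) = x"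
  by (simp add: \<tau>_def)

lemma tau_S [simp]: "s \<in> S \<Longrightarrow> \<tau> s = \<theta> s"
  by (simp add: \<tau>_def)

lemma tau_theta_S [simp]: "s \<in> S \<Longrightarrow> \<tau> (\<theta> s) = s"
  by (simp add: \<tau>_def)

lemma len_tau [simp]: "z \<in> carrier W \<Longrightarrow> len (\<tau> z) = len z"
  by (simp add: \<tau>_def del: theta_inv)

abbreviation \<I> :: "'a set" where "\<I> \<equiv> twisted_involutions W \<theta>"

lemma I_iff: "z \<in> \<I> \<longleftrightarrow> z \<in> carrier W \<and> \<tau> z = z"
proof (cases "z \<in> carrier W")
  case True
  have "\<theta> z = inv z \<longleftrightarrow> inv (\<theta> z) = inv (inv z)" using True by (metis inv_inv theta_closed inv_closed)
  thus ?thesis using True by (simp add: twisted_involutions_def \<tau>_def)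
qed (simp add: twisted_involutions_def)

lemma I_carrier [simp]: "z \<in> \<I> \<Longrightarrow> z \<in> carrier W" and I_tau [simp]: "z \<in> \<I> \<Longrightarrow> \<tau> z = z"
  by (simp_all add: I_iff)

lemma one_I [simp]: "\<one> \<in> \<I>"
  by (simp add: I_iff \<tau>_def)

abbreviation act :: "'a \<Rightarrow> 'a \<Rightarrow> 'a" where "act \<equiv> letter_act W \<theta>"
abbreviation acts :: "'a \<Rightarrow> 'a list \<Rightarrow> 'a" where "acts \<equiv> word_act W \<theta>"

lemma acts_simps [simp]: "acts z [] = z" "acts z (s # us) = acts (act z s) us" 
  "acts z (us @ vs) = acts (acts z us) vs"
  by (simp_all add: word_act_def)

definition onesided :: "'a \<Rightarrow> 'a \<Rightarrow> bool" where "onesided z s \<longleftrightarrow> \<theta> s \<otimes> z \<otimes> s = z"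

lemma onesided_iff: "z \<in> carrier W \<Longrightarrow> s \<in> S \<Longrightarrow> onesided z s \<longleftrightarrow> z \<otimes> s = \<theta> s \<otimes> z"
  unfolding onesided_def by (metis S_cancel_left S_carrier m_assoc m_closed theta_S)

lemma act_eq: "act z s = (if onesided z s then z \<otimes> s else \<theta> s \<otimes> z \<otimes> s)"
  by (simp add: letter_act_def onesided_def)

lemma act_I [simp]: assumes "z \<in> \<I>" "s \<in> S" shows "act z s \<in> \<I>"
proof (cases "onesided z s")
  case True
  hence "\<theta> s \<otimes> z = z \<otimes> s" using onesided_iff[of z s] assms by simp
  hence "\<tau> (z \<otimes> s) = z \<otimes> s" using assms by simp
  thus ?thesis using True assms unfolding I_iff act_eq by simp
next
  case False
  have "\<tau> (\<theta> s \<otimes> z \<otimes> s) = \<theta> s \<otimes> z \<otimes> s" using assms by (simp add: m_assoc)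
  thus ?thesis using False assms unfolding I_iff act_eq by simp
qed

lemma acts_I [simp]: "z \<in> \<I> \<Longrightarrow> us \<in> lists S \<Longrightarrow> acts z us \<in> \<I>"
  by (induction us arbitrary: z) auto

lemma act_act: assumes "z \<in> carrier W" "s \<in> S" shows "act (act z s) s = z"
proof (cases "onesided z s")
  case True
  hence "z \<otimes> s = \<theta> s \<otimes> z" using assms onesided_iff by blast
  hence "onesided (z \<otimes> s) s" using assms by (simp add: onesided_def)
  thus ?thesis using True assms by (simp add: act_eq)
next
  case False
  have "\<theta> s \<otimes> (\<theta> s \<otimes> z \<otimes> s) \<otimes> s = z" using assms by (simp add: m_assoc)
  hence "\<not> onesided (\<theta> s \<otimes> z \<otimes> s) s" using False unfolding onesided_def by metis
  thus ?thesis using False assms by (simp add: act_eq m_assoc)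
qed

lemma len_theta_left: "z \<in> \<I> \<Longrightarrow> s \<in> S \<Longrightarrow> len (\<theta> s \<otimes> z) = len (z \<otimes> s)"
  using len_tau[of "z \<otimes> s"] by simp

text \<open>If left multiplication by \<open>\<theta> s\<close> shortened z s, then
  \<open>exchange_sides\<close> would give \<theta>(s) z = z s, and the step would be one-sided. So
  a two-sided step gains length on both sides.\<close>

lemma asc_step:
  assumes z: "z \<in> \<I>" "s \<in> S" "\<not> desc z s"
  shows "desc (act z s) s" "onesided z s \<Longrightarrow> len (act z s) = len z + 1" 
    "\<not> onesided z s \<Longrightarrow> len (act z s) = len z + 2"
proof -
  have l: "len (z \<otimes> s) = len z + 1" using z len_asc by simp
  show 1: "len (act z s) = len z + 1" if "onesided z s" using that l by (simp add: act_eq)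
  show 2: "len (act z s) = len z + 2" if *: "\<not> onesided z s"
  proof -
    have "\<not> len (\<theta> s \<otimes> z \<otimes> s) < len (z \<otimes> s)" 
      using exchange_sides[of z s "\<theta> s"] z l len_theta_left[of z s] * onesided_iff[of z s] by force
    moreover have "len (\<theta> s \<otimes> z \<otimes> s) = len (z \<otimes> s) + 1 \<or> len (\<theta> s \<otimes> z \<otimes> s) < len (z \<otimes> s)"
      using len_mult_gen[of "\<tau> (z \<otimes> s)" s] len_tau[of "\<tau> (z \<otimes> s) \<otimes> s"] len_tau[of "z \<otimes> s"] z 
      by (auto simp: m_assoc)
    ultimately show ?thesis using * l by (simp add: act_eq)
  qed
  have "len (act z s \<otimes> s) = (if onesided z s then len z else len z + 1)"
    using z l len_theta_left[of z s] by (simp add: act_eq)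
  thus "desc (act z s) s" using 1 2 by (auto simp: desc_def)
qed

lemma desc_step:
  assumes z: "z \<in> \<I>" "s \<in> S" "desc z s"
  shows "\<not> desc (act z s) s" "len (act z s) < len z"
proof -
  have l: "len z = len (z \<otimes> s) + 1" using z len_desc by simp
  show *: "\<not> desc (act z s) s"
  proof
    assume d: "desc (act z s) s"
    show False
    proof (cases "onesided z s")
      case True
      thus False using d l z by (simp add: act_eq desc_def)
    next
      case False
      have "len (\<theta> s \<otimes> z) < len (\<theta> s \<otimes> z \<otimes> s)"
        using False d z by (simp add: act_eq desc_def)
      hence "\<theta> s \<otimes> (z \<otimes> s) = z \<otimes> s \<otimes> s"
        using exchange_sides[of "z \<otimes> s" s "\<theta> s"] z l len_theta_left[of z s] by (simp add: m_assoc)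
      thus False using False z by (simp add: onesided_def m_assoc)
    qed
  qed
  show "len (act z s) < len z" using asc_step[OF _ _ *] act_act[of z s] z 
    by (cases "onesided (act z s) s") auto
qed

fun ascw :: "'a \<Rightarrow> 'a list \<Rightarrow> bool" where
  "ascw z [] = True"
| "ascw z (s # us) = (s \<in> S \<and> \<not> desc z s \<and> ascw (act z s) us)"

lemma ascw_append [simp]: "ascw z (us @ vs) \<longleftrightarrow> ascw z us \<and> ascw (acts z us) vs"
  by (induction us arbitrary: z) auto

lemma ascw_lists: "ascw z us \<Longrightarrow> us \<in> lists S"
  by (induction us arbitrary: z) auto

section \<open>The Hecke monoid\<close>

text \<open>The Demazure product with a generator: \<open>R\<close> on the right by
  \<open>s\<close>, \<open>L\<close> on the left by \<open>\<theta> s\<close>. Both operations are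
  idempotent and never shorten an element.\<close>

definition R :: "'a \<Rightarrow> 'a \<Rightarrow> 'a" where "R z s = (if desc z s then z else z \<otimes> s)"
definition L :: "'a \<Rightarrow> 'a \<Rightarrow> 'a" where "L z s = \<tau> (R (\<tau> z) s)"
definition up :: "'a \<Rightarrow> 'a \<Rightarrow> 'a" where "up z s = L (R z s) s"

lemma R_closed [simp]: "z \<in> carrier W \<Longrightarrow> s \<in> S \<Longrightarrow> R z s \<in> carrier W"
  by (simp add: R_def)

lemma L_closed [simp]: "z \<in> carrier W \<Longrightarrow> s \<in> S \<Longrightarrow> L z s \<in> carrier W"
  by (simp add: L_def)

lemma L_eq: "z \<in> carrier W \<Longrightarrow> s \<in> S \<Longrightarrow> L z s = (if len (\<theta> s \<otimes> z) < len z then z else \<theta> s \<otimes> z)"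
  using len_tau[of "\<theta> s \<otimes> z"] by (simp add: L_def R_def desc_def)

lemma len_mult_theta: "z \<in> carrier W \<Longrightarrow> s \<in> S \<Longrightarrow> len (\<theta> s \<otimes> z) = len z + 1 \<or> len z = len (\<theta> s \<otimes> z) + 1"
  using len_mult_gen[of "\<tau> z" s] len_tau[of "\<theta> s \<otimes> z"] by simp

text \<open>The only critical case is that \<open>\<theta> t\<close> lengthens z but shortens z s.
  Then \<open>exchange_sides\<close> gives \<theta>(t) z = z s, and both sides equal this
  element.\<close>

lemma L_R_commute:
  assumes "z \<in> carrier W" "s \<in> S" "t \<in> S"
  shows "L (R z s) t = R (L z t) s"
proof -
  let ?t = "\<theta> t"
  have a: "?t \<otimes> (z \<otimes> s) = ?t \<otimes> z \<otimes> s" using assms by (simp add: m_assoc)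
  have lr: "len (z \<otimes> s) = len z + 1 \<or> len z = len (z \<otimes> s) + 1" using len_mult_gen assms by blast
  have ll: "len (?t \<otimes> z) = len z + 1 \<or> len z = len (?t \<otimes> z) + 1" using len_mult_theta assms by blast
  have lrl: "len (?t \<otimes> z \<otimes> s) = len (z \<otimes> s) + 1 \<or> len (z \<otimes> s) = len (?t \<otimes> z \<otimes> s) + 1" 
    using len_mult_theta[of "z \<otimes> s" t] assms by (simp add: m_assoc)
  have llr: "len (?t \<otimes> z \<otimes> s) = len (?t \<otimes> z) + 1 \<or> len (?t \<otimes> z) = len (?t \<otimes> z \<otimes> s) + 1" 
    using len_mult_gen[of "?t \<otimes> z" s] assms by simp
  have ex: "len (?t \<otimes> z) > len z \<Longrightarrow> len (?t \<otimes> z \<otimes> s) < len (z \<otimes> s) \<Longrightarrow> ?t \<otimes> z = z \<otimes> s"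
    using exchange_sides[of z s ?t] assms by simp
  show ?thesis
  proof (cases "len (?t \<otimes> z) > len z \<and> len (?t \<otimes> z \<otimes> s) < len (z \<otimes> s)")
    case True
    thus ?thesis using ex assms lr by (auto simp: R_def L_eq desc_def a)
  next
    case False
    thus ?thesis using assms lr ll lrl llr by (auto simp: R_def L_eq desc_def a)
  qed
qed

abbreviation RW where "RW \<equiv> foldl R"
abbreviation LW where "LW \<equiv> foldl L"
abbreviation upw where "upw \<equiv> foldl up"

lemma RW_closed [simp]: "z \<in> carrier W \<Longrightarrow> us \<in> lists S \<Longrightarrow> RW z us \<in> carrier W"
  by (induction us arbitrary: z) auto

lemma LW_closed [simp]: "z \<in> carrier W \<Longrightarrow> us \<in> lists S \<Longrightarrow> LW z us \<in> carrier W"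
  by (induction us arbitrary: z) auto

lemma LW_tau: "z \<in> carrier W \<Longrightarrow> us \<in> lists S \<Longrightarrow> LW z us = \<tau> (RW (\<tau> z) us)"
  by (induction us arbitrary: z) (auto simp: L_def)

lemma R_LW_commute: "z \<in> carrier W \<Longrightarrow> s \<in> S \<Longrightarrow> us \<in> lists S \<Longrightarrow> R (LW z us) s = LW (R z s) us"
  by (induction us arbitrary: z) (auto simp: L_R_commute)

lemma RW_LW_commute: "z \<in> carrier W \<Longrightarrow> us \<in> lists S \<Longrightarrow> vs \<in> lists S \<Longrightarrow> RW (LW z us) vs = LW (RW z vs) us"
  by (induction vs arbitrary: z) (auto simp: R_LW_commute)

text \<open>By commutation, all right factors can be applied before all left ones; each side can
  then be treated by ordinary Coxeter combinatorics.\<close>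

lemma upw_eq: "z \<in> carrier W \<Longrightarrow> us \<in> lists S \<Longrightarrow> upw z us = LW (RW z us) us"
proof (induction us rule: rev_induct)
  case (snoc s us)
  thus ?case using R_LW_commute[of "RW z us" s us] by (auto simp: up_def)
qed simp

text \<open>In the one-sided case the left factor would undo the right one, so \<open>L\<close> does
  nothing: both cases of the letter action come out of one formula.\<close>

lemma up_asc: assumes "z \<in> \<I>" "s \<in> S" "\<not> desc z s" shows "up z s = act z s"
proof -
  have l: "len (z \<otimes> s) = len z + 1" using assms len_asc by simp
  have a: "\<theta> s \<otimes> (z \<otimes> s) = \<theta> s \<otimes> z \<otimes> s" using assms by (simp add: m_assoc)
  have "up z s = (if len (\<theta> s \<otimes> z \<otimes> s) < len (z \<otimes> s) then z \<otimes> s else \<theta> s \<otimes> z \<otimes> s)"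
    using assms by (simp add: up_def R_def L_eq a)
  thus ?thesis using asc_step(2,3)[OF assms] l unfolding act_eq
    by (cases "onesided z s") (auto simp: onesided_def)
qed

lemma up_desc: "z \<in> \<I> \<Longrightarrow> s \<in> S \<Longrightarrow> desc z s \<Longrightarrow> up z s = z"
  by (simp add: up_def R_def L_def)

lemma up_I [simp]: "z \<in> \<I> \<Longrightarrow> s \<in> S \<Longrightarrow> up z s \<in> \<I>"
  using up_asc[of z s] up_desc[of z s] by (cases "desc z s") auto

lemma desc_up: "z \<in> \<I> \<Longrightarrow> s \<in> S \<Longrightarrow> desc (up z s) s"
  using up_asc[of z s] up_desc[of z s] asc_step(1)[of z s] by (cases "desc z s") auto

lemma upw_I [simp]: "z \<in> \<I> \<Longrightarrow> us \<in> lists S \<Longrightarrow> upw z us \<in> \<I>"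
  by (induction us arbitrary: z) auto

lemma upw_stable: "z \<in> \<I> \<Longrightarrow> us \<in> lists {s \<in> S. desc z s} \<Longrightarrow> upw z us = z"
  by (induction us) (auto simp: up_desc)

lemma RW_alternating:
  assumes "y \<in> carrier W" "s \<in> S" "t \<in> S" "\<And>j. j < n \<Longrightarrow> \<not> desc (y \<otimes> wp (alternating j s t)) (ltr j s t)"
  shows "RW y (alternating n s t) = y \<otimes> wp (alternating n s t) \<and> len (y \<otimes> wp (alternating n s t)) = len y + n"
  using assms(4)
proof (induction n)
  case 0
  then show ?case using assms by simp
next
  case (Suc n)
  have r: "ltr n s t \<in> S" and al: "alternating n s t \<in> lists S" using assms alternating_lists[of s S t]
    by (auto simp: ltr_def)
  have IH: "RW y (alternating n s t) = y \<otimes> wp (alternating n s t)" "len (y \<otimes> wp (alternating n s t)) = len y + n"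
    using Suc by auto
  have d: "\<not> desc (y \<otimes> wp (alternating n s t)) (ltr n s t)" using Suc.prems by simp
  have e: "y \<otimes> wp (alternating (Suc n) s t) = y \<otimes> wp (alternating n s t) \<otimes> ltr n s t"
    unfolding alternating_snoc using r al assms by (simp add: m_assoc)
  have "RW y (alternating (Suc n) s t) = R (RW y (alternating n s t)) (ltr n s t)"
    unfolding alternating_snoc by simp
  also have "\<dots> = y \<otimes> wp (alternating n s t) \<otimes> ltr n s t" unfolding IH by (simp add: R_def d)
  finally show ?case using len_asc[OF _ r d] al assms IH(2) unfolding e by simp
qed

lemma A_alternating:
  assumes "y \<in> carrier W" "s \<in> S" "t \<in> S"
  shows "A f (y \<otimes> wp (alternating j s t)) (ltr j s t) = cheb (c s t) (Suc j) * A f y s + cheb (c s t) j * A f y t"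
    "A f (y \<otimes> wp (alternating (Suc j) s t)) (ltr j s t) = - (cheb (c s t) (Suc j) * A f y s + cheb (c s t) j * A f y t)"
  using assms play_alternating[of s t "A f y" j] alternating_lists[of s S t]
  by (simp_all add: A_mult A_wp del: alternating.simps)

text \<open>The root of the next letter is a combination of y \<alpha>_s and y \<alpha>_t whose
  coefficients, by \<open>cheb_dihedral\<close>, are nonnegative and not both zero.\<close>

lemma alternating_asc:
  assumes "y \<in> carrier W" "s \<in> S" "t \<in> S" "s \<noteq> t" "\<not> desc y s" "\<not> desc y t" "m s t = 0 \<or> n \<le> m s t"
  shows "RW y (alternating n s t) = y \<otimes> wp (alternating n s t)" "len (y \<otimes> wp (alternating n s t)) = len y + n"
proof -
  have "\<not> desc (y \<otimes> wp (alternating j s t)) (ltr j s t)" if "j < n" for j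
  proof -
    have r: "ltr j s t \<in> S" and al: "alternating j s t \<in> lists S" using assms alternating_lists[of s S t]
      by (auto simp: ltr_def)
    let ?x = "A (\<lambda>_. 1) y s" and ?y = "A (\<lambda>_. 1) y t"
    have "?x > 0" "?y > 0" using asc_pos[of y _ "\<lambda>_. 1"] assms by auto
    moreover have "cheb (c s t) (Suc j) \<ge> 0" "cheb (c s t) j \<ge> 0" "cheb (c s t) (Suc j) > 0 \<or> cheb (c s t) j > 0"
      using cheb_dihedral[OF assms(2-4), of j] assms(7) that by auto
    ultimately have "cheb (c s t) (Suc j) * ?x + cheb (c s t) j * ?y > 0"
      by (auto intro: add_pos_nonneg add_nonneg_pos)
    thus ?thesis using desc_iff[OF _ r] assms al A_alternating(1)[of y s t "\<lambda>_. 1" j] by auto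
  qed
  from RW_alternating[OF assms(1-3) this] 
  show "RW y (alternating n s t) = y \<otimes> wp (alternating n s t)" "len (y \<otimes> wp (alternating n s t)) = len y + n" by auto
qed

lemma play_vanish: "us \<in> lists K \<Longrightarrow> (\<And>k. k \<in> K \<Longrightarrow> f k = 0) \<Longrightarrow> play f us = f"
  by (induction us) (auto simp: fire_def)

lemma len_R: "z \<in> carrier W \<Longrightarrow> s \<in> S \<Longrightarrow> len (R z s) \<ge> len z"
  using len_asc[of z s] by (auto simp: R_def)

end

section \<open>Two descents\<close>

context twisted_coxeter
begin

text \<open>Written with \<open>up\<close> because the climb may arrive before all
  \<open>m s t\<close> letters are spent; the surplus letters then have no effect.\<close>

definition local_top :: "'a \<Rightarrow> 'a \<Rightarrow> 'a \<Rightarrow> 'a" where "local_top u s t = upw u (alternating (m s t) s t)"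

text \<open>\<open>w \<alpha>\<^sub>x = - \<alpha>\<^bsub>\<theta> y\<^esub>\<close>; in particular \<open>w x w\<^sup>-\<^sup>1 = \<theta> y\<close>.\<close>

definition psi :: "'a \<Rightarrow> 'a \<Rightarrow> 'a \<Rightarrow> bool" where "psi w x y \<longleftrightarrow> (\<forall>f. A f w x = - f (\<theta> y))"

text \<open>Left multiplication by \<open>\<theta> p\<close> still shortens z, and multiplying by
  \<open>r\<close> on the right costs at most one letter. In a climb with two letters, a one-sided
  step after the first is therefore the last.\<close>

lemma onesided_last:
  assumes "z \<in> \<I>" "p \<in> S" "r \<in> S" "desc z p" "\<not> desc z r" "onesided z r"
  shows "desc (act z r) p"
proof -
  have I: "act z r \<in> \<I>" using assms by simp
  have e: "act z r = z \<otimes> r" using assms by (simp add: act_eq)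
  have "len (act z r \<otimes> p) = len (\<theta> p \<otimes> act z r)" using len_theta_left[OF I assms(2)] by simp
  also have "\<dots> = len (\<theta> p \<otimes> z \<otimes> r)" using e assms by (simp add: m_assoc)
  also have "\<dots> \<le> len (\<theta> p \<otimes> z) + 1" using len_mult_le[of "\<theta> p \<otimes> z" r] len_gen_le[of r] assms by simp
  also have "\<dots> = len (z \<otimes> p) + 1" using len_theta_left assms by simp
  also have "\<dots> = len z" using len_desc assms by simp
  also have "\<dots> < len (act z r)" using len_asc assms e by simp
  finally show ?thesis by (simp add: desc_def)
qed

lemma LW_stable: "z \<in> \<I> \<Longrightarrow> us \<in> lists {s \<in> S. desc z s} \<Longrightarrow> LW z us = z"
  by (induction us) (auto simp: L_def R_def)

lemma conj_word:
  assumes "u \<in> carrier W" "K \<subseteq> S" "\<And>x. x \<in> K \<Longrightarrow> \<pi> x \<in> S" "\<And>x. x \<in> K \<Longrightarrow> u \<otimes> x = \<pi> x \<otimes> u" "us \<in> lists K"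
  shows "u \<otimes> wp us = wp (map \<pi> us) \<otimes> u"
  using assms(5)
proof (induction us)
  case (Cons x us)
  have us: "us \<in> lists S" "map \<pi> us \<in> lists S" using Cons assms by (auto simp: in_lists_conv_set)
  have x: "x \<in> S" "\<pi> x \<in> S" using Cons assms by auto
  have "u \<otimes> wp (x # us) = u \<otimes> x \<otimes> wp us" using us x assms by (simp add: m_assoc)
  also have "\<dots> = \<pi> x \<otimes> (u \<otimes> wp us)" using assms(4)[of x] Cons us x assms by (simp add: m_assoc)
  also have "\<dots> = wp (map \<pi> (x # us)) \<otimes> u" using Cons us x assms by (simp add: m_assoc)
  finally show ?case .
qed (use assms in simp)

context
  fixes u s t
  assumes u: "u \<in> \<I>" and s: "s \<in> S" and t: "t \<in> S" and st: "s \<noteq> t"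
    and asc: "\<not> desc u s" "\<not> desc u t" and m_pos: "m s t > 0"
begin

lemma alt_S [simp]: "alternating n s t \<in> lists S" "alternating n t s \<in> lists S" "ltr n s t \<in> S" "ltr n t s \<in> S"
  using alternating_lists[of _ S] s t by (auto simp: ltr_def)

lemma longest_word: "wp (alternating (m s t) s t) = wp (alternating (m s t) t s)"
  by (rule braid[OF s t m_pos])

lemma local_top_eq: "local_top u s t = LW (u \<otimes> wp (alternating (m s t) s t)) (alternating (m s t) s t)"
  unfolding local_top_def using alternating_asc[of u s t] upw_eq[of u "alternating (m s t) s t"] u s t st asc by simp

text \<open>Left and right operators commute, and on \<open>u\<close> both satisfy the braid relation.\<close>

lemma local_top_sym: "local_top u s t = local_top u t s"
proof -
  let ?a = "alternating (m s t) s t" and ?b = "alternating (m s t) t s"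
  have a: "RW u ?a = u \<otimes> wp ?a" using alternating_asc[of u s t] u s t st asc by simp
  have b: "RW u ?b = u \<otimes> wp ?b" using alternating_asc[of u t s "m s t"] m_sym[of t s] u s t st asc by simp
  have ab: "RW u ?a = RW u ?b" unfolding a b longest_word ..
  have "LW u ?a = \<tau> (RW u ?a)" "LW u ?b = \<tau> (RW u ?b)" using u LW_tau[of u] by simp_all
  hence l: "LW u ?a = LW u ?b" using ab by simp
  have "local_top u s t = LW (RW u ?a) ?a" unfolding local_top_def using upw_eq u by simp
  also have "\<dots> = RW (LW u ?a) ?b" unfolding ab using RW_LW_commute[of u ?a ?b] u by simp
  also have "\<dots> = LW (RW u ?b) ?b" unfolding l using RW_LW_commute[of u ?b ?b] u by simp
  also have "\<dots> = local_top u t s" unfolding local_top_def using upw_eq u m_sym[of t s] s t by simp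
  finally show ?thesis .
qed

lemma local_top_I: "local_top u s t \<in> \<I>"
  unfolding local_top_def using u by simp

lemma desc_local_top_last: "desc (local_top u s t) (ltr (m s t - 1) s t)"
proof -
  obtain k where k: "m s t = Suc k" using m_pos by (cases "m s t") auto
  show ?thesis unfolding local_top_def k alternating_snoc using desc_up u by simp
qed

end

context
  fixes u s t
  assumes u: "u \<in> \<I>" and s: "s \<in> S" and t: "t \<in> S" and st: "s \<noteq> t"
    and asc: "\<not> desc u s" "\<not> desc u t" and m_pos: "m s t > 0"
begin

lemmas ctx = u s t st asc m_pos
lemma ctx': "u \<in> \<I>" "t \<in> S" "s \<in> S" "t \<noteq> s" "\<not> desc u t" "\<not> desc u s" "m t s > 0"
  using ctx m_sym[of s t] by auto

text \<open>The last letter written is a descent; by symmetry the top is also reached by the word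
  that ends in the other letter.\<close>

lemma desc_local_top: "desc (local_top u s t) s" "desc (local_top u s t) t"
proof -
  obtain k where k: "m s t = Suc k" using m_pos by (cases "m s t") auto
  have m: "m t s = m s t" using m_sym s t by simp
  have "desc (local_top u s t) (ltr k s t)" "desc (local_top u s t) (ltr k t s)"
    using desc_local_top_last[OF ctx] desc_local_top_last[OF ctx'] local_top_sym[OF ctx] k m by simp_all
  thus "desc (local_top u s t) s" "desc (local_top u s t) t" by (auto simp: ltr_def split: if_splits)
qed

lemma upw_local_top: "us \<in> lists {s, t} \<Longrightarrow> upw (local_top u s t) us = local_top u s t"
  using desc_local_top s t by (intro upw_stable local_top_I[OF ctx]) (auto simp: in_lists_conv_set)

text \<open>Only the first and the last step of the walk from \<open>u\<close> up to \<open>local_top u s t\<close> can be one-sided.\<close>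

lemma walk:
  obtains n \<delta> where "1 \<le> n" "n \<le> m s t" "ascw u (alternating n s t)" "acts u (alternating n s t) = local_top u s t"
    "\<delta> \<le> 1" "len (local_top u s t) + (if onesided u s then 1 else 0) + \<delta> = len u + 2 * n"
proof -
  define z where "z = (\<lambda>j. upw u (alternating j s t))"
  let ?l = "\<lambda>j. ltr j s t"
  have al: "alternating j s t \<in> lists S" "?l j \<in> S" for j using alt_S[OF ctx] by auto
  have zI: "z j \<in> \<I>" for j using u al by (simp add: z_def)
  have z0: "z 0 = u" by (simp add: z_def)
  have zSuc: "z (Suc j) = up (z j) (?l j)" for j by (simp add: z_def alternating_snoc del: alternating.simps)
  \<comment> \<open>At the first \<open>n\<close> whose next letter is already a descent, the letter
    just written is a descent too. So \<open>z n\<close> is stable under both letters and equals the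
    top.\<close>
  define n where "n = (LEAST n. desc (z n) (?l n))"
  have zm: "z (m s t) = local_top u s t" by (simp add: z_def local_top_def)
  have ex: "desc (z (m s t)) (?l (m s t))" using desc_local_top by (simp add: zm ltr_def)
  have dn: "desc (z n) (?l n)" unfolding n_def by (rule LeastI[of "\<lambda>n. desc (z n) (?l n)", OF ex])
  have nm: "n \<le> m s t" unfolding n_def by (rule Least_le[of "\<lambda>n. desc (z n) (?l n)", OF ex])
  have nd: "\<not> desc (z j) (?l j)" if "j < n" for j using not_less_Least[of j "\<lambda>n. desc (z n) (?l n)"] that n_def by auto
  have n1: "n \<ge> 1" using dn z0 asc by (cases n) auto
  have zs: "z (Suc j) = act (z j) (?l j)" if "j < n" for j using zSuc up_asc[OF zI al(2) nd[OF that]] by simp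
  have last: "desc (z (Suc j)) (?l j)" for j using zSuc desc_up zI al by simp
  have walk: "ascw u (alternating j s t) \<and> acts u (alternating j s t) = z j" if "j \<le> n" for j
    using that
  proof (induction j)
    case (Suc j)
    thus ?case unfolding alternating_snoc using zs[of j] nd[of j] al by simp
  qed (simp add: z0)
  obtain n' where n': "n = Suc n'" using n1 by (cases n) auto
  have both: "desc (z n) s" "desc (z n) t" using dn last[of n'] n' ltr_cases[of n' s t] by auto
  have "local_top u s t = upw (z n) (alternating (m s t - n) (?l n) (?l (Suc n)))"
    using alternating_add[of n "m s t - n" s t] nm by (simp add: local_top_def z_def)
  also have "\<dots> = z n" using both s t ltr_cases[of n s t] 
    by (intro upw_stable zI alternating_lists) auto
  finally have top: "local_top u s t = z n" .
  let ?e = "if onesided u s then 1 else 0 :: nat"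
  have len1: "len (z (Suc j)) + ?e = len u + 2 * Suc j" if "Suc j < n \<or> j = 0" "Suc j \<le> n" for j
    using that
  proof (induction j)
    case 0
    show ?case using zs[of 0] asc_step(2,3)[OF u s asc(1)] n1 by (simp add: z0)
  next
    case (Suc j)
    have j: "Suc j < n" using Suc by auto
    \<comment> \<open>By \<open>onesided_last\<close> a one-sided step here would make the letter
      after it a descent, and the walk would have stopped before \<open>n\<close>.\<close>
    have "\<not> onesided (z (Suc j)) (?l (Suc j))"
    proof
      assume "onesided (z (Suc j)) (?l (Suc j))"
      hence "desc (z (Suc (Suc j))) (?l j)"
        using onesided_last[OF zI al(2) al(2) last nd[OF j]] zs[OF j] by simp
      hence "desc (z (Suc (Suc j))) (?l (Suc (Suc j)))" by simp
      thus False using nd[of "Suc (Suc j)"] Suc by auto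
    qed
    thus ?case using asc_step(3)[OF zI al(2) nd[OF j]] zs[OF j] Suc by simp
  qed
  show ?thesis
  proof (cases n')
    case 0
    thus ?thesis using that[of n 0] n1 nm walk[of n] top len1[of 0] n' by simp
  next
    case (Suc j)
    have "len (z (Suc j)) + ?e = len u + 2 * Suc j" using len1[of j] Suc n' by simp
    moreover have "len (z n) = len (z (Suc j)) + 1 \<or> len (z n) = len (z (Suc j)) + 2"
      using asc_step(2,3)[OF zI al(2) nd, of "Suc j"] zs[of "Suc j"] Suc n' by auto
    ultimately show ?thesis using that[of n 0] that[of n 1] n1 nm walk[of n] top Suc n' by auto
  qed
qed

lemma A_long_left: 
  assumes "f (\<theta> s) = 0" "f (\<theta> t) = 0" "x \<in> carrier W"
  shows "A f (\<tau> (wp (alternating n s t)) \<otimes> x) = A f x"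
proof -
  let ?a = "rev (map \<theta> (alternating n s t))"
  have l: "?a \<in> lists {\<theta> s, \<theta> t}" unfolding map_alternating 
    using alternating_lists[of "\<theta> s" "{\<theta> s, \<theta> t}" "\<theta> t" n] by (auto simp: in_lists_conv_set)
  hence lS: "?a \<in> lists S" using s t by (auto simp: in_lists_conv_set)
  have al: "alternating n s t \<in> lists S" using alt_S[OF ctx] by simp
  have "\<tau> (wp (alternating n s t)) = inv (wp (map \<theta> (alternating n s t)))"
    using al by (simp add: \<tau>_def theta_wp)
  also have "\<dots> = wp ?a" using al by (intro wp_rev[symmetric] theta_lists)
  finally have "A f (\<tau> (wp (alternating n s t))) = f"
    using A_wp[OF lS] play_vanish[OF l] assms by auto
  thus ?thesis using assms al by (simp add: A_mult)
qed

text \<open>The hypothesis says that \<open>u \<alpha>\<^sub>s\<close> is not a combination of \<open>\<alpha>\<^bsub>\<theta> s\<^esub>\<close> and \<open>\<alpha>\<^bsub>\<theta> t\<^esub>\<close>; \<open>f\<close> is blind to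
  left factors from the parabolic subgroup of \<open>\<theta>({s,t})\<close>.\<close>

lemma local_top_long:
  assumes f: "\<And>r. f r \<ge> 0" "f (\<theta> s) = 0" "f (\<theta> t) = 0" "A f u s > 0"
  shows "len (local_top u s t) + 1 \<ge> len u + 2 * m s t"
proof -
  let ?k = "m s t" and ?w = "wp (alternating (m s t) s t)"
  note al = alt_S[OF ctx]
  \<comment> \<open>Applying \<tau> turns the left climb into a right climb that starts at \<tau>(u
    w) = \<tau>(w) u.\<close>
  let ?y = "\<tau> ?w \<otimes> u"
  have yc: "?y \<in> carrier W" using al u by simp
  have top: "local_top u s t = \<tau> (RW ?y (alternating ?k s t))"
    unfolding local_top_eq[OF ctx] using LW_tau al u by simp
  have y: "len ?y = len u + ?k"
    using len_tau[of "u \<otimes> ?w"] alternating_asc(2)[of u s t ?k] al ctx by simp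
  obtain k where k: "?k = Suc k" using m_pos by (cases "m s t") auto
  have Aus: "A f ?y s = A f u s" "A f ?y t = A f u t" using A_long_left[of f u] f u by simp_all
  \<comment> \<open>The coefficient of \<open>A f u s\<close> is positive for all but the last of
    the \<open>m s t\<close> letters and vanishes there; this is the +1 in the bound.\<close>
  have "\<not> desc (?y \<otimes> wp (alternating j s t)) (ltr j s t)" if j: "j < k" for j
  proof -
    have "A f u t \<ge> 0" using asc_nonneg f ctx by simp
    moreover have "cheb (c s t) j \<ge> 0" "cheb (c s t) (Suc j) > 0"
      using cheb_dihedral(2,4)[OF s t st, of j] j k by auto
    ultimately have "A f (?y \<otimes> wp (alternating j s t)) (ltr j s t) > 0"
      using A_alternating(1)[OF yc s t, of f j] f Aus by (simp add: add_pos_nonneg)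
    thus ?thesis using desc_nonpos[of "?y \<otimes> wp (alternating j s t)" "ltr j s t" f] f yc al by fastforce
  qed
  from RW_alternating[OF yc s t this] 
  have "len (RW ?y (alternating k s t)) = len ?y + k" by simp
  moreover have "RW ?y (alternating ?k s t) = R (RW ?y (alternating k s t)) (ltr k s t)"
    unfolding k alternating_snoc by simp
  ultimately have "len (RW ?y (alternating ?k s t)) \<ge> len ?y + k"
    using len_R[of "RW ?y (alternating k s t)" "ltr k s t"] yc al by simp
  moreover have "len (local_top u s t) = len (RW ?y (alternating ?k s t))"
    unfolding top using yc al by (intro len_tau RW_closed)
  ultimately show ?thesis using y k by linarith
qed

text \<open>By hypothesis u \<alpha>_s and u \<alpha>_t lie in the span of \<alpha>_\<theta>(s) and
  \<alpha>_\<theta>(t), with a nonnegative coefficient matrix. Since \<theta>(u) = u^-1, this matrix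
  is its own inverse, hence the identity or a scaled swap, and \<open>root_scale\<close> removes the
  scaling.\<close>

lemma normalizing_cases:
  assumes "\<And>f r. (\<And>q. f q \<ge> 0) \<Longrightarrow> f (\<theta> s) = 0 \<Longrightarrow> f (\<theta> t) = 0 \<Longrightarrow> r \<in> {s, t} \<Longrightarrow> A f u r \<le> 0"
  shows "(\<forall>f. A f u s = f (\<theta> s)) \<and> (\<forall>f. A f u t = f (\<theta> t)) \<or> (\<forall>f. A f u s = f (\<theta> t)) \<and> (\<forall>f. A f u t = f (\<theta> s))"
proof -
  have 0: "A f u r = 0" if "\<And>q. f q \<ge> 0" "f (\<theta> s) = 0" "f (\<theta> t) = 0" "r \<in> {s, t}" for f r
  proof (rule antisym)
    show "A f u r \<le> 0" using that by (rule assms)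
    show "A f u r \<ge> 0" using that(4) ctx by (intro asc_nonneg that(1)) auto
  qed
  let ?e = "\<lambda>p r. if r = p then 1 else 0 :: real"
  define k1 k2 l1 l2 where "k1 = A (?e (\<theta> s)) u s" and "k2 = A (?e (\<theta> t)) u s" 
    and "l1 = A (?e (\<theta> s)) u t" and "l2 = A (?e (\<theta> t)) u t"
  have ne: "\<theta> s \<noteq> \<theta> t" using s t st by simp
  have ks: "A f u s = k1 * f (\<theta> s) + k2 * f (\<theta> t)" for f
    unfolding k1_def k2_def by (rule span_two[OF 0 ne]) auto
  have kt: "A f u t = l1 * f (\<theta> s) + l2 * f (\<theta> t)" for f
    unfolding l1_def l2_def by (rule span_two[OF 0 ne]) auto
  have nn: "k1 \<ge> 0" "k2 \<ge> 0" "l1 \<ge> 0" "l2 \<ge> 0"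
    unfolding k1_def k2_def l1_def l2_def by (rule asc_nonneg[OF _ _ _]; simp add: u s t asc)+
  have th: "\<theta> u = inv u" using u unfolding twisted_involutions_def by blast
  have inv: "A f (inv u) (\<theta> s) = k1 * f s + k2 * f t" "A f (inv u) (\<theta> t) = l1 * f s + l2 * f t" for f
    using A_theta[of u s f, unfolded th ks] A_theta[of u t f, unfolded th kt] u s t by simp_all
  have s2: "f s = k1 * (k1 * f s + k2 * f t) + k2 * (l1 * f s + l2 * f t)" for f
  proof -
    have "f s = A (A f (inv u)) u s" using u by simp
    also have "\<dots> = k1 * A f (inv u) (\<theta> s) + k2 * A f (inv u) (\<theta> t)" by (rule ks)
    finally show ?thesis unfolding inv .
  qed
  have t2: "f t = l1 * (k1 * f s + k2 * f t) + l2 * (l1 * f s + l2 * f t)" for f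
  proof -
    have "f t = A (A f (inv u)) u t" using u by simp
    also have "\<dots> = l1 * A f (inv u) (\<theta> s) + l2 * A f (inv u) (\<theta> t)" by (rule kt)
    finally show ?thesis unfolding inv .
  qed
  have e: "k1 * k1 + k2 * l1 = 1" "k1 * k2 + k2 * l2 = 0" "l1 * k1 + l2 * l1 = 0" "l1 * k2 + l2 * l2 = 1"
    using s2[of "?e s", symmetric] s2[of "?e t", symmetric] t2[of "?e s", symmetric] t2[of "?e t", symmetric] st 
    by simp_all
  have k2l2: "k1 * k2 = 0" "k2 * l2 = 0" "l1 * k1 = 0" "l2 * l1 = 0" 
    using e(2,3) nn add_nonneg_eq_0_iff[of "k1 * k2" "k2 * l2"] add_nonneg_eq_0_iff[of "l1 * k1" "l2 * l1"] by simp_all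
  show ?thesis
  proof (cases "k2 = 0")
    case True
    hence "k1 * k1 = 1" using e(1) by simp
    hence k1: "k1 = 1" using nn square_eq_1_iff[of k1] by auto
    have l1: "l1 = 0" using k2l2(3) k1 by simp
    hence "l2 * l2 = 1" using e(4) by simp
    hence "l2 = 1" using nn square_eq_1_iff[of l2] by auto
    with k1 l1 show ?thesis using ks kt True by simp
  next
    case False
    hence k1: "k1 = 0" and l2: "l2 = 0" using k2l2 by simp_all
    have "k2 = 1" using root_scale[of u s "\<theta> t" k2] ks k1 nn ctx by fastforce
    moreover have "l1 = 1" using e(1) calculation k1 by simp
    ultimately show ?thesis using ks kt k1 l2 by simp
  qed
qed

end

lemma psi_carrier: "w \<in> carrier W \<Longrightarrow> x \<in> S \<Longrightarrow> y \<in> S \<Longrightarrow> psi w x y \<Longrightarrow> w \<otimes> x = \<theta> y \<otimes> w"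
  using root_transport_neg[of w x "\<theta> y"] by (simp add: psi_def)

lemma psi_unique: assumes "psi w x y" "psi w x z" "y \<in> S" "z \<in> S" shows "y = z"
proof (rule ccontr)
  assume "y \<noteq> z"
  hence "\<theta> y \<noteq> \<theta> z" using assms by simp
  moreover have "f (\<theta> y) = f (\<theta> z)" for f :: "'a \<Rightarrow> real" using assms(1,2) by (simp add: psi_def)
  from this[of "\<lambda>r. if r = \<theta> y then 1 else 0"] have "\<theta> y = \<theta> z" by (simp split: if_splits)
  ultimately show False by simp
qed

text \<open>The first step is one-sided, and so is the last if m(s,t) is even; all others gain
  length 2. A total gain of m(s,t) gives \<open>n\<close>. The parity decides whether the longest
  dihedral element fixes or exchanges the two letters. In \<open>normal_swap\<close> the first step
  is two-sided.\<close>

definition normal_id :: "'a \<Rightarrow> 'a \<Rightarrow> 'a \<Rightarrow> nat \<Rightarrow> bool" where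
  "normal_id u s t n \<longleftrightarrow> u \<otimes> s = \<theta> s \<otimes> u \<and> u \<otimes> t = \<theta> t \<otimes> u \<and> n = (m s t + 2) div 2 \<and>
     (let w = local_top u s t in if even (m s t) then psi w s s \<and> psi w t t else psi w s t \<and> psi w t s)"

definition normal_swap :: "'a \<Rightarrow> 'a \<Rightarrow> 'a \<Rightarrow> nat \<Rightarrow> bool" where
  "normal_swap u s t n \<longleftrightarrow> u \<otimes> s = \<theta> t \<otimes> u \<and> u \<otimes> t = \<theta> s \<otimes> u \<and> n = (m s t + 1) div 2 \<and>
     (let w = local_top u s t in if even (m s t) then psi w s t \<and> psi w t s else psi w s s \<and> psi w t t)"

context
  fixes u s t
  assumes u: "u \<in> \<I>" and s: "s \<in> S" and t: "t \<in> S" and st: "s \<noteq> t"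
    and asc: "\<not> desc u s" "\<not> desc u t" and m_pos: "m s t > 0"
begin

lemmas base = u s t st asc m_pos
lemmas base' = ctx'[OF base]
lemmas al = alt_S[OF base]

lemma transport: "x \<in> S \<Longrightarrow> y \<in> S \<Longrightarrow> \<forall>f. A f u x = f y \<Longrightarrow> u \<otimes> x = y \<otimes> u"
  by (rule root_transport) (use u in auto)

lemma A_longest:
  assumes "x \<in> carrier W"
  shows "A f (x \<otimes> wp (alternating (m s t) s t)) s = - A f x (if even (m s t) then s else t)"
    "A f (x \<otimes> wp (alternating (m s t) s t)) t = - A f x (if even (m s t) then t else s)"
proof -
  let ?w = "wp (alternating (m s t) s t)"
  obtain k where k: "m s t = Suc k" using m_pos by (cases "m s t") auto
  have cheb: "cheb (c s t) (Suc k) = 0" "cheb (c s t) k = 1"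
    using cheb_cos_zero[OF m_ge_2[OF s t st m_pos] c_def refl] k by simp_all
  have cts: "c t s = c s t" using c_sym s t by simp
  have 1: "A f (x \<otimes> ?w) (ltr k s t) = - A f x t" 
    using A_alternating(2)[OF assms s t, of f k] cheb unfolding k by simp
  have 2: "A f (x \<otimes> ?w) (ltr k t s) = - A f x s" 
    using A_alternating(2)[OF assms t s, of f k] cheb cts longest_word[OF base] unfolding k by simp
  show "A f (x \<otimes> ?w) s = - A f x (if even (m s t) then s else t)"
    "A f (x \<otimes> ?w) t = - A f x (if even (m s t) then t else s)"
    using 1 2 unfolding k by (auto simp: ltr_def split: if_splits)
qed

text \<open>Conjugation by \<open>u\<close> sends the longest dihedral element w to \<theta>(w), so
  u w is already a twisted involution with both descents and the left climb adds nothing. Descents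
  of \<open>u\<close> survive because u w = \<theta>(w) u with additive lengths.\<close>

lemma normal_local_top:
  assumes n: "(\<forall>f. A f u s = f (\<theta> s)) \<and> (\<forall>f. A f u t = f (\<theta> t)) \<or> (\<forall>f. A f u s = f (\<theta> t)) \<and> (\<forall>f. A f u t = f (\<theta> s))"
  shows "local_top u s t = u \<otimes> wp (alternating (m s t) s t)"
    "len (local_top u s t) = len u + m s t"
    "\<And>r. r \<in> S \<Longrightarrow> desc u r \<Longrightarrow> desc (local_top u s t) r"
proof -
  let ?w = "wp (alternating (m s t) s t)"
  have tw: "\<theta> ?w = wp (map \<theta> (alternating (m s t) s t))" using al by (intro theta_wp)
  have tw': "\<theta> ?w = wp (map \<theta> (alternating (m s t) t s))" unfolding longest_word[OF base] using al by (intro theta_wp)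
  have uc: "u \<in> carrier W" using u by simp
  have sub: "{s,t} \<subseteq> S" using s t by simp
  have al': "alternating (m s t) s t \<in> lists {s, t}" by (rule alternating_lists) simp_all
  have uw: "u \<otimes> ?w = \<theta> ?w \<otimes> u" using n
  proof
    assume *: "(\<forall>f. A f u s = f (\<theta> s)) \<and> (\<forall>f. A f u t = f (\<theta> t))"
    hence e: "u \<otimes> s = \<theta> s \<otimes> u" "u \<otimes> t = \<theta> t \<otimes> u"
      using transport[OF s theta_S[OF s]] transport[OF t theta_S[OF t]] by blast+
    have K: "u \<otimes> x = \<theta> x \<otimes> u" "\<theta> x \<in> S" if "x \<in> {s, t}" for x using that e s t by auto
    have "u \<otimes> ?w = wp (map \<theta> (alternating (m s t) s t)) \<otimes> u"
      by (rule conj_word[OF uc sub K(2,1) al'])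
    thus ?thesis using tw by simp
  next
    assume *: "(\<forall>f. A f u s = f (\<theta> t)) \<and> (\<forall>f. A f u t = f (\<theta> s))"
    hence e: "u \<otimes> s = \<theta> t \<otimes> u" "u \<otimes> t = \<theta> s \<otimes> u"
      using transport[OF s theta_S[OF t]] transport[OF t theta_S[OF s]] by blast+
    let ?\<pi> = "\<lambda>x. if x = s then \<theta> t else \<theta> s"
    have K: "u \<otimes> x = ?\<pi> x \<otimes> u" "?\<pi> x \<in> S" if "x \<in> {s, t}" for x using that e s t by auto
    have "u \<otimes> ?w = wp (map ?\<pi> (alternating (m s t) s t)) \<otimes> u"
      by (rule conj_word[OF uc sub K(2,1) al'])
    also have "map ?\<pi> (alternating (m s t) s t) = map \<theta> (alternating (m s t) t s)" 
      using st by (simp add: map_alternating)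
    finally show ?thesis using tw' by simp
  qed
  have wc: "?w \<in> carrier W" using al by simp
  have "inv ?w = ?w"
  proof -
    have "inv ?w = wp (rev (alternating (m s t) s t))" using al by (intro wp_rev[symmetric])
    also have "\<dots> = ?w" by (simp add: rev_alternating longest_word[OF base])
    finally show ?thesis .
  qed
  hence "\<tau> ?w = \<theta> ?w" by (simp add: \<tau>_def)
  moreover have "\<tau> (u \<otimes> ?w) = \<tau> ?w \<otimes> u" using u wc by (simp del: wp_closed)
  ultimately have "\<tau> (u \<otimes> ?w) = u \<otimes> ?w" using uw by argo
  hence I: "u \<otimes> ?w \<in> \<I>" using uc wc I_iff by blast
  have len: "len (u \<otimes> ?w) = len u + m s t" using alternating_asc(2)[of u s t] base by simp
  have dd: "desc (u \<otimes> ?w) s" "desc (u \<otimes> ?w) t"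
    using desc_iff[of "u \<otimes> ?w"] A_longest[OF uc, of "\<lambda>_. 1"] asc_pos[of u _ "\<lambda>_. 1"] s t u wc asc by auto
  show top: "local_top u s t = u \<otimes> ?w" unfolding local_top_eq[OF base]
    using s t dd by (intro LW_stable[OF I] alternating_lists) auto
  show "len (local_top u s t) = len u + m s t" using top len by simp
  show "desc (local_top u s t) r" if "r \<in> S" "desc u r" for r
  proof -
    have "len (u \<otimes> ?w \<otimes> r) = len (\<theta> ?w \<otimes> (u \<otimes> r))" using uw wc u that by (simp add: m_assoc)
    also have "\<dots> \<le> len (\<theta> ?w) + len (u \<otimes> r)" using wc u that by (intro len_mult_le) auto
    also have "\<dots> < m s t + len u" using that len_le[OF al(1)[of "m s t"]] wc by (simp add: desc_def)
    finally show ?thesis unfolding top desc_def len by simp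
  qed
qed

lemma walks:
  obtains n \<delta> n' \<delta>' where "1 \<le> n" "n \<le> m s t" "ascw u (alternating n s t)" "acts u (alternating n s t) = local_top u s t"
    "\<delta> \<le> 1" "len (local_top u s t) + (if onesided u s then 1 else 0) + \<delta> = len u + 2 * n"
    "1 \<le> n'" "n' \<le> m s t" "ascw u (alternating n' t s)" "acts u (alternating n' t s) = local_top u s t"
    "\<delta>' \<le> 1" "len (local_top u s t) + (if onesided u t then 1 else 0) + \<delta>' = len u + 2 * n'"
proof -
  note sym = local_top_sym[OF base] m_sym[OF s t]
  show ?thesis using walk[OF base] walk[OF base', folded sym] that by metis
qed

lemma rank_two_normal:
  assumes nc: "(\<forall>f. A f u s = f (\<theta> s)) \<and> (\<forall>f. A f u t = f (\<theta> t)) \<or> (\<forall>f. A f u s = f (\<theta> t)) \<and> (\<forall>f. A f u t = f (\<theta> s))"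
  obtains n where "1 \<le> n" "ascw u (alternating n s t)" "ascw u (alternating n t s)"
    "acts u (alternating n s t) = local_top u s t" "acts u (alternating n t s) = local_top u s t"
    "normal_id u s t n \<or> normal_swap u s t n"
proof -
  let ?w = "local_top u s t"
  obtain n d n' d' where n: "1 \<le> n" "n \<le> m s t" "ascw u (alternating n s t)" "acts u (alternating n s t) = ?w"
    "d \<le> 1" "len ?w + (if onesided u s then 1 else 0) + d = len u + 2 * n"
    and n': "1 \<le> n'" "n' \<le> m s t" "ascw u (alternating n' t s)" "acts u (alternating n' t s) = ?w"
    "d' \<le> 1" "len ?w + (if onesided u t then 1 else 0) + d' = len u + 2 * n'"
    using walks by blast
  note top = normal_local_top[OF nc]
  have uc: "u \<in> carrier W" using u by simp
  show ?thesis using nc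
  proof
    assume *: "(\<forall>f. A f u s = f (\<theta> s)) \<and> (\<forall>f. A f u t = f (\<theta> t))"
    hence e: "u \<otimes> s = \<theta> s \<otimes> u" "u \<otimes> t = \<theta> t \<otimes> u"
      using transport[OF s theta_S[OF s]] transport[OF t theta_S[OF t]] by blast+
    hence o: "onesided u s" "onesided u t" using onesided_iff uc s t by simp_all
    have nn: "n = (m s t + 2) div 2" "n' = (m s t + 2) div 2" using n n' top(2) o by simp_all
    have "if even (m s t) then psi ?w s s \<and> psi ?w t t else psi ?w s t \<and> psi ?w t s"
      unfolding psi_def top(1) A_longest[OF uc] using * by simp
    hence "normal_id u s t n" using e nn by (simp add: normal_id_def Let_def)
    thus ?thesis using that[of n] n n' nn by simp
  next
    assume *: "(\<forall>f. A f u s = f (\<theta> t)) \<and> (\<forall>f. A f u t = f (\<theta> s))"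
    hence e: "u \<otimes> s = \<theta> t \<otimes> u" "u \<otimes> t = \<theta> s \<otimes> u"
      using transport[OF s theta_S[OF t]] transport[OF t theta_S[OF s]] by blast+
    have o: "\<not> onesided u s" "\<not> onesided u t" 
      using onesided_iff[OF uc s] onesided_iff[OF uc t] e uc s t st by auto
    have nn: "n = (m s t + 1) div 2" "n' = (m s t + 1) div 2" using n n' top(2) o by simp_all
    have "if even (m s t) then psi ?w s t \<and> psi ?w t s else psi ?w s s \<and> psi ?w t t"
      unfolding psi_def top(1) A_longest[OF uc] using * by simp
    hence "normal_swap u s t n" using e nn by (simp add: normal_swap_def Let_def)
    thus ?thesis using that[of n] n n' nn by simp
  qed
qed

text \<open>If u \<alpha>_s or u \<alpha>_t leaves the span of \<alpha>_\<theta>(s) and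
  \<alpha>_\<theta>(t), the climb gains at least 2 m(s,t) - 1 in length. A step gains at most 2, so
  both climbs need all m(s,t) letters.\<close>

theorem rank_two:
  obtains n where "1 \<le> n" "ascw u (alternating n s t)" "ascw u (alternating n t s)"
    "acts u (alternating n s t) = local_top u s t" "acts u (alternating n t s) = local_top u s t"
    "n = m s t \<or> (normal_id u s t n \<or> normal_swap u s t n) \<and> (\<forall>r\<in>S. desc u r \<longrightarrow> desc (local_top u s t) r)"
proof (cases "\<exists>f r. (\<forall>q. f q \<ge> 0) \<and> f (\<theta> s) = 0 \<and> f (\<theta> t) = 0 \<and> r \<in> {s, t} \<and> A f u r > 0")
  case True
  have "len (local_top u s t) + 1 \<ge> len u + 2 * m s t" 
    using True local_top_long[OF base] local_top_long[OF base'] local_top_sym[OF base] m_sym[OF s t] by auto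
  moreover obtain n d n' d' where n: "1 \<le> n" "n \<le> m s t" "ascw u (alternating n s t)" "acts u (alternating n s t) = local_top u s t"
    "d \<le> 1" "len (local_top u s t) + (if onesided u s then 1 else 0) + d = len u + 2 * n"
    and n': "1 \<le> n'" "n' \<le> m s t" "ascw u (alternating n' t s)" "acts u (alternating n' t s) = local_top u s t"
    "d' \<le> 1" "len (local_top u s t) + (if onesided u t then 1 else 0) + d' = len u + 2 * n'"
    using walks by blast
  ultimately have "n = m s t" "n' = m s t" by (auto split: if_splits)
  thus ?thesis using that[of n] n n' by simp
next
  case False
  have nc: "(\<forall>f. A f u s = f (\<theta> s)) \<and> (\<forall>f. A f u t = f (\<theta> t)) \<or> (\<forall>f. A f u s = f (\<theta> t)) \<and> (\<forall>f. A f u t = f (\<theta> s))"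
    by (rule normalizing_cases[OF base]) (use False in \<open>auto simp: not_less\<close>)
  show ?thesis by (rule rank_two_normal[OF nc]) (use that normal_local_top(3)[OF nc] in blast)
qed

text \<open>A letter repeated at once is absorbed, since it has just become a descent.\<close>

lemma upw_two_letters:
  assumes "us \<in> lists {s, t}"
  shows "\<exists>n x y. (x, y) \<in> {(s, t), (t, s)} \<and> upw u us = upw u (alternating n x y)"
  using assms
proof (induction us rule: rev_induct)
  case Nil
  show ?case by (intro exI[of _ 0]) auto
next
  case (snoc r us)
  then obtain n x y where xy: "(x, y) \<in> {(s, t), (t, s)}" "upw u us = upw u (alternating n x y)" by auto
  have r: "r \<in> {x, y}" using snoc xy by auto
  show ?case
  proof (cases "r = ltr n x y")
    case True
    thus ?thesis using xy by (intro exI[of _ "Suc n"] exI[of _ x] exI[of _ y]) (simp add: alternating_snoc del: alternating.simps)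
  next
    case False
    show ?thesis
    proof (cases n)
      case 0
      hence "r = y" using False r by simp
      thus ?thesis using xy 0 by (intro exI[of _ 1] exI[of _ y] exI[of _ x]) auto
    next
      case (Suc k)
      hence "r = ltr k x y" using False r by (auto simp: ltr_def split: if_splits)
      moreover have "desc (upw u (alternating n x y)) (ltr k x y)" unfolding Suc alternating_snoc
        using desc_up[of "upw u (alternating k x y)" "ltr k x y"] u s t xy al by auto
      ultimately have "up (upw u (alternating n x y)) r = upw u (alternating n x y)" 
        using up_desc[of "upw u (alternating n x y)" r] u xy al by auto
      thus ?thesis using xy by (intro exI[of _ n] exI[of _ x] exI[of _ y]) auto
    qed
  qed
qed

text \<open>A word of n + m(s,t) alternating letters is cut in two ways: the last m(s,t) letters fix
  the given element, and the last n letters fix the top.\<close>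

lemma local_top_unique:
  assumes "us \<in> lists {s, t}" "desc (upw u us) s" "desc (upw u us) t"
  shows "upw u us = local_top u s t"
proof -
  obtain n x y where xy: "(x, y) \<in> {(s, t), (t, s)}" "upw u us = upw u (alternating n x y)" 
    using upw_two_letters[OF assms(1)] by blast
  have c: "u \<in> \<I>" "x \<in> S" "y \<in> S" "x \<noteq> y" "\<not> desc u x" "\<not> desc u y" "m x y > 0"
    and top: "local_top u x y = local_top u s t" using xy base base' local_top_sym[OF base] by auto
  have "us \<in> lists S" using assms s t by (auto simp: in_lists_conv_set)
  hence I: "upw u us \<in> \<I>" using u by simp
  let ?l = "\<lambda>n. ltr n x y" and ?k = "m x y"
  have "upw u us = upw (upw u us) (alternating ?k (?l n) (?l (Suc n)))"
    using assms(2,3) s t xy ltr_cases[of n x y] by (intro upw_stable[OF I, symmetric] alternating_lists) auto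
  also have "\<dots> = upw u (alternating (n + ?k) x y)" unfolding xy(2) alternating_add by simp
  also have "\<dots> = upw (local_top u x y) (alternating n (?l ?k) (?l (Suc ?k)))"
    unfolding add.commute[of n] alternating_add local_top_def by simp
  also have "\<dots> = local_top u x y" 
    using ltr_cases[of ?k x y] by (intro upw_local_top[OF c] alternating_lists) auto
  finally show ?thesis using top by simp
qed

end

lemma ex_bottom_upw:
  assumes "w \<in> \<I>" "s \<in> S" "t \<in> S"
  shows "\<exists>u us. u \<in> \<I> \<and> us \<in> lists {s, t} \<and> w = upw u us \<and> \<not> desc u s \<and> \<not> desc u t"
  using assms(1)
proof (induction "len w" arbitrary: w rule: less_induct)
  case less
  show ?case
  proof (cases "desc w s \<or> desc w t")
    case False
    thus ?thesis using less by (intro exI[of _ w] exI[of _ "[]"]) auto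
  next
    case True
    then obtain r where r: "r \<in> {s, t}" "desc w r" by auto
    have rS: "r \<in> S" using r assms by auto
    have I: "act w r \<in> \<I>" using less rS by simp
    obtain u us where u: "u \<in> \<I>" "us \<in> lists {s, t}" "act w r = upw u us" "\<not> desc u s" "\<not> desc u t"
      using less(1)[OF desc_step(2)[OF less(2) rS r(2)] I] by blast
    have "w = act (act w r) r" using act_act less rS by simp
    also have "\<dots> = up (act w r) r" using up_asc[OF I rS] desc_step(1)[OF less(2) rS r(2)] by simp
    finally have "w = upw u (us @ [r])" using u(3) by simp
    thus ?thesis using u r by (intro exI[of _ u] exI[of _ "us @ [r]"]) auto
  qed
qed

text \<open>For an infinite bond the vector \<alpha>_s + \<alpha>_t pairs to zero with both roots,
  which \<open>no_degenerate_descents\<close> excludes.\<close>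

lemma desc_m_pos:
  assumes "w \<in> carrier W" "s \<in> S" "t \<in> S" "s \<noteq> t" "desc w s" "desc w t"
  shows "m s t > 0"
proof (rule ccontr)
  assume "\<not> m s t > 0"
  hence "c s t = 2" "c t s = 2" using m_sym[of t s] assms by (simp_all add: c_def)
  thus False using assms by (intro no_degenerate_descents[of "{s, t}" s "\<lambda>_. 1" w]) auto
qed

lemma ex_bottom:
  assumes "w \<in> \<I>" "s \<in> S" "t \<in> S" "s \<noteq> t" "desc w s" "desc w t"
  obtains u where "u \<in> \<I>" "\<not> desc u s" "\<not> desc u t" "w = local_top u s t"
proof -
  obtain u us where u: "u \<in> \<I>" "us \<in> lists {s, t}" "w = upw u us" "\<not> desc u s" "\<not> desc u t"
    using ex_bottom_upw[of w s t] assms by blast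
  have "m s t > 0" using desc_m_pos[of w s t] assms by simp
  from local_top_unique[OF u(1) assms(2,3,4) u(4,5) this u(2)] assms u that show ?thesis by auto
qed

section \<open>Ascending words\<close>

lemma len_ascw: "z \<in> \<I> \<Longrightarrow> ascw z us \<Longrightarrow> len (acts z us) \<ge> len z + length us"
proof (induction us arbitrary: z)
  case (Cons s us)
  thus ?case using Cons(1)[of "act z s"] asc_step(2,3)[of z s] by (cases "onesided z s") auto
qed simp

lemma ex_ascw: assumes "w \<in> \<I>" obtains us where "ascw \<one> us" "acts \<one> us = w"
proof -
  have "\<exists>us. ascw \<one> us \<and> acts \<one> us = w" using assms
  proof (induction "len w" arbitrary: w rule: less_induct)
    case less
    show ?case
    proof (cases "w = \<one>")
      case True thus ?thesis by (intro exI[of _ "[]"]) simp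
    next
      case False
      then obtain s where s: "s \<in> S" "desc w s" using ex_desc less by (metis I_carrier)
      then obtain us where us: "ascw \<one> us" "acts \<one> us = act w s" 
        using less(1)[OF desc_step(2)[OF less(2) s] act_I[OF less(2) s(1)]] by blast
      have "act (act w s) s = w" by (rule act_act[OF I_carrier[OF less(2)] s(1)])
      thus ?thesis using s desc_step(1)[OF less(2) s] us
        by (intro exI[of _ "us @ [s]"]) simp
    qed
  qed
  thus ?thesis using that by blast
qed

lemma ascw_snocD:
  assumes "ascw \<one> (us @ [s])" "acts \<one> (us @ [s]) = w"
  shows "s \<in> S" "ascw \<one> us" "desc w s" "acts \<one> us = act w s" "w \<in> \<I>" "act w s \<in> \<I>" "len (act w s) < len w"
proof -
  show *: "s \<in> S" "ascw \<one> us" using assms by auto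
  have I: "acts \<one> us \<in> \<I>" using ascw_lists * by simp
  show "w \<in> \<I>" using I assms * by auto
  show "desc w s" using asc_step(1)[OF I] assms by auto
  show "acts \<one> us = act w s" using act_act[of "acts \<one> us" s] I assms by auto
  show "act w s \<in> \<I>" using \<open>w \<in> \<I>\<close> * by simp
  show "len (act w s) < len w" using desc_step \<open>w \<in> \<I>\<close> * \<open>desc w s\<close> by simp
qed

lemma ascw_snocI:
  assumes "w \<in> \<I>" "s \<in> S" "desc w s" "ascw \<one> us" "acts \<one> us = act w s"
  shows "ascw \<one> (us @ [s])" "acts \<one> (us @ [s]) = w"
  using assms desc_step(1)[of w s] act_act[of w s] by auto

lemma diamond:
  assumes w: "w \<in> \<I>" "s \<in> S" "t \<in> S" "s \<noteq> t" "desc w s" "desc w t"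
  obtains p a b where "ascw \<one> (p @ a @ [s])" "acts \<one> (p @ a @ [s]) = w"
    "ascw \<one> (p @ b @ [t])" "acts \<one> (p @ b @ [t]) = w" "length a = length b"
proof -
  obtain u where u: "u \<in> \<I>" "\<not> desc u s" "\<not> desc u t" "w = local_top u s t" using ex_bottom[OF w] .
  have mp: "m s t > 0" using desc_m_pos[of w s t] w by simp
  obtain p where p: "ascw \<one> p" "acts \<one> p = u" using ex_ascw u by blast
  obtain n where n: "1 \<le> n" "ascw u (alternating n s t)" "ascw u (alternating n t s)"
    "acts u (alternating n s t) = w" "acts u (alternating n t s) = w"
    using rank_two[OF u(1) w(2,3,4) u(2,3) mp] u(4) by metis
  obtain k where k: "n = Suc k" using n by (cases n) auto
  let ?a = "alternating k s t" and ?b = "alternating k t s"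
  have 1: "ascw \<one> (p @ ?a @ [ltr k s t])" "acts \<one> (p @ ?a @ [ltr k s t]) = w"
    "ascw \<one> (p @ ?b @ [ltr k t s])" "acts \<one> (p @ ?b @ [ltr k t s]) = w"
    using n p unfolding k alternating_snoc by simp_all
  show ?thesis
  proof (cases "even k")
    case True
    thus ?thesis using that[of p ?a ?b] 1 by (simp add: ltr_def)
  next
    case False
    thus ?thesis using that[of p ?b ?a] 1 by (simp add: ltr_def)
  qed
qed

text \<open>This makes the number of letters a rank function on the twisted involutions; the diamond
  supplies words of equal length for any two last letters.\<close>

lemma ascw_length_unique:
  assumes "ascw \<one> us" "ascw \<one> vs" "acts \<one> us = acts \<one> vs"
  shows "length us = length vs"
  using assms
proof (induction "len (acts \<one> us)" arbitrary: us vs rule: less_induct)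
  case less
  define w where "w = acts \<one> us"
  have w: "acts \<one> us = w" "acts \<one> vs = w" using less w_def by simp_all
  show ?case
  proof (cases "us = [] \<or> vs = []")
    case True
    hence "w = \<one>" using w by auto
    thus ?thesis using len_ascw[of \<one> us] len_ascw[of \<one> vs] less w by simp
  next
    case False
    then obtain us' s vs' t where st: "us = us' @ [s]" "vs = vs' @ [t]" by (metis rev_exhaust)
    note D = ascw_snocD[OF less(2)[unfolded st] w(1)[unfolded st]] ascw_snocD[OF less(3)[unfolded st] w(2)[unfolded st]]
    have IH: "length xs = length ys" if "ascw \<one> xs" "ascw \<one> ys" "acts \<one> xs = act w r" "acts \<one> ys = act w r" 
      "r \<in> {s, t}" for xs ys r
      using less(1)[of xs ys] that D w by auto
    show ?thesis
    proof (cases "s = t")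
      case True
      thus ?thesis using IH[of us' vs' s] D st by simp
    next
      case False
      obtain p a b where pab: "ascw \<one> (p @ a @ [s])" "acts \<one> (p @ a @ [s]) = w"
        "ascw \<one> (p @ b @ [t])" "acts \<one> (p @ b @ [t]) = w" "length a = length b" 
        using diamond[of w s t] D False by metis
      have "length us' = length (p @ a)" 
        using IH[of us' "p @ a" s] D ascw_snocD[of "p @ a" s w] pab by simp
      moreover have "length vs' = length (p @ b)" 
        using IH[of vs' "p @ b" t] D ascw_snocD[of "p @ b" t w] pab by simp
      ultimately show ?thesis using st pab(5) by simp
    qed
  qed
qed

text \<open>A letter raises the rank by one at an ascent and lowers it by one at a descent, so a
  shortest expression consists of ascents only.\<close>

lemma expression_length:
  assumes "us \<in> lists S" "ascw \<one> vs" "acts \<one> vs = acts \<one> us"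
  shows "length vs \<le> length us \<and> (length us = length vs \<longrightarrow> ascw \<one> us)"
  using assms
proof (induction us arbitrary: vs rule: rev_induct)
  case Nil
  thus ?case using len_ascw[of \<one> vs] by simp
next
  case (snoc s us)
  let ?w = "acts \<one> us"
  have us: "us \<in> lists S" "s \<in> S" using snoc by auto
  have I: "?w \<in> \<I>" using us by simp
  obtain vs' where vs': "ascw \<one> vs'" "acts \<one> vs' = ?w" using ex_ascw[OF I] by blast
  have IH: "length vs' \<le> length us \<and> (length us = length vs' \<longrightarrow> ascw \<one> us)"
    using snoc(1)[OF us(1) vs'] .
  show ?case
  proof (cases "desc ?w s")
    case False
    hence "length vs = length (vs' @ [s])" using snoc vs' us by (intro ascw_length_unique) auto
    thus ?thesis using IH False us by auto
  next
    case True
    have "acts \<one> (vs @ [s]) = ?w" using snoc(4) act_act[of ?w s] I us by simp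
    moreover have "ascw \<one> (vs @ [s])" using snoc(3,4) desc_step(1)[OF I us(2) True] us by simp
    ultimately have "length (vs @ [s]) = length vs'" using vs' by (intro ascw_length_unique) auto
    thus ?thesis using IH by auto
  qed
qed

lemma reduced_expression_iff:
  assumes "w \<in> \<I>"
  shows "reduced_expression W S \<theta> w us \<longleftrightarrow> ascw \<one> us \<and> acts \<one> us = w"
proof -
  obtain vs where vs: "ascw \<one> vs" "acts \<one> vs = w" using ex_ascw[OF assms] by blast
  have vsS: "vs \<in> lists S" using vs ascw_lists by blast
  show ?thesis
  proof
    assume "reduced_expression W S \<theta> w us"
    hence us: "us \<in> lists S" "acts \<one> us = w" "length us \<le> length vs" using vs vsS
      unfolding reduced_expression_def expression_def by auto
    thus "ascw \<one> us \<and> acts \<one> us = w" using expression_length[of us vs] vs by auto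
  next
    assume us: "ascw \<one> us \<and> acts \<one> us = w"
    thus "reduced_expression W S \<theta> w us" using expression_length[of _ us] ascw_lists
      unfolding reduced_expression_def expression_def by auto
  qed
qed

text \<open>Restricted to ascending words with equal result, so that chains of moves can be reversed
  and extended on the right without losing the reducedness that initial moves demand.\<close>

definition moves :: "('a list \<times> 'a list) set \<Rightarrow> ('a list \<times> 'a list) set" where
  "moves P = {(us, vs). ascw \<one> us \<and> ascw \<one> vs \<and> acts \<one> us = acts \<one> vs \<and>
     (us, vs) \<in> braid_moves W S \<union> initial_moves W S \<theta> P}"

lemma moves_subset: "(moves P)\<^sup>* \<subseteq> (braid_moves W S \<union> initial_moves W S \<theta> P)\<^sup>*"
  by (rule rtrancl_mono) (auto simp: moves_def)

lemma moves_initial: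
  assumes "(us, vs) \<in> P \<union> P\<inverse>" "ascw \<one> (us @ xs)" "ascw \<one> vs" "acts \<one> us = acts \<one> vs"
  shows "(us @ xs, vs @ xs) \<in> moves P"
proof -
  have us: "ascw \<one> us" using assms(2) by simp
  have I: "acts \<one> us \<in> \<I>" "acts \<one> (us @ xs) \<in> \<I>" using acts_I[OF one_I ascw_lists] us assms(2) by blast+
  have red: "reduced_expression W S \<theta> (acts \<one> us) us" "reduced_expression W S \<theta> (acts \<one> us) vs"
    "reduced_expression W S \<theta> (acts \<one> (us @ xs)) (us @ xs)"
    using reduced_expression_iff[OF I(1)] reduced_expression_iff[OF I(2)] us assms by simp_all
  have "(us @ xs, vs @ xs) \<in> initial_moves W S \<theta> P"
    unfolding initial_moves_def using assms(1) red I by blast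
  thus ?thesis using assms by (simp add: moves_def)
qed

lemma moves_braid:
  assumes "ascw \<one> (us @ alternating (m s t) s t @ vs)" "ascw \<one> (us @ alternating (m s t) t s @ vs)"
    "acts \<one> (us @ alternating (m s t) s t @ vs) = acts \<one> (us @ alternating (m s t) t s @ vs)"
    "s \<in> S" "t \<in> S" "s \<noteq> t" "m s t > 0"
  shows "(us @ alternating (m s t) s t @ vs, us @ alternating (m s t) t s @ vs) \<in> moves P"
proof -
  have "us \<in> lists S" "vs \<in> lists S" using ascw_lists[OF assms(1)] by auto
  thus ?thesis using assms unfolding moves_def braid_moves_def by blast
qed

lemma moves_sym: "(us, vs) \<in> moves P \<Longrightarrow> (vs, us) \<in> moves P"
proof -
  assume a: "(us, vs) \<in> moves P"
  hence b: "ascw \<one> us" "ascw \<one> vs" "acts \<one> us = acts \<one> vs" by (auto simp: moves_def)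
  from a have "(us, vs) \<in> braid_moves W S \<or> (us, vs) \<in> initial_moves W S \<theta> P" by (auto simp: moves_def)
  thus ?thesis
  proof
    assume "(us, vs) \<in> braid_moves W S"
    then obtain xs ys s t where *: "us = xs @ alternating (m s t) s t @ ys" "vs = xs @ alternating (m s t) t s @ ys"
      "s \<in> S" "t \<in> S" "s \<noteq> t" "m s t > 0" unfolding braid_moves_def by blast
    hence e: "us = xs @ alternating (m t s) s t @ ys" "vs = xs @ alternating (m t s) t s @ ys" "m t s > 0"
      using m_sym[of s t] by simp_all
    show ?thesis using b unfolding e(1,2) by (intro moves_braid *(3-5) *(5)[symmetric] e(3)) simp_all
  next
    assume "(us, vs) \<in> initial_moves W S \<theta> P"
    then obtain p q xs v where *: "us = p @ xs" "vs = q @ xs" "(p, q) \<in> P \<union> P\<inverse>" "v \<in> \<I>"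
      "reduced_expression W S \<theta> v p" "reduced_expression W S \<theta> v q" 
      unfolding initial_moves_def by blast
    hence pq: "ascw \<one> p" "acts \<one> p = acts \<one> q" using reduced_expression_iff[OF *(4)] by auto
    have qp: "(q, p) \<in> P \<union> P\<inverse>" using *(3) by blast
    show ?thesis using b pq unfolding *(1,2) by (intro moves_initial[OF qp]) simp_all
  qed
qed

lemma moves_append: 
  assumes "(us, vs) \<in> moves P" "ascw \<one> (us @ xs)"
  shows "(us @ xs, vs @ xs) \<in> moves P"
proof -
  have b: "ascw \<one> us" "ascw \<one> vs" "acts \<one> us = acts \<one> vs" using assms by (auto simp: moves_def)
  hence v: "ascw \<one> (vs @ xs)" "acts \<one> (us @ xs) = acts \<one> (vs @ xs)" using assms by auto
  from assms have "(us, vs) \<in> braid_moves W S \<or> (us, vs) \<in> initial_moves W S \<theta> P" by (auto simp: moves_def)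
  thus ?thesis
  proof
    assume "(us, vs) \<in> braid_moves W S"
    then obtain ps ys s t where *: "us = ps @ alternating (m s t) s t @ ys" "vs = ps @ alternating (m s t) t s @ ys"
      "s \<in> S" "t \<in> S" "s \<noteq> t" "m s t > 0" unfolding braid_moves_def by blast
    have "(ps @ alternating (m s t) s t @ (ys @ xs), ps @ alternating (m s t) t s @ (ys @ xs)) \<in> moves P"
      by (rule moves_braid) (use v assms(2) in \<open>simp_all add: * del: alternating.simps\<close>)
    thus ?thesis by (simp add: *(1,2))
  next
    assume "(us, vs) \<in> initial_moves W S \<theta> P"
    then obtain p q ys v where *: "us = p @ ys" "vs = q @ ys" "(p, q) \<in> P \<union> P\<inverse>" "v \<in> \<I>"
      "reduced_expression W S \<theta> v p" "reduced_expression W S \<theta> v q" 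
      unfolding initial_moves_def by blast
    hence pq: "ascw \<one> q" "acts \<one> p = acts \<one> q" using reduced_expression_iff[OF *(4)] by auto
    have "(p @ (ys @ xs), q @ (ys @ xs)) \<in> moves P"
      using assms(2) pq by (intro moves_initial[OF *(3)]) (simp_all add: *(1,2))
    thus ?thesis by (simp add: *(1,2))
  qed
qed

lemma moves_rtrancl_append: 
  assumes "(us, vs) \<in> (moves P)\<^sup>*" "ascw \<one> (us @ xs)"
  shows "(us @ xs, vs @ xs) \<in> (moves P)\<^sup>*"
  using assms
proof (induction rule: rtrancl_induct)
  case (step ys zs)
  have IH: "(us @ xs, ys @ xs) \<in> (moves P)\<^sup>*" using step by simp
  moreover have "ascw \<one> (ys @ xs)" using IH step(4) by (cases rule: rtranclE) (auto simp: moves_def)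
  ultimately show ?case using moves_append[OF step(2)] by (meson rtrancl.rtrancl_into_rtrancl)
qed simp

lemma moves_rtrancl_sym: "(us, vs) \<in> (moves P)\<^sup>* \<Longrightarrow> (vs, us) \<in> (moves P)\<^sup>*"
  by (induction rule: rtrancl_induct) (auto intro: moves_sym converse_rtrancl_into_rtrancl)

section \<open>Parabolic subgroups\<close>

text \<open>Let v be the minimal element of the coset \<open>w W_K\<close>, and v = w x. Since
  \<open>w\<close> conjugates \<open>K\<close> by \<theta>, also v = \<theta>(x) w, so
  \<open>w\<close> is a left multiple of v with additive lengths, and every descent of v is a
  descent of \<open>w\<close>.\<close>

lemma parabolic_rest:
  assumes "w \<in> carrier W" "K \<subseteq> S" "\<And>k. k \<in> K \<Longrightarrow> psi w k k"
  obtains ks where "ks \<in> lists K" "w = wp ks" | r where "r \<in> S" "r \<notin> K" "desc w r"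
proof -
  have "\<exists>ks\<in>lists K. len v = len (v \<otimes> wp ks) + length ks \<and> (\<forall>k\<in>K. \<not> desc (v \<otimes> wp ks) k)" if "v \<in> carrier W" for v
    using that
  proof (induction "len v" arbitrary: v rule: less_induct)
    case less
    show ?case
    proof (cases "\<exists>k\<in>K. desc v k")
      case False
      thus ?thesis using less by (intro bexI[of _ "[]"]) auto
    next
      case True
      then obtain k where k: "k \<in> K" "k \<in> S" "desc v k" using assms by auto
      have l: "len v = len (v \<otimes> k) + 1" using len_desc less k by blast
      have "len (v \<otimes> k) < len v" "v \<otimes> k \<in> carrier W" using l less(2) k by auto
      then obtain ks where ks: "ks \<in> lists K" "len (v \<otimes> k) = len (v \<otimes> k \<otimes> wp ks) + length ks" 
        "\<forall>k'\<in>K. \<not> desc (v \<otimes> k \<otimes> wp ks) k'" using less(1)[of "v \<otimes> k"] by blast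
      have "ks \<in> lists S" using ks assms by (auto simp: in_lists_conv_set)
      hence e: "v \<otimes> k \<otimes> wp ks = v \<otimes> wp (k # ks)" using less k by (simp add: m_assoc)
      show ?thesis using ks k l unfolding e by (intro bexI[of _ "k # ks"]) auto
    qed
  qed
  from this[OF assms(1)] obtain ks where ks: "ks \<in> lists K" "len w = len (w \<otimes> wp ks) + length ks" 
    "\<forall>k\<in>K. \<not> desc (w \<otimes> wp ks) k" by blast
  have ksS: "ks \<in> lists S" "rev ks \<in> lists S" "map \<theta> ks \<in> lists S" "rev (map \<theta> ks) \<in> lists S" "rev ks \<in> lists K"
    using ks assms by (auto simp: in_lists_conv_set)
  define v where "v = w \<otimes> wp ks"
  have vc: "v \<in> carrier W" using assms ksS by (simp add: v_def)
  show ?thesis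
  proof (cases "v = \<one>")
    case True
    hence "w = inv (wp ks)" using assms ksS by (simp add: v_def inv_equality)
    also have "\<dots> = wp (rev ks)" using wp_rev ksS by simp
    finally show ?thesis using that(1)[of "rev ks"] ksS by simp
  next
    case False
    then obtain r where r: "r \<in> S" "desc v r" using ex_desc vc by blast
    have K: "w \<otimes> k = \<theta> k \<otimes> w" "\<theta> k \<in> S" if "k \<in> K" for k
      using psi_carrier[of w k k] assms that by auto
    have "v = wp (map \<theta> ks) \<otimes> w" unfolding v_def by (rule conj_word[OF assms(1,2) K(2,1) ks(1)])
    hence "inv (wp (map \<theta> ks)) \<otimes> v = w" using assms ksS vc by (metis inv_solve_left wp_closed)
    hence w: "w = wp (rev (map \<theta> ks)) \<otimes> v" using wp_rev[OF ksS(3)] by simp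
    have "len (w \<otimes> r) \<le> len (wp (rev (map \<theta> ks))) + len (v \<otimes> r)"
      using len_mult_le[of "wp (rev (map \<theta> ks))" "v \<otimes> r"] w ksS vc r by (simp add: m_assoc)
    also have "\<dots> < length ks + len v" 
      using len_le[OF ksS(4)] r by (simp add: desc_def)
    finally have "desc w r" using ks(2) by (simp add: desc_def v_def)
    moreover have "r \<notin> K" using r ks(3) by (auto simp: v_def)
    ultimately show ?thesis using that(2) r by blast
  qed
qed

text \<open>Elements of \<open>W_K\<close> do not change the coordinate of \<alpha>_r for r outside
  \<open>K\<close>; it stays 1, so the root of \<open>r\<close> stays positive.\<close>

lemma desc_in_parabolic:
  assumes "ys \<in> lists K" "K \<subseteq> S" "r \<in> S" "desc (wp ys) r" shows "r \<in> K"
proof (rule ccontr)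
  assume r: "r \<notin> K"
  let ?f = "\<lambda>q. if q = r then 1 else 0 :: real"
  have "ys \<in> lists S" using assms by (auto simp: in_lists_conv_set)
  moreover have "play ?f ys = ?f" by (rule play_vanish[OF assms(1)]) (use r in auto)
  ultimately have "A ?f (wp ys) r = 1" "ys \<in> lists S" by (simp_all add: A_wp)
  moreover from this have "A ?f (wp ys) r \<le> 0" using assms \<open>ys \<in> lists S\<close> by (intro desc_nonpos) auto
  ultimately show False by simp
qed

text \<open>The assumptions make \<open>w\<close> the longest element of \<open>W\<^sub>K\<close>: it sends the simple roots of \<open>K\<close> to
  negatives of simple roots.\<close>

context
  fixes w K ks
  assumes K: "K \<subseteq> S" and ks: "ks \<in> lists K" "w = wp ks" and psi: "\<And>k. k \<in> K \<Longrightarrow> psi w k k"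
begin

lemma theta_parabolic: assumes "k \<in> K" shows "\<theta> k \<in> K"
proof (rule ccontr)
  assume r: "\<theta> k \<notin> K"
  let ?f = "\<lambda>q. if q = \<theta> k then 1 else 0 :: real"
  have "ks \<in> lists S" using ks K by (auto simp: in_lists_conv_set)
  moreover have "play ?f ks = ?f" by (rule play_vanish[OF ks(1)]) (use r in auto)
  ultimately have "A ?f w k = 0" using r assms ks by (auto simp: A_wp)
  thus False using psi[OF assms] by (auto simp: psi_def)
qed

text \<open>The inverse of \<open>w\<close> sends \<alpha>_r to -\<alpha>_\<theta>(r), and
  \<open>wp xs\<close> makes this positive again. So the quotient has no descents.\<close>

lemma longest_unique:
  assumes xs: "xs \<in> lists K" and d: "\<And>k. k \<in> K \<Longrightarrow> desc (wp xs) k"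
  shows "wp xs = w"
proof -
  have S: "xs \<in> lists S" "ks \<in> lists S" "rev ks \<in> lists S" "rev ks \<in> lists K" 
    using xs ks K by (auto simp: in_lists_conv_set)
  have wc: "w \<in> carrier W" using ks S by simp
  have iw: "inv w = wp (rev ks)" using wp_rev S ks by simp
  let ?y = "wp xs \<otimes> inv w"
  have y: "?y = wp (xs @ rev ks)" using iw S by simp
  have "?y = \<one>"
  proof (rule faithful)
    show "?y \<in> carrier W" using S wc by simp
    fix r assume r: "r \<in> S"
    show "\<not> desc ?y r"
    proof
      assume dr: "desc ?y r"
      hence rK: "r \<in> K" using desc_in_parabolic[of "xs @ rev ks" K r] y r xs S K by auto
      hence tK: "\<theta> r \<in> K" using theta_parabolic by simp
      have rS: "\<theta> r \<in> S" using r by simp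
      have inv: "A f (inv w) r = - f (\<theta> r)" for f
      proof -
        have "A (A f (inv w)) w (\<theta> r) = - A f (inv w) (\<theta> (\<theta> r))" using psi[OF tK] unfolding psi_def by blast
        thus ?thesis using wc r by simp
      qed
      have "A (\<lambda>_. 1) ?y r = - A (\<lambda>_. 1) (wp xs) (\<theta> r)" using inv S wc by (simp add: A_mult)
      moreover have "A (\<lambda>_. 1) (wp xs) (\<theta> r) < 0" using d[OF tK] desc_iff[OF _ rS] S by simp
      ultimately show False using dr desc_iff[of ?y r] S wc r by simp
    qed
  qed
  hence "wp xs = inv (inv w)" using S wc by (intro inv_equality[symmetric]) auto
  thus ?thesis using wc by simp
qed

text \<open>Only \<open>w\<close> has all of \<open>K\<close> as descents within \<open>W_K\<close>.
  An explicit word with this property therefore computes \<open>w\<close>, and the permutation of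
  \<open>K\<close> read off from it must be \<theta>.\<close>

lemma theta_from_word:
  assumes xs: "xs \<in> lists K" and p: "\<And>f k. k \<in> K \<Longrightarrow> play f xs k = - f (\<pi> k)" and k: "k \<in> K"
  shows "\<theta> k = \<pi> k"
proof -
  have S: "xs \<in> lists S" using xs K by (auto simp: in_lists_conv_set)
  have "desc (wp xs) k" if "k \<in> K" for k
  proof -
    have "k \<in> S" using that K by auto
    from desc_iff[OF _ this, of "wp xs"] show ?thesis using p[OF that] S by (simp add: A_wp)
  qed
  hence "wp xs = w" using longest_unique[OF xs] by simp
  hence "f (\<theta> k) = f (\<pi> k)" for f :: "'a \<Rightarrow> real" 
    using p[OF k, of f] psi[OF k] A_wp[OF S, of f] unfolding psi_def by (metis neg_equal_iff_equal)
  from this[of "\<lambda>q. if q = \<pi> k then 1 else 0"] show ?thesis by (simp split: if_splits)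
qed

lemma restricts_to_id_iff: "restricts_to_id W \<theta> K \<longleftrightarrow> (\<forall>k\<in>K. \<theta> k = k)"
proof
  assume *: "\<forall>k\<in>K. \<theta> k = k"
  have "w \<in> carrier W \<and> \<theta> w = w" if "w \<in> generate W K" for w
    using that by (induction rule: generate.induct) (use * K in \<open>auto simp: subset_iff\<close>)
  thus "restricts_to_id W \<theta> K" by (simp add: restricts_to_id_def)
qed (auto simp: restricts_to_id_def intro: generate.incl)

end

text \<open>Pairs an ascending word with an ordinary word for the same element, so that its steps
  can be checked by playing numbers.\<close>

definition asc_path :: "'a list \<Rightarrow> 'a list \<Rightarrow> bool" where
  "asc_path p us \<longleftrightarrow> ascw \<one> p \<and> acts \<one> p = wp us \<and> us \<in> lists S"

lemma asc_path_Nil: "asc_path [] []"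
  by (simp add: asc_path_def)

lemma asc_path_one:
  assumes "asc_path p us" "s \<in> S" "\<And>f. play f us s = f (\<theta> s)"
  shows "asc_path (p @ [s]) (us @ [s])"
proof -
  have us: "us \<in> lists S" "wp us \<in> carrier W" using assms by (auto simp: asc_path_def)
  have "\<not> desc (wp us) s" using desc_iff[OF us(2) assms(2)] A_wp[OF us(1)] assms by simp
  moreover have "onesided (wp us) s" 
    using root_transport[OF us(2) assms(2), of "\<theta> s"] onesided_iff[OF us(2) assms(2)] A_wp[OF us(1)] assms by simp
  ultimately show ?thesis using assms us by (auto simp: asc_path_def act_eq)
qed

text \<open>A one-sided ascent would send \<alpha>_s to the simple root of
  \<open>\<theta> s\<close>, of height 1; a height above 1 forces a two-sided step.\<close>

lemma asc_path_two:
  assumes "asc_path p us" "s \<in> S" "play (\<lambda>_. 1) us s > 1"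
  shows "asc_path (p @ [s]) (\<theta> s # us @ [s])"
proof -
  have us: "us \<in> lists S" "wp us \<in> carrier W" using assms by (auto simp: asc_path_def)
  have d: "\<not> desc (wp us) s" using desc_iff[OF us(2) assms(2)] A_wp[OF us(1)] assms by simp
  moreover have "\<not> onesided (wp us) s"
  proof
    assume "onesided (wp us) s"
    hence "A (\<lambda>_. 1) (wp us) s = 1" 
      using transport_root[OF us(2) assms(2) _ _ d, of "\<theta> s" "\<lambda>_. 1"] onesided_iff[OF us(2) assms(2)] assms by simp
    thus False using assms(3) A_wp[OF us(1)] by simp
  qed
  ultimately show ?thesis using assms us by (auto simp: asc_path_def act_eq m_assoc)
qed

end

lemma ceil_half: "nat \<lceil>(real m + 1) / 2\<rceil> = (m + 2) div 2" "nat \<lceil>real m / 2\<rceil> = (m + 1) div 2"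
proof -
  have "\<lceil>real k / 2\<rceil> = int ((k + 1) div 2)" for k by (rule ceiling_unique) linarith+
  from this[of m] this[of "m + 1"] show "nat \<lceil>(real m + 1) / 2\<rceil> = (m + 2) div 2" "nat \<lceil>real m / 2\<rceil> = (m + 1) div 2"
    by (simp_all add: add.commute)
qed

section \<open>Connecting the descents\<close>

locale word_property_step = twisted_coxeter W S \<theta> for W (structure) and S \<theta> +
  fixes lab :: "'a set \<Rightarrow> 'a list" and w :: 'a
  assumes lab: "labelling_choice W S \<theta> lab"
    and w: "w \<in> \<I>"
    and IH: "\<And>v us vs. v \<in> \<I> \<Longrightarrow> len v < len w \<Longrightarrow> ascw \<one> us \<Longrightarrow> acts \<one> us = v \<Longrightarrow> ascw \<one> vs \<Longrightarrow> acts \<one> vs = v \<Longrightarrow>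
      (us, vs) \<in> (moves (listed_pairs W S \<theta> lab))\<^sup>*"
begin

abbreviation P where "P \<equiv> listed_pairs W S \<theta> lab"
abbreviation M where "M \<equiv> (moves P)\<^sup>*"

text \<open>Vacuous if \<open>s\<close> or \<open>t\<close> is not a descent of \<open>w\<close>;
  hence the hypotheses on the middle letter in \<open>sim_trans\<close>.\<close>

definition sim :: "'a \<Rightarrow> 'a \<Rightarrow> bool" where
  "sim s t \<longleftrightarrow> (\<forall>us vs. ascw \<one> (us @ [s]) \<longrightarrow> acts \<one> (us @ [s]) = w \<longrightarrow> ascw \<one> (vs @ [t]) \<longrightarrow> acts \<one> (vs @ [t]) = w 
     \<longrightarrow> (us @ [s], vs @ [t]) \<in> M)"

lemma simD: "sim s t \<Longrightarrow> ascw \<one> (us @ [s]) \<Longrightarrow> acts \<one> (us @ [s]) = w \<Longrightarrow> ascw \<one> (vs @ [t]) \<Longrightarrow> acts \<one> (vs @ [t]) = w 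
     \<Longrightarrow> (us @ [s], vs @ [t]) \<in> M"
  unfolding sim_def by blast

lemma sim_refl: "sim s s"
  unfolding sim_def
proof (intro allI impI)
  fix us vs assume a: "ascw \<one> (us @ [s])" "acts \<one> (us @ [s]) = w" "ascw \<one> (vs @ [s])" "acts \<one> (vs @ [s]) = w"
  note u = ascw_snocD[OF a(1,2)] and v = ascw_snocD[OF a(3,4)]
  have "(us, vs) \<in> M" using IH[OF u(6,7,2,4) v(2,4)] .
  thus "(us @ [s], vs @ [s]) \<in> M" using moves_rtrancl_append a(1) by blast
qed

lemma sim_sym: "sim s t \<Longrightarrow> sim t s"
  unfolding sim_def using moves_rtrancl_sym by blast

lemma sim_trans: assumes "sim a b" "sim b c'" "b \<in> S" "desc w b" shows "sim a c'"
proof -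
  obtain us where us: "ascw \<one> us" "acts \<one> us = act w b" using ex_ascw[of "act w b"] w assms by auto
  note b = ascw_snocI[OF w assms(3,4) us]
  show ?thesis unfolding sim_def
  proof (intro allI impI)
    fix xs ys assume a: "ascw \<one> (xs @ [a])" "acts \<one> (xs @ [a]) = w" "ascw \<one> (ys @ [c'])" "acts \<one> (ys @ [c']) = w"
    show "(xs @ [a], ys @ [c']) \<in> M" using simD[OF assms(1) a(1,2) b] simD[OF assms(2) b a(3,4)] by (rule rtrancl_trans)
  qed
qed

text \<open>The induction hypothesis connects all expressions with the same last letter, so one
  connected pair settles all pairs.\<close>

lemma sim_witness:
  assumes "ascw \<one> (xs @ [a])" "acts \<one> (xs @ [a]) = w" "ascw \<one> (ys @ [b])" "acts \<one> (ys @ [b]) = w"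
    "(xs @ [a], ys @ [b]) \<in> M"
  shows "sim a b"
  unfolding sim_def
proof (intro allI impI)
  fix us vs assume a: "ascw \<one> (us @ [a])" "acts \<one> (us @ [a]) = w" "ascw \<one> (vs @ [b])" "acts \<one> (vs @ [b]) = w"
  have "(us @ [a], xs @ [a]) \<in> M" by (rule simD[OF sim_refl a(1,2) assms(1,2)])
  moreover have "(ys @ [b], vs @ [b]) \<in> M" by (rule simD[OF sim_refl assms(3,4) a(3,4)])
  ultimately show "(us @ [a], vs @ [b]) \<in> M" using assms(5) by (meson rtrancl_trans)
qed

lemma sim_alternating:
  assumes "n \<ge> 1" "ascw \<one> (p @ alternating n s t)" "acts \<one> (p @ alternating n s t) = w"
    "ascw \<one> (p @ alternating n t s)" "acts \<one> (p @ alternating n t s) = w"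
    "(p @ alternating n s t, p @ alternating n t s) \<in> moves P"
  shows "sim s t"
proof -
  obtain k where k: "n = Suc k" using assms by (cases n) auto
  note a = assms(2-)[unfolded k alternating_snoc append_assoc[symmetric]]
  have "sim (ltr k s t) (ltr k t s)" using sim_witness[OF a(1-4)] a(5) by blast
  thus ?thesis using sim_sym by (auto simp: ltr_def split: if_splits)
qed

lemma pair_cases:
  assumes s: "s \<in> S" and t: "t \<in> S" and st: "s \<noteq> t" and d: "desc w s" "desc w t" and ns: "\<not> sim s t"
  shows "(psi w s s \<and> psi w t t \<and> m s t \<ge> 3 \<or> psi w s t \<and> psi w t s) \<and> (\<exists>r\<in>S - {s, t}. desc w r)"
proof -
  have mp: "m s t > 0" using desc_m_pos[of w s t] w s t st d by simp
  have m2: "m s t \<ge> 2" using m_ge_2 s t st mp by blast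
  obtain u where u: "u \<in> \<I>" "\<not> desc u s" "\<not> desc u t" "w = local_top u s t" using ex_bottom[OF w s t st d] .
  obtain n where n: "1 \<le> n" "ascw u (alternating n s t)" "ascw u (alternating n t s)"
    "acts u (alternating n s t) = w" "acts u (alternating n t s) = w"
    "n = m s t \<or> (normal_id u s t n \<or> normal_swap u s t n) \<and> (\<forall>r\<in>S. desc u r \<longrightarrow> desc w r)"
    using rank_two[OF u(1) s t st u(2,3) mp] unfolding u(4)[symmetric] by blast
  obtain p where p: "ascw \<one> p" "acts \<one> p = u" using ex_ascw u by blast
  have wd: "ascw \<one> (p @ alternating n s t)" "acts \<one> (p @ alternating n s t) = w"
    "ascw \<one> (p @ alternating n t s)" "acts \<one> (p @ alternating n t s) = w" using n p by simp_all
  have nm: "n \<noteq> m s t"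
  proof
    assume nm: "n = m s t"
    have "(p @ alternating n s t, p @ alternating n t s) \<in> moves P"
      using moves_braid[of p s t "[]" P] wd s t st mp unfolding nm by simp
    thus False using sim_alternating[OF n(1) wd] ns by blast
  qed
  hence nrm: "normal_id u s t n \<or> normal_swap u s t n" and dd: "\<forall>r\<in>S. desc u r \<longrightarrow> desc w r" using n by auto
  \<comment> \<open>For m(s,t) = 2 the climb takes (2 + 2) div 2 = 2 letters, so the braid move
    applies and \<open>n = m s t\<close>.\<close>
  have id3: "m s t \<ge> 3" if "normal_id u s t n"
  proof -
    have "n = (m s t + 2) div 2" using that by (simp add: normal_id_def)
    hence "m s t \<noteq> 2" using nm by auto
    thus ?thesis using m2 by linarith
  qed
  have 1: "psi w s s \<and> psi w t t \<and> m s t \<ge> 3 \<or> psi w s t \<and> psi w t s"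
    using nrm
  proof
    assume "normal_id u s t n"
    thus ?thesis using id3 by (auto simp: normal_id_def u(4)[symmetric] split: if_splits)
  next
    assume *: "normal_swap u s t n"
    have "m s t \<ge> 3" if "odd (m s t)" using that m2 by (metis even_numeral le_neq_implies_less numeral_2_eq_2 numeral_3_eq_3 Suc_leI)
    thus ?thesis using * by (auto simp: normal_swap_def u(4)[symmetric] split: if_splits)
  qed
  have "u \<noteq> \<one>"
  proof
    assume u1: "u = \<one>"
    hence p0: "p = []" using p len_ascw[of \<one> p] by simp
    let ?J = "{s, t}"
    have th: "\<theta> s = s \<and> \<theta> t = t \<and> normal_id u s t n \<or> \<theta> s = t \<and> \<theta> t = s \<and> normal_swap u s t n" 
      using nrm
    proof
      assume *: "normal_id u s t n"
      hence "\<one> \<otimes> s = \<theta> s \<otimes> \<one>" "\<one> \<otimes> t = \<theta> t \<otimes> \<one>" unfolding normal_id_def u1 by blast+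
      thus ?thesis using * s t by simp
    next
      assume *: "normal_swap u s t n"
      hence "\<one> \<otimes> s = \<theta> t \<otimes> \<one>" "\<one> \<otimes> t = \<theta> s \<otimes> \<one>" unfolding normal_swap_def u1 by blast+
      thus ?thesis using * s t by simp
    qed
    have stab: "theta_stable S \<theta> ?J" using th s t by (auto simp: theta_stable_def)
    have "labelled_type W (Type_I2 (m s t)) {s, t} [s, t]" using st m2 by (intro labelled_type.I2) auto
    hence lt: "labelled_type W (Type_I2 (m s t)) ?J (lab ?J)" using lab stab unfolding labelling_choice_def by blast
    then obtain x y where xy: "lab ?J = [x, y]" "?J = {x, y}" by (cases rule: labelled_type.cases) auto
    have rid: "restricts_to_id W \<theta> ?J \<longleftrightarrow> \<theta> s = s \<and> \<theta> t = t"
    proof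
      assume "restricts_to_id W \<theta> ?J"
      thus "\<theta> s = s \<and> \<theta> t = t" by (auto simp: restricts_to_id_def intro: generate.incl)
    next
      assume *: "\<theta> s = s \<and> \<theta> t = t"
      have "v \<in> carrier W \<and> \<theta> v = v" if "v \<in> generate W ?J" for v
        using that by (induction rule: generate.induct) (use * s t in auto)
      thus "restricts_to_id W \<theta> ?J" by (simp add: restricts_to_id_def)
    qed
    have "(alternating n x y, alternating n y x) \<in> P"
      using th
    proof
      assume *: "\<theta> s = s \<and> \<theta> t = t \<and> normal_id u s t n"
      hence n': "n = nat \<lceil>(real (m s t) + 1) / 2\<rceil>" by (simp add: normal_id_def ceil_half)
      show ?thesis unfolding n' by (rule listed_pairs.I2_id[where J = ?J]) (use stab lt xy id3 rid * in auto)
    next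
      assume *: "\<theta> s = t \<and> \<theta> t = s \<and> normal_swap u s t n"
      hence n': "n = nat \<lceil>real (m s t) / 2\<rceil>" by (simp add: normal_swap_def ceil_half)
      show ?thesis unfolding n' by (rule listed_pairs.I2_nonid[where J = ?J]) (use stab lt xy m2 rid * st in auto)
    qed
    \<comment> \<open>The chosen labelling may list the two letters in either order, so the pair may
      occur reversed.\<close>
    hence pp: "(alternating n s t, alternating n t s) \<in> P \<union> P\<inverse>" using xy(2) by (auto simp: doubleton_eq_iff)
    have "(alternating n s t @ [], alternating n t s @ []) \<in> moves P"
      by (rule moves_initial[OF pp]) (use wd p0 in simp_all)
    thus False using sim_alternating[OF n(1) wd] ns p0 by simp
  qed
  then obtain r where r: "r \<in> S" "desc u r" using ex_desc u by (metis I_carrier)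
  hence "r \<noteq> s" "r \<noteq> t" "desc w r" using u dd by auto
  thus ?thesis using 1 r by blast
qed

text \<open>Let u be the element reached by the common prefix \<open>p\<close>. All letters of
  \<open>K\<close> except \<open>x\<close> and \<open>y\<close> are descents of u and remain
  descents of the top over \<open>x\<close> and \<open>y\<close>. This top then has all of
  \<open>K\<close> as descents and equals \<open>w\<close>, so the listed words are reduced
  expressions of \<open>w\<close>.\<close>

lemma listed_connect:
  assumes K: "K \<subseteq> S" and ks: "ks \<in> lists K" "w = wp ks" and psi: "\<And>k. k \<in> K \<Longrightarrow> psi w k k" 
    and d: "\<And>k. k \<in> K \<Longrightarrow> desc w k"
    and path: "asc_path p us" "us \<in> lists K" and xy: "x \<in> K" "y \<in> K" "x \<noteq> y"
    and nc: "(\<forall>f. play f us x = f (\<theta> x)) \<and> (\<forall>f. play f us y = f (\<theta> y)) \<and> n = (m x y + 2) div 2 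
      \<or> (\<forall>f. play f us x = f (\<theta> y)) \<and> (\<forall>f. play f us y = f (\<theta> x)) \<and> n = (m x y + 1) div 2"
    and rest: "\<And>z. z \<in> K \<Longrightarrow> z \<noteq> x \<Longrightarrow> z \<noteq> y \<Longrightarrow> play (\<lambda>_. 1) us z < 0"
    and pair: "(p @ alternating n x y, p @ alternating n y x) \<in> P"
  shows "sim x y"
proof -
  define u where "u = acts \<one> p"
  have p: "ascw \<one> p" "u = wp us" "us \<in> lists S" using path by (auto simp: asc_path_def u_def)
  have u: "u \<in> \<I>" unfolding u_def by (rule acts_I[OF one_I ascw_lists[OF p(1)]])
  have uc: "u \<in> carrier W" using u by simp
  have S: "x \<in> S" "y \<in> S" using xy K by auto
  have Au: "A f u = play f us" for f using A_wp p by simp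
  have asc: "\<not> desc u x" "\<not> desc u y" using desc_iff[OF uc S(1)] desc_iff[OF uc S(2)] nc by (auto simp: Au)
  have mp: "m x y > 0" using desc_m_pos[of w x y] w S xy d by simp
  note cc = u S xy(3) asc mp
  let ?top = "local_top u x y"
  have nc': "(\<forall>f. A f u x = f (\<theta> x)) \<and> (\<forall>f. A f u y = f (\<theta> y)) \<or> (\<forall>f. A f u x = f (\<theta> y)) \<and> (\<forall>f. A f u y = f (\<theta> x))"
    using nc by (auto simp: Au)
  obtain n' where n': "1 \<le> n'" "ascw u (alternating n' x y)" "ascw u (alternating n' y x)"
    "acts u (alternating n' x y) = ?top" "acts u (alternating n' y x) = ?top"
    "normal_id u x y n' \<or> normal_swap u x y n'" using rank_two_normal[OF cc nc'] by blast
  have ne: "\<not> (u \<otimes> x = \<theta> x \<otimes> u \<and> u \<otimes> x = \<theta> y \<otimes> u)"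
  proof
    assume "u \<otimes> x = \<theta> x \<otimes> u \<and> u \<otimes> x = \<theta> y \<otimes> u"
    hence "\<theta> x \<otimes> u = \<theta> y \<otimes> u" by argo
    hence "\<theta> x = \<theta> y" using uc S by simp
    thus False using S xy by simp
  qed
  have tr: "u \<otimes> x = z \<otimes> u" if "\<forall>f. play f us x = f z" "z \<in> S" for z
    using root_transport[OF uc S(1) that(2)] that(1) Au by simp
  have nn: "n' = n" using nc
  proof (elim disjE conjE)
    assume *: "\<forall>f. play f us x = f (\<theta> x)" "n = (m x y + 2) div 2"
    have "u \<otimes> x = \<theta> x \<otimes> u" using tr[OF *(1)] S by simp
    thus ?thesis using n'(6) ne *(2) by (auto simp: normal_id_def normal_swap_def)
  next
    assume *: "\<forall>f. play f us x = f (\<theta> y)" "n = (m x y + 1) div 2"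
    have "u \<otimes> x = \<theta> y \<otimes> u" using tr[OF *(1)] S by simp
    thus ?thesis using n'(6) ne *(2) by (auto simp: normal_id_def normal_swap_def)
  qed
  have topd: "desc ?top k" if k: "k \<in> K" for k
  proof (cases "k = x \<or> k = y")
    case True
    thus ?thesis using desc_local_top[OF cc] by auto
  next
    case False
    have kS: "k \<in> S" using k K by auto
    have "desc u k" using desc_iff[OF uc kS] rest[OF k] False by (simp add: Au)
    thus ?thesis using normal_local_top(3)[OF cc nc'] kS by blast
  qed
  have al: "alternating (m x y) x y \<in> lists K" using xy by (intro alternating_lists)
  hence "alternating (m x y) x y \<in> lists S" using K by (auto simp: in_lists_conv_set)
  hence tw: "?top = wp (us @ alternating (m x y) x y)" using normal_local_top(1)[OF cc nc'] p by simp
  have "wp (us @ alternating (m x y) x y) = w"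
    by (rule longest_unique[OF K ks psi]) (use path al topd tw in auto)
  hence top: "?top = w" using tw by simp
  have wd: "ascw \<one> (p @ alternating n x y)" "acts \<one> (p @ alternating n x y) = w"
    "ascw \<one> (p @ alternating n y x)" "acts \<one> (p @ alternating n y x) = w" 
    using n' p top unfolding nn by (simp_all add: u_def)
  have "((p @ alternating n x y) @ [], (p @ alternating n y x) @ []) \<in> moves P"
    by (rule moves_initial) (use wd pair in simp_all)
  thus ?thesis using sim_alternating[of n p x y] wd n'(1) nn by simp
qed

end

lemma alternating_numerals: "alternating 2 s t = [s, t]" "alternating 3 s t = [s, t, s]"
  by (simp_all add: eval_nat_numeral)

section \<open>Affine diagrams, excluded as sets of descents\<close>

context coxeter_system
begin

lemma c_values: "m s t = 2 \<Longrightarrow> c s t = 0" "m s t = 3 \<Longrightarrow> c s t = 1" "m s t = 4 \<Longrightarrow> c s t = sqrt 2"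
  by (simp_all add: c_def cos_60 cos_45)

lemma c_lower: "m s t \<ge> 3 \<Longrightarrow> c s t \<ge> 1" "m s t \<ge> 4 \<Longrightarrow> c s t \<ge> sqrt 2" "m s t \<ge> 6 \<Longrightarrow> c s t \<ge> sqrt 3"
  using c_mono[of 3 s t] c_mono[of 4 s t] c_mono[of 6 s t] by (simp_all add: cos_60 cos_45 cos_30)

text \<open>The golden ratio: \<open>cheb c 5\<close> factors as (c^2 - c - 1)(c^2 + c - 1), and the
  second factor is positive for c >= 1.\<close>

lemma c_golden: assumes "m s t = 5" shows "c s t * c s t = c s t + 1" "c s t > 1"
proof -
  let ?c = "c s t"
  have 1: "?c \<ge> 1" using c_lower(1)[of s t] assms by simp
  have "cheb ?c 5 = 0" using cheb_cos_zero(1)[of 5 ?c "pi / real 5"] assms by (simp add: c_def)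
  hence "(?c * ?c - ?c - 1) * (?c * ?c + ?c - 1) = 0" by (simp add: eval_nat_numeral algebra_simps)
  moreover have "?c * ?c + ?c - 1 > 0" using 1 mult_mono[of 1 ?c 1 ?c] by simp
  ultimately show g: "?c * ?c = ?c + 1" by simp
  hence "?c \<noteq> 1" by auto
  thus "?c > 1" using 1 by simp
qed

text \<open>The weights used in the exclusions are null vectors of affine diagrams: A2
  (\<open>no_triangle\<close>), C2 (\<open>no_path_44\<close>), G2 (\<open>no_path_36\<close>), A3
  (\<open>no_square\<close>), B3 (\<open>no_star_4\<close>) and D4 (\<open>no_five\<close>). Larger
  bonds only increase the pairing sums.\<close>

lemma no_three:
  assumes w: "w \<in> carrier W" "a \<in> S" "b \<in> S" "e \<in> S" "distinct [a, b, e]" "desc w a" "desc w b" "desc w e"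
    and d: "da > 0" "db \<ge> 0" "de \<ge> 0"
      "db * c a b + de * c a e \<ge> 2 * da" "da * c a b + de * c b e \<ge> 2 * db" "da * c a e + db * c b e \<ge> 2 * de"
  shows False
proof (rule no_degenerate_descents[of "{a, b, e}" a "\<lambda>k. if k = a then da else if k = b then db else de" w])
  fix k assume "k \<in> {a, b, e}"
  thus "(\<Sum>j\<in>{a, b, e}. (if j = a then da else if j = b then db else de) * c j k) \<ge> 0"
    using d w c_sym[of b a] c_sym[of e a] c_sym[of e b] by auto
qed (use w d in auto)

lemma no_four:
  assumes w: "w \<in> carrier W" "a \<in> S" "b \<in> S" "e \<in> S" "r \<in> S" "distinct [a, b, e, r]" 
      "desc w a" "desc w b" "desc w e" "desc w r"
    and d: "da > 0" "db \<ge> 0" "de \<ge> 0" "dr \<ge> 0"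
      "db * c a b + de * c a e + dr * c a r \<ge> 2 * da" "da * c a b + de * c b e + dr * c b r \<ge> 2 * db" 
      "da * c a e + db * c b e + dr * c e r \<ge> 2 * de" "da * c a r + db * c b r + de * c e r \<ge> 2 * dr"
  shows False
proof (rule no_degenerate_descents[of "{a, b, e, r}" a 
      "\<lambda>k. if k = a then da else if k = b then db else if k = e then de else dr" w])
  fix k assume "k \<in> {a, b, e, r}"
  thus "(\<Sum>j\<in>{a, b, e, r}. (if j = a then da else if j = b then db else if j = e then de else dr) * c j k) \<ge> 0"
    using d w c_sym[of b a] c_sym[of e a] c_sym[of e b] c_sym[of r a] c_sym[of r b] c_sym[of r e] by auto
qed (use w d in auto)

lemma no_five:
  assumes w: "w \<in> carrier W" "a \<in> S" "b \<in> S" "e \<in> S" "r \<in> S" "q \<in> S" "distinct [a, b, e, r, q]" 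
      "desc w a" "desc w b" "desc w e" "desc w r" "desc w q"
    and star: "m b a \<ge> 3" "m b e \<ge> 3" "m b r \<ge> 3" "m b q \<ge> 3"
  shows False
proof (rule no_degenerate_descents[of "{a, b, e, r, q}" b "\<lambda>k. if k = b then 2 else 1" w])
  have c1: "c b a \<ge> 1" "c b e \<ge> 1" "c b r \<ge> 1" "c b q \<ge> 1" by (intro c_lower star)+
  hence c1': "c a b \<ge> 1" "c e b \<ge> 1" "c r b \<ge> 1" "c q b \<ge> 1"
    using c_sym[of b a] c_sym[of b e] c_sym[of b r] c_sym[of b q] w by simp_all
  have c0: "c x y \<ge> 0" if "x \<in> {a, e, r, q}" "y \<in> {a, e, r, q}" "x \<noteq> y" for x y
    using c_nonneg[of x y] w that by auto
  note c0 = c0[of a e] c0[of e a] c0[of a r] c0[of r a] c0[of a q] c0[of q a] c0[of e r] c0[of r e] 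
    c0[of e q] c0[of q e] c0[of r q] c0[of q r]
  fix k assume k: "k \<in> {a, b, e, r, q}"
  have e: "(\<Sum>j\<in>{a, b, e, r, q}. (if j = b then 2 else 1) * c j k) = c a k + 2 * c b k + c e k + c r k + c q k"
    using w by auto
  show "(\<Sum>j\<in>{a, b, e, r, q}. (if j = b then 2 else 1) * c j k) \<ge> 0"
    unfolding e using k c1 c1' c0 w by auto
qed (use w in auto)

lemma no_triangle:
  assumes "w \<in> carrier W" "a \<in> S" "b \<in> S" "e \<in> S" "distinct [a, b, e]" "desc w a" "desc w b" "desc w e"
    "m a b \<ge> 3" "m b e \<ge> 3" "m a e \<ge> 3"
  shows False
  using no_three[OF assms(1-8), of 1 1 1] c_lower(1)[of a b] c_lower(1)[of b e] c_lower(1)[of a e] assms by simp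

lemma sqrt_mult_ge: "x \<ge> 0 \<Longrightarrow> y \<ge> sqrt x \<Longrightarrow> sqrt x * y \<ge> x"
  using mult_left_mono[of "sqrt x" y "sqrt x"] by simp

lemma no_path_44:
  assumes "w \<in> carrier W" "a \<in> S" "b \<in> S" "e \<in> S" "distinct [a, b, e]" "desc w a" "desc w b" "desc w e"
    "m a b \<ge> 4" "m b e \<ge> 4" 
  shows False
proof (rule no_three[OF assms(1-8), of 1 "sqrt 2" 1])
  have "c a e \<ge> 0" using c_nonneg assms by auto
  moreover have "c a b \<ge> sqrt 2" "c b e \<ge> sqrt 2" using c_lower assms by auto
  moreover have "sqrt 2 * c a b \<ge> 2" "sqrt 2 * c b e \<ge> 2" using calculation by (auto intro: sqrt_mult_ge)
  ultimately show "sqrt 2 * c a b + 1 * c a e \<ge> 2 * 1" "1 * c a b + 1 * c b e \<ge> 2 * sqrt 2" 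
    "1 * c a e + sqrt 2 * c b e \<ge> 2 * 1" by auto
qed auto

lemma no_path_36:
  assumes "w \<in> carrier W" "a \<in> S" "b \<in> S" "e \<in> S" "distinct [a, b, e]" "desc w a" "desc w b" "desc w e"
    "m a b \<ge> 6" "m b e \<ge> 3" 
  shows False
proof (rule no_three[OF assms(1-8), of "sqrt 3" 2 1])
  have "c a e \<ge> 0" using c_nonneg assms by auto
  moreover have "c a b \<ge> sqrt 3" "c b e \<ge> 1" using c_lower assms by auto
  moreover have "sqrt 3 * c a b \<ge> 3" using calculation by (auto intro: sqrt_mult_ge)
  moreover have "sqrt 3 * c a e \<ge> 0" using calculation by simp
  ultimately show "2 * c a b + 1 * c a e \<ge> 2 * sqrt 3" "sqrt 3 * c a b + 1 * c b e \<ge> 2 * 2" 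
    "sqrt 3 * c a e + 2 * c b e \<ge> 2 * 1" by - linarith+
qed auto

lemma no_square:
  assumes "w \<in> carrier W" "a \<in> S" "b \<in> S" "e \<in> S" "r \<in> S" "distinct [a, b, e, r]" 
    "desc w a" "desc w b" "desc w e" "desc w r"
    "m a b \<ge> 3" "m b e \<ge> 3" "m e r \<ge> 3" "m a r \<ge> 3"
  shows False
proof (rule no_four[OF assms(1-10), of 1 1 1 1])
  have "c a e \<ge> 0" "c b r \<ge> 0" using c_nonneg assms by auto
  moreover have "c a b \<ge> 1" "c b e \<ge> 1" "c e r \<ge> 1" "c a r \<ge> 1" using c_lower(1) assms by auto
  ultimately show "1 * c a b + 1 * c a e + 1 * c a r \<ge> 2 * 1" "1 * c a b + 1 * c b e + 1 * c b r \<ge> 2 * 1" 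
      "1 * c a e + 1 * c b e + 1 * c e r \<ge> 2 * 1" "1 * c a r + 1 * c b r + 1 * c e r \<ge> 2 * 1" by auto
qed auto

lemma no_star_4:
  assumes "w \<in> carrier W" "a \<in> S" "b \<in> S" "e \<in> S" "r \<in> S" "distinct [a, b, e, r]" 
    "desc w a" "desc w b" "desc w e" "desc w r"
    "m a b \<ge> 4" "m b e \<ge> 3" "m b r \<ge> 3"
  shows False
proof (rule no_four[OF assms(1-10), of "sqrt 2" 2 1 1])
  have "c a e \<ge> 0" "c a r \<ge> 0" "c e r \<ge> 0" using c_nonneg assms by auto
  moreover have "c a b \<ge> sqrt 2" "c b e \<ge> 1" "c b r \<ge> 1" using c_lower assms by auto
  moreover have "sqrt 2 * c a b \<ge> 2" using calculation by (auto intro: sqrt_mult_ge)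
  moreover have "sqrt 2 * c a e \<ge> 0" "sqrt 2 * c a r \<ge> 0" using calculation by auto
  ultimately show "2 * c a b + 1 * c a e + 1 * c a r \<ge> 2 * sqrt 2" "sqrt 2 * c a b + 1 * c b e + 1 * c b r \<ge> 2 * 2" 
      "sqrt 2 * c a e + 2 * c b e + 1 * c e r \<ge> 2 * 1" "sqrt 2 * c a r + 2 * c b r + 1 * c e r \<ge> 2 * 1" by - linarith+
qed auto

text \<open>Firing in the labelled diagrams of rank 3 (with first bond \<open>p = c s\<^sub>1 s\<^sub>2\<close>) and of type \<open>D\<^sub>4\<close>; the
  index \<open>i\<close> stands for the letter \<open>s\<^bsub>i+1\<^esub>\<close>.\<close>

fun fire3 :: "real \<Rightarrow> real \<times> real \<times> real \<Rightarrow> nat \<Rightarrow> real \<times> real \<times> real" where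
  "fire3 p (x, y, z) i = (if i = 0 then (-x, y + p * x, z) else if i = 1 then (x + p * y, -y, z + y) else (x, y + z, -z))"

fun fire4 :: "real \<times> real \<times> real \<times> real \<Rightarrow> nat \<Rightarrow> real \<times> real \<times> real \<times> real" where
  "fire4 (x, y, z, v) i = (if i = 0 then (-x, y, z + x, v) else if i = 1 then (x, -y, z + y, v) 
     else if i = 2 then (x + z, y + z, -z, v + z) else (x, y, z + v, -v))"

lemma play3:
  assumes "s1 \<in> S" "s2 \<in> S" "s3 \<in> S" "c s1 s2 = p" "c s2 s3 = 1" "c s1 s3 = 0" "set is \<subseteq> {0, 1, 2}"
  shows "(play f (map ((!) [s1, s2, s3]) is) s1, play f (map ((!) [s1, s2, s3]) is) s2, play f (map ((!) [s1, s2, s3]) is) s3)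
    = foldl (fire3 p) (f s1, f s2, f s3) is"
  using assms(7)
proof (induction "is" arbitrary: f)
  case (Cons i js)
  have "c s2 s1 = p" "c s3 s2 = 1" "c s3 s1 = 0" 
    using c_sym[of s2 s1] c_sym[of s3 s2] c_sym[of s3 s1] assms(1-6) by simp_all
  hence "fire3 p (f s1, f s2, f s3) i = (fire f ([s1, s2, s3] ! i) s1, fire f ([s1, s2, s3] ! i) s2, fire f ([s1, s2, s3] ! i) s3)"
    using assms(1-6) Cons(2) by (auto simp: fire_def)
  thus ?case using Cons by simp
qed simp

lemma play4:
  assumes "s1 \<in> S" "s2 \<in> S" "s3 \<in> S" "s4 \<in> S" "c s1 s3 = 1" "c s2 s3 = 1" "c s4 s3 = 1" "c s1 s2 = 0" "c s1 s4 = 0" "c s2 s4 = 0"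
    "set is \<subseteq> {0, 1, 2, 3}"
  shows "(play f (map ((!) [s1, s2, s3, s4]) is) s1, play f (map ((!) [s1, s2, s3, s4]) is) s2, 
      play f (map ((!) [s1, s2, s3, s4]) is) s3, play f (map ((!) [s1, s2, s3, s4]) is) s4)
    = foldl fire4 (f s1, f s2, f s3, f s4) is"
  using assms(11)
proof (induction "is" arbitrary: f)
  case (Cons i js)
  have "c s3 s1 = 1" "c s3 s2 = 1" "c s3 s4 = 1" "c s2 s1 = 0" "c s4 s1 = 0" "c s4 s2 = 0" 
    using c_sym[of s3 s1] c_sym[of s3 s2] c_sym[of s3 s4] c_sym[of s2 s1] c_sym[of s4 s1] c_sym[of s4 s2] assms(1-10) by simp_all
  hence "fire4 (f s1, f s2, f s3, f s4) i = (fire f ([s1, s2, s3, s4] ! i) s1, fire f ([s1, s2, s3, s4] ! i) s2, 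
      fire f ([s1, s2, s3, s4] ! i) s3, fire f ([s1, s2, s3, s4] ! i) s4)"
    using assms(1-10) Cons(2) by (auto simp: fire_def)
  thus ?case using Cons by simp
qed simp

end

section \<open>The listed moves of rank 3 and 4\<close>

context word_property_step
begin

definition longest_in :: "'a set \<Rightarrow> bool" where
  "longest_in K \<longleftrightarrow> K \<subseteq> S \<and> (\<exists>ks\<in>lists K. w = wp ks) \<and> (\<forall>k\<in>K. psi w k k \<and> desc w k)"

lemma longest_in_theta:
  assumes "longest_in K" "xs \<in> lists K" "\<And>f k. k \<in> K \<Longrightarrow> play f xs k = - f (\<pi> k)" "k \<in> K"
  shows "\<theta> k = \<pi> k"
proof -
  obtain ks where "K \<subseteq> S" "ks \<in> lists K" "w = wp ks" "\<And>k. k \<in> K \<Longrightarrow> psi w k k"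
    using assms(1) by (auto simp: longest_in_def)
  from theta_from_word[OF this assms(2-4)] show ?thesis .
qed

lemma longest_in_stable:
  assumes "longest_in K" shows "theta_stable S \<theta> K"
proof -
  obtain ks where ks: "K \<subseteq> S" "ks \<in> lists K" "w = wp ks" "\<And>k. k \<in> K \<Longrightarrow> psi w k k"
    using assms(1) by (auto simp: longest_in_def)
  have th: "\<theta> k \<in> K" if "k \<in> K" for k using theta_parabolic[OF ks that] .
  have "k \<in> \<theta> ` K" if "k \<in> K" for k using th[OF that] that ks(1) by (intro image_eqI[of _ _ "\<theta> k"]) auto
  thus ?thesis using th ks(1) by (auto simp: theta_stable_def)
qed

lemma longest_in_labelled:
  assumes "longest_in K" "labelled_type W T K ss"
  shows "labelled_type W T K (lab K)"
  using lab longest_in_stable[OF assms(1)] assms(2) unfolding labelling_choice_def by blast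

lemma longest_in_restricts: "longest_in K \<Longrightarrow> restricts_to_id W \<theta> K \<longleftrightarrow> (\<forall>k\<in>K. \<theta> k = k)"
  using restricts_to_id_iff unfolding longest_in_def by blast

lemma longest_in_connect:
  assumes "longest_in K" "asc_path p us" "us \<in> lists K" "x \<in> K" "y \<in> K" "x \<noteq> y"
    "(\<forall>f. play f us x = f (\<theta> x)) \<and> (\<forall>f. play f us y = f (\<theta> y)) \<and> n = (m x y + 2) div 2 
      \<or> (\<forall>f. play f us x = f (\<theta> y)) \<and> (\<forall>f. play f us y = f (\<theta> x)) \<and> n = (m x y + 1) div 2"
    "\<And>z. z \<in> K \<Longrightarrow> z \<noteq> x \<Longrightarrow> z \<noteq> y \<Longrightarrow> play (\<lambda>_. 1) us z < 0"
    "(p @ alternating n x y, p @ alternating n y x) \<in> P"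
  shows "sim x y"
proof -
  obtain ks where ks: "K \<subseteq> S" "ks \<in> lists K" "w = wp ks" "\<And>k. k \<in> K \<Longrightarrow> psi w k k" "\<And>k. k \<in> K \<Longrightarrow> desc w k"
    using assms(1) by (auto simp: longest_in_def)
  from listed_connect[OF ks assms(2-)] show ?thesis .
qed

text \<open>The prefix \<open>[s2, s3]\<close> reaches u = s1 s2 s3, which sends \<alpha>_s1 to
  \<alpha>_s2 and \<alpha>_s2 to \<alpha>_s3. As \<theta> exchanges s1 and s3, this is the swapped
  case with bond 3, and each climb to \<open>w\<close> takes 2 letters.\<close>

lemma connect_A3:
  assumes K: "longest_in {s1, s2, s3}" and lb: "lab {s1, s2, s3} = [s1, s2, s3]"
    and lt: "labelled_type W Type_A3 {s1, s2, s3} (lab {s1, s2, s3})"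
    and ms: "distinct [s1, s2, s3]" "m s1 s2 = 3" "m s2 s3 = 3" "m s1 s3 = 2"
  shows "sim s1 s2"
proof -
  let ?K = "{s1, s2, s3}"
  have S: "s1 \<in> S" "s2 \<in> S" "s3 \<in> S" using K by (auto simp: longest_in_def)
  note E = play3[OF S, of 1, OF _ _ _, unfolded c_values(1)[OF ms(4)] c_values(2)[OF ms(2)] c_values(2)[OF ms(3)], OF refl refl refl]
  \<comment> \<open>A word for the longest element of A3; it negates the simple roots up to the
    reflection of the diagram.\<close>
  have "\<theta> k = (if k = s1 then s3 else if k = s2 then s2 else s1)" if "k \<in> ?K" for k
  proof (rule longest_in_theta[OF K _ _ that, of "[s1, s2, s3, s1, s2, s1]"])
    fix f k assume "k \<in> ?K"
    thus "play f [s1, s2, s3, s1, s2, s1] k = - f (if k = s1 then s3 else if k = s2 then s2 else s1)"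
      using E[of "[0, 1, 2, 0, 1, 0]" f] ms by auto
  qed auto
  hence th: "\<theta> s1 = s3" "\<theta> s2 = s2" "\<theta> s3 = s1" using ms by auto
  have "asc_path [s2] [s2]" using asc_path_one[OF asc_path_Nil S(2)] th by simp
  hence path: "asc_path [s2, s3] [s1, s2, s3]" using asc_path_two[OF _ S(3)] E[of "[1]" "\<lambda>_. 1"] th by fastforce
  have "\<not> restricts_to_id W \<theta> ?K" using longest_in_restricts[OF K] th ms by auto
  hence "([s2, s3, s1, s2], [s2, s3, s2, s1]) \<in> P"
    using longest_in_stable[OF K] lt lb by (intro listed_pairs.A3[where J = ?K])
  moreover have "play f [s1, s2, s3] s1 = f s2" "play f [s1, s2, s3] s2 = f s3" "play f [s1, s2, s3] s3 = - f s1 - f s2 - f s3" for f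
    using E[of "[0, 1, 2]" f] by simp_all
  ultimately show ?thesis using ms th
    by (intro longest_in_connect[OF K path, of _ _ 2]) (auto simp: alternating_numerals)
qed

text \<open>The prefix \<open>[s1, s2, s3]\<close> reaches an element that fixes \<alpha>_s1 and
  \<alpha>_s2; with bond 4 and trivial \<theta>, each climb takes 3 letters.\<close>

lemma connect_B3:
  assumes K: "longest_in {s1, s2, s3}" and lb: "lab {s1, s2, s3} = [s1, s2, s3]"
    and lt: "labelled_type W Type_B3 {s1, s2, s3} (lab {s1, s2, s3})"
    and ms: "distinct [s1, s2, s3]" "m s1 s2 = 4" "m s2 s3 = 3" "m s1 s3 = 2"
  shows "sim s1 s2"
proof -
  let ?K = "{s1, s2, s3}"
  have S: "s1 \<in> S" "s2 \<in> S" "s3 \<in> S" using K by (auto simp: longest_in_def)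
  define p where "p = c s1 s2"
  have p: "p * p = 2" "p * (p * x) = 2 * x" "p > 0" for x using c_values(3)[OF ms(2)] by (simp_all add: p_def flip: mult.assoc)
  note E = play3[OF S p_def[symmetric], unfolded c_values(1)[OF ms(4)] c_values(2)[OF ms(3)], OF refl refl]
  \<comment> \<open>The Coxeter number is 6, and the cube of the Coxeter element is -1.\<close>
  have "\<theta> k = k" if "k \<in> ?K" for k
  proof (rule longest_in_theta[OF K _ _ that, of "[s1, s2, s3, s1, s2, s3, s1, s2, s3]"])
    fix f k assume "k \<in> ?K"
    thus "play f [s1, s2, s3, s1, s2, s3, s1, s2, s3] k = - f k"
      using E[of "[0, 1, 2, 0, 1, 2, 0, 1, 2]" f] by (auto simp: p algebra_simps)
  qed auto
  hence th: "\<theta> s1 = s1" "\<theta> s2 = s2" "\<theta> s3 = s3" by auto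
  have "asc_path [s1] [s1]" using asc_path_one[OF asc_path_Nil S(1)] th by simp
  hence "asc_path [s1, s2] [s2, s1, s2]" using asc_path_two[OF _ S(2), of "[s1]" "[s1]"] E[of "[0]" "\<lambda>_. 1"] th p(3) by simp
  hence path: "asc_path [s1, s2, s3] [s3, s2, s1, s2, s3]" 
    using asc_path_two[OF _ S(3), of "[s1, s2]" "[s2, s1, s2]"] E[of "[1, 0, 1]" "\<lambda>_. 1"] th p(3) by (simp add: algebra_simps p(1,2))
  have "([s1, s2, s3, s1, s2, s1], [s1, s2, s3, s2, s1, s2]) \<in> P"
    using longest_in_stable[OF K] lt lb by (intro listed_pairs.B3[where J = ?K])
  moreover have "play f [s3, s2, s1, s2, s3] s1 = f s1" "play f [s3, s2, s1, s2, s3] s2 = f s2" 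
    "play (\<lambda>_. 1) [s3, s2, s1, s2, s3] s3 < 0" for f
    using E[of "[2, 1, 0, 1, 2]" f] E[of "[2, 1, 0, 1, 2]" "\<lambda>_. 1"] p(3) by (simp_all add: algebra_simps p(1,2))
  ultimately show ?thesis using ms th
    by (intro longest_in_connect[OF K path, of _ _ 3]) (auto simp: alternating_numerals)
qed

text \<open>The common prefix of 7 letters reaches an element that exchanges \<alpha>_s2 and
  \<alpha>_s3; with bond 3, each climb takes 2 letters.\<close>

lemma connect_H3:
  assumes K: "longest_in {s1, s2, s3}" and lb: "lab {s1, s2, s3} = [s1, s2, s3]"
    and lt: "labelled_type W Type_H3 {s1, s2, s3} (lab {s1, s2, s3})"
    and ms: "distinct [s1, s2, s3]" "m s1 s2 = 5" "m s2 s3 = 3" "m s1 s3 = 2"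
  shows "sim s3 s2"
proof -
  let ?K = "{s1, s2, s3}"
  have S: "s1 \<in> S" "s2 \<in> S" "s3 \<in> S" using K by (auto simp: longest_in_def)
  define p where "p = c s1 s2"
  have p1: "p * p = p + 1" "p > 1" using c_golden[OF ms(2)] by (simp_all add: p_def)
  have p: "p * p = p + 1" "p * (p * x) = p * x + x" for x using p1(1) by (simp_all add: algebra_simps flip: mult.assoc)
  note E = play3[OF S p_def[symmetric], unfolded c_values(1)[OF ms(4)] c_values(2)[OF ms(3)], OF refl refl]
  \<comment> \<open>The Coxeter number is 10, and the fifth power of the Coxeter element is
    -1.\<close>
  have "\<theta> k = k" if "k \<in> ?K" for k
  proof (rule longest_in_theta[OF K _ _ that, of "[s1, s2, s3, s1, s2, s3, s1, s2, s3, s1, s2, s3, s1, s2, s3]"])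
    fix f k assume "k \<in> ?K"
    thus "play f [s1, s2, s3, s1, s2, s3, s1, s2, s3, s1, s2, s3, s1, s2, s3] k = - f k"
      using E[of "[0, 1, 2, 0, 1, 2, 0, 1, 2, 0, 1, 2, 0, 1, 2]" f] by (auto simp: p algebra_simps)
  qed auto
  hence th: "\<theta> s1 = s1" "\<theta> s2 = s2" "\<theta> s3 = s3" by auto
  have "asc_path [s1] [s1]" using asc_path_one[OF asc_path_Nil S(1)] th by simp
  moreover have "play f [s1] s3 = f s3" for f using E[of "[0]" f] by simp
  ultimately have "asc_path [s1, s3] [s1, s3]" using asc_path_one[OF _ S(3), of "[s1]" "[s1]"] th by simp
  hence "asc_path [s1, s3, s2] [s2, s1, s3, s2]" 
    using asc_path_two[OF _ S(2), of "[s1, s3]" "[s1, s3]"] E[of "[0, 2]" "\<lambda>_. 1"] th p1(2) by simp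
  hence "asc_path [s1, s3, s2, s1] [s1, s2, s1, s3, s2, s1]" 
    using asc_path_two[OF _ S(1), of "[s1, s3, s2]" "[s2, s1, s3, s2]"] E[of "[1, 0, 2, 1]" "\<lambda>_. 1"] th p1(2) 
    by (simp add: algebra_simps p)
  hence "asc_path [s1, s3, s2, s1, s3] [s3, s1, s2, s1, s3, s2, s1, s3]" 
    using asc_path_two[OF _ S(3), of "[s1, s3, s2, s1]" "[s1, s2, s1, s3, s2, s1]"] E[of "[0, 1, 0, 2, 1, 0]" "\<lambda>_. 1"] th p1(2) 
    by (simp add: algebra_simps p)
  hence "asc_path [s1, s3, s2, s1, s3, s2] [s2, s3, s1, s2, s1, s3, s2, s1, s3, s2]" 
    using asc_path_two[OF _ S(2), of "[s1, s3, s2, s1, s3]" "[s3, s1, s2, s1, s3, s2, s1, s3]"] 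
      E[of "[2, 0, 1, 0, 2, 1, 0, 2]" "\<lambda>_. 1"] th p1(2) 
    by (simp add: algebra_simps p)
  hence path: "asc_path [s1, s3, s2, s1, s3, s2, s1] [s1, s2, s3, s1, s2, s1, s3, s2, s1, s3, s2, s1]" 
    using asc_path_two[OF _ S(1), of "[s1, s3, s2, s1, s3, s2]" "[s2, s3, s1, s2, s1, s3, s2, s1, s3, s2]"] 
      E[of "[1, 2, 0, 1, 0, 2, 1, 0, 2, 1]" "\<lambda>_. 1"] th p1(2) 
    by (simp add: algebra_simps p)
  let ?u = "[s1, s2, s3, s1, s2, s1, s3, s2, s1, s3, s2, s1]"
  have "([s1, s3, s2, s1, s3, s2, s1, s3, s2], [s1, s3, s2, s1, s3, s2, s1, s2, s3]) \<in> P"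
    using longest_in_stable[OF K] lt lb by (intro listed_pairs.H3[where J = ?K])
  moreover have "play f ?u s2 = f s3" "play f ?u s3 = f s2" "play (\<lambda>_. 1) ?u s1 < 0" for f
    using E[of "[0, 1, 2, 0, 1, 0, 2, 1, 0, 2, 1, 0]" f] E[of "[0, 1, 2, 0, 1, 0, 2, 1, 0, 2, 1, 0]" "\<lambda>_. 1"] p1(2) 
    by (simp_all add: algebra_simps p)
  moreover have "m s3 s2 = 3" using ms m_sym S by simp
  ultimately show ?thesis using ms th
    by (intro longest_in_connect[OF K path, of _ _ 2]) (auto simp: alternating_numerals)
qed

text \<open>The common prefix of 6 letters reaches an element that exchanges \<alpha>_s3 and
  \<alpha>_s4. Its first three letters commute and act one-sidedly, the next three
  two-sidedly.\<close>

lemma connect_D4: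
  assumes K: "longest_in {s1, s2, s3, s4}" and lb: "lab {s1, s2, s3, s4} = [s1, s2, s3, s4]"
    and lt: "labelled_type W Type_D4 {s1, s2, s3, s4} (lab {s1, s2, s3, s4})"
    and ms: "distinct [s1, s2, s3, s4]" "m s1 s3 = 3" "m s2 s3 = 3" "m s4 s3 = 3" "m s1 s2 = 2" "m s1 s4 = 2" "m s2 s4 = 2"
  shows "sim s3 s4"
proof -
  let ?K = "{s1, s2, s3, s4}"
  have S: "s1 \<in> S" "s2 \<in> S" "s3 \<in> S" "s4 \<in> S" using K by (auto simp: longest_in_def)
  note E = play4[OF S c_values(2)[OF ms(2)] c_values(2)[OF ms(3)] c_values(2)[OF ms(4)] 
      c_values(1)[OF ms(5)] c_values(1)[OF ms(6)] c_values(1)[OF ms(7)]]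
  \<comment> \<open>The Coxeter number is 6, and the cube of the Coxeter element is -1.\<close>
  have th0: "\<theta> k = k" if "k \<in> ?K" for k
  proof (rule longest_in_theta[OF K _ _ that, of "[s1, s2, s4, s3, s1, s2, s4, s3, s1, s2, s4, s3]"])
    fix f k assume "k \<in> ?K"
    thus "play f [s1, s2, s4, s3, s1, s2, s4, s3, s1, s2, s4, s3] k = - f k"
      using E[of "[0, 1, 3, 2, 0, 1, 3, 2, 0, 1, 3, 2]" f] by auto
  qed auto
  hence th: "\<theta> s1 = s1" "\<theta> s2 = s2" "\<theta> s3 = s3" "\<theta> s4 = s4" by auto
  have "asc_path [s4] [s4]" using asc_path_one[OF asc_path_Nil S(4)] th by simp
  moreover have "play f [s4] s2 = f s2" for f using E[of "[3]" f] by simp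
  ultimately have "asc_path [s4, s2] [s4, s2]" using asc_path_one[OF _ S(2), of "[s4]" "[s4]"] th by simp
  moreover have "play f [s4, s2] s1 = f s1" for f using E[of "[3, 1]" f] by simp
  ultimately have "asc_path [s4, s2, s1] [s4, s2, s1]" using asc_path_one[OF _ S(1), of "[s4, s2]" "[s4, s2]"] th by simp
  hence "asc_path [s4, s2, s1, s3] [s3, s4, s2, s1, s3]" 
    using asc_path_two[OF _ S(3), of "[s4, s2, s1]" "[s4, s2, s1]"] E[of "[3, 1, 0]" "\<lambda>_. 1"] th by simp
  hence "asc_path [s4, s2, s1, s3, s2] [s2, s3, s4, s2, s1, s3, s2]" 
    using asc_path_two[OF _ S(2), of "[s4, s2, s1, s3]" "[s3, s4, s2, s1, s3]"] E[of "[2, 3, 1, 0, 2]" "\<lambda>_. 1"] th by simp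
  hence path: "asc_path [s4, s2, s1, s3, s2, s1] [s1, s2, s3, s4, s2, s1, s3, s2, s1]" 
    using asc_path_two[OF _ S(1), of "[s4, s2, s1, s3, s2]" "[s2, s3, s4, s2, s1, s3, s2]"] 
      E[of "[1, 2, 3, 1, 0, 2, 1]" "\<lambda>_. 1"] th by simp
  let ?u = "[s1, s2, s3, s4, s2, s1, s3, s2, s1]"
  have "restricts_to_id W \<theta> ?K" using longest_in_restricts[OF K] th0 by blast
  hence "([s4, s2, s1, s3, s2, s1, s3, s4], [s4, s2, s1, s3, s2, s1, s4, s3]) \<in> P"
    using longest_in_stable[OF K] lt lb by (intro listed_pairs.D4[where J = ?K])
  moreover have "play f ?u s3 = f s4" "play f ?u s4 = f s3" "play (\<lambda>_. 1) ?u s1 < 0" "play (\<lambda>_. 1) ?u s2 < 0" for f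
    using E[of "[0, 1, 2, 3, 1, 0, 2, 1, 0]" f] E[of "[0, 1, 2, 3, 1, 0, 2, 1, 0]" "\<lambda>_. 1"] by simp_all
  moreover have "m s3 s4 = 3" using ms m_sym S by simp
  ultimately show ?thesis using ms th
    by (intro longest_in_connect[OF K path, of _ _ 2]) (auto simp: alternating_numerals)
qed

lemma psi_fixed:
  assumes "x \<in> S" "y \<in> S" "x \<noteq> y" "desc w x" "desc w y" "psi w y y" "\<not> sim x y"
  shows "psi w x x" "m x y \<ge> 3"
  using pair_cases[of x y] psi_unique[of w y x y] assms by blast+

text \<open>In type A3 the labelling fixed by \<open>lab\<close> may traverse the path in either
  direction. Only the middle node \<open>b\<close> is determined, hence the disjunction.\<close>

lemma connect_rank_3:
  assumes K: "longest_in {a, b, e}" and abe: "distinct [a, b, e]" 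
    and ms: "m a b = 3 \<or> m a b = 4 \<or> m a b = 5" "m b e = 3" "m a e = 2"
  shows "sim b a \<or> sim b e"
proof -
  have S: "a \<in> S" "b \<in> S" "e \<in> S" using K by (auto simp: longest_in_def)
  have ctr: "s2 = b \<and> (s1 = a \<and> s3 = e \<or> s1 = e \<and> s3 = a)" 
    if "{a, b, e} = {s1, s2, s3}" "distinct [s1, s2, s3]" "m s1 s3 = 2" for s1 s2 s3
  proof -
    have "s1 \<in> {a, b, e}" "s2 \<in> {a, b, e}" "s3 \<in> {a, b, e}" unfolding that(1) by auto
    moreover have "m b a = m a b" "m e b = 3" using m_sym[of b a] m_sym[of e b] S ms by auto
    ultimately show ?thesis using that(2,3) ms by auto
  qed
  consider "m a b = 3" | "m a b = 4" | "m a b = 5" using ms by blast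
  thus ?thesis
  proof cases
    case 1
    have "labelled_type W Type_A3 {a, b, e} [a, b, e]" using 1 abe ms by (intro labelled_type.A3) auto
    hence lt: "labelled_type W Type_A3 {a, b, e} (lab {a, b, e})" by (rule longest_in_labelled[OF K])
    then obtain s1 s2 s3 where l: "lab {a, b, e} = [s1, s2, s3]" "{a, b, e} = {s1, s2, s3}" "distinct [s1, s2, s3]" 
      "m s1 s2 = 3" "m s2 s3 = 3" "m s1 s3 = 2" by (cases rule: labelled_type.cases) auto
    have "sim s1 s2" using connect_A3 K l lt by metis
    thus ?thesis using ctr[OF l(2,3,6)] sim_sym by blast
  next
    case 2
    have "labelled_type W Type_B3 {a, b, e} [a, b, e]" using 2 abe ms by (intro labelled_type.B3) auto
    hence lt: "labelled_type W Type_B3 {a, b, e} (lab {a, b, e})" by (rule longest_in_labelled[OF K])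
    then obtain s1 s2 s3 where l: "lab {a, b, e} = [s1, s2, s3]" "{a, b, e} = {s1, s2, s3}" "distinct [s1, s2, s3]" 
      "m s1 s2 = 4" "m s2 s3 = 3" "m s1 s3 = 2" by (cases rule: labelled_type.cases) auto
    have "sim s1 s2" using connect_B3 K l lt by metis
    thus ?thesis using ctr[OF l(2,3,6)] sim_sym by blast
  next
    case 3
    have "labelled_type W Type_H3 {a, b, e} [a, b, e]" using 3 abe ms by (intro labelled_type.H3) auto
    hence lt: "labelled_type W Type_H3 {a, b, e} (lab {a, b, e})" by (rule longest_in_labelled[OF K])
    then obtain s1 s2 s3 where l: "lab {a, b, e} = [s1, s2, s3]" "{a, b, e} = {s1, s2, s3}" "distinct [s1, s2, s3]" 
      "m s1 s2 = 5" "m s2 s3 = 3" "m s1 s3 = 2" by (cases rule: labelled_type.cases) auto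
    have "sim s3 s2" using connect_H3 K l lt by metis
    thus ?thesis using ctr[OF l(2,3,6)] sim_sym by blast
  qed
qed

lemma connect_rank_4:
  assumes K: "longest_in {a, b, e, r}" and abe: "distinct [a, b, e, r]" 
    and ms: "m b a = 3" "m b e = 3" "m b r = 3" "m a e = 2" "m a r = 2" "m e r = 2"
  shows "sim b a \<or> sim b e \<or> sim b r"
proof -
  have S: "a \<in> S" "b \<in> S" "e \<in> S" "r \<in> S" using K by (auto simp: longest_in_def)
  have ms': "m a b = 3" "m e b = 3" "m r b = 3" 
    using m_sym[of a b] m_sym[of e b] m_sym[of r b] S ms by auto
  let ?K = "{a, b, e, r}"
  have eq: "{a, e, b, r} = ?K" by auto
  have "labelled_type W Type_D4 {a, e, b, r} [a, e, b, r]" using abe ms ms' by (intro labelled_type.D4) auto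
  hence lt: "labelled_type W Type_D4 ?K (lab ?K)" unfolding eq by (rule longest_in_labelled[OF K])
  then obtain s1 s2 s3 s4 where l: "lab ?K = [s1, s2, s3, s4]" "?K = {s1, s2, s3, s4}" "distinct [s1, s2, s3, s4]" 
    "m s1 s3 = 3" "m s2 s3 = 3" "m s4 s3 = 3" "m s1 s2 = 2" "m s1 s4 = 2" "m s2 s4 = 2" 
    by (cases rule: labelled_type.cases) auto
  have "sim s3 s4" using connect_D4[of s1 s2 s3 s4] K l lt by simp
  moreover have "s3 = b"
  proof -
    have "s1 \<in> ?K" "s2 \<in> ?K" "s3 \<in> ?K" unfolding l(2) by auto
    thus ?thesis using l(3,4,5) ms ms' m_sym[of e a] m_sym[of r a] m_sym[of r e] S by auto
  qed
  moreover have "s4 \<in> {a, e, r}" using l(2,3) calculation(2) by auto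
  ultimately show ?thesis by blast
qed

lemma m_ge_3:
  assumes "x \<in> S" "y \<in> S" "x \<noteq> y" "desc w x" "desc w y" "m x y \<noteq> 2" shows "m x y \<ge> 3"
  using m_ge_2[of x y] desc_m_pos[of w x y] w assms by force

text \<open>If \<open>b\<close> is not connected to \<open>a\<close>, it is not connected to
  \<open>e\<close> either. Any further descent is then bonded to \<open>b\<close>: one of them
  completes the path to D4, a second one to the affine diagram D4.\<close>

lemma path_connect_aux:
  assumes S: "a \<in> S" "b \<in> S" "e \<in> S" and ne: "distinct [a, b, e]" and d: "desc w a" "desc w b" "desc w e"
    and p: "psi w a a" "psi w b b" "psi w e e" and ms: "m a b \<ge> 3" "m b e = 3" "m a e = 2" and ae: "sim a e"
  shows "sim b a"
proof (rule ccontr)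
  assume nba: "\<not> sim b a"
  have wc: "w \<in> carrier W" using w by simp
  have nbe: "\<not> sim b e" using nba sim_trans[of b e a] sim_sym[OF ae] S d by blast
  have sy: "m e b = 3" "m b a = m a b" "m e a = 2" using m_sym[of e b] m_sym[of b a] m_sym[of e a] S ms by auto
  have "\<not> m a b \<ge> 6" using no_path_36[of w a b e] wc S ne d ms by auto
  hence mab: "m a b = 3 \<or> m a b = 4 \<or> m a b = 5" using ms by linarith
  let ?K = "{a, b, e}"
  have KS: "?K \<subseteq> S" using S by auto
  have pK: "psi w k k" if "k \<in> ?K" for k using that p by auto
  show False
  proof (rule parabolic_rest[OF wc KS pK])
    fix ks assume "ks \<in> lists ?K" "w = wp ks"
    hence "longest_in ?K" unfolding longest_in_def using KS p d by blast
    thus False using connect_rank_3[of a b e] ne mab ms nba nbe by blast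
  next
    fix r assume r: "r \<in> S" "r \<notin> ?K" "desc w r"
    hence rne: "r \<noteq> a" "r \<noteq> b" "r \<noteq> e" by auto
    \<comment> \<open>If \<open>r\<close> were connected to \<open>b\<close>, it would be
      unconnected to \<open>a\<close> and \<open>e\<close>, hence bonded to both, which closes a
      square.\<close>
    have "\<not> sim r b"
    proof
      assume rb: "sim r b"
      hence "\<not> sim r a" "\<not> sim r e" using sim_trans[OF sim_sym[OF rb], of a] sim_trans[OF sim_sym[OF rb], of e] r nba nbe by auto
      hence "m r a \<ge> 3" "m r e \<ge> 3" using psi_fixed[of r a] psi_fixed[of r e] r rne S d p by auto
      thus False using no_square[of w a b e r] wc S r ne rne d ms m_sym[of e r] m_sym[of a r] by auto
    qed
    hence rb: "psi w r r" "m r b \<ge> 3" using psi_fixed[of r b] r rne S d p by auto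
    hence br: "m b r \<ge> 3" using m_sym[of b r] S r by simp
    have mxr: "m x r = 2" if x: "x \<in> {a, e}" for x
    proof (rule ccontr)
      assume "m x r \<noteq> 2"
      hence xr: "m x r \<ge> 3" using x S d r rne by (intro m_ge_3) auto
      show False by (rule no_triangle[of w x b r]) (use x wc S d r rne ne xr br ms sy in auto)
    qed
    have mar: "m a r = 2" and mer: "m e r = 2" using mxr by simp_all
    have "\<not> m a b \<ge> 4"
    proof
      assume "m a b \<ge> 4"
      thus False by (intro no_star_4[of w a b e r]) (use wc S r ne rne d ms br in auto)
    qed
    hence mab3: "m a b = 3" using ms by linarith
    have "\<not> m r b \<ge> 4"
    proof
      assume "m r b \<ge> 4"
      thus False by (intro no_star_4[of w r b e a]) (use wc S r ne rne d ms sy in auto)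
    qed
    hence mbr: "m b r = 3" using rb m_sym[of b r] S r by linarith
    have ar: "sim x r" if x: "x \<in> {a, e}" for x
    proof (rule ccontr)
      assume "\<not> sim x r"
      hence "m x r \<ge> 3" using x S d r rne rb(1) by (intro psi_fixed(2)) auto
      thus False using mxr[OF x] by simp
    qed
    have nbr: "\<not> sim b r" using sim_trans[of b r a] sim_sym[OF ar[of a]] r nba by blast
    let ?L = "{a, b, e, r}"
    have LS: "?L \<subseteq> S" using S r by auto
    have pL: "psi w k k" if "k \<in> ?L" for k using that p rb by auto
    show False
    proof (rule parabolic_rest[OF wc LS pL])
      fix ks assume "ks \<in> lists ?L" "w = wp ks"
      hence "longest_in ?L" unfolding longest_in_def using LS r(3) d p rb by blast
      thus False using connect_rank_4[of a b e r] ne rne mab3 mbr mar mer sy ms nba nbe nbr by auto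
    next
      fix q assume q: "q \<in> S" "q \<notin> ?L" "desc w q"
      hence qne: "q \<noteq> a" "q \<noteq> b" "q \<noteq> e" "q \<noteq> r" by auto
      have "\<not> sim q b"
      proof
        assume qb: "sim q b"
        hence "\<not> sim q a" "\<not> sim q e" using sim_trans[OF sim_sym[OF qb], of a] sim_trans[OF sim_sym[OF qb], of e] q nba nbe by auto
        hence "m q a \<ge> 3" "m q e \<ge> 3" using psi_fixed[of q a] psi_fixed[of q e] q qne S d p by auto
        thus False using no_square[of w a b e q] wc S q ne qne d ms m_sym[of e q] m_sym[of a q] by auto
      qed
      hence "m q b \<ge> 3" using psi_fixed[of q b] q qne S d p by auto
      hence "m b q \<ge> 3" using m_sym[of b q] S q by simp
      thus False by (intro no_five[of w a b e r q]) (use wc S r q ne rne qne d ms br sy in auto)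
    qed
  qed
qed

lemma path_connect:
  assumes S: "a \<in> S" "b \<in> S" "e \<in> S" and ne: "distinct [a, b, e]" and d: "desc w a" "desc w b" "desc w e"
    and p: "psi w a a" "psi w b b" "psi w e e" and ms: "m b a \<ge> 3" "m b e \<ge> 3"
  shows "sim b a"
proof -
  have wc: "w \<in> carrier W" using w by simp
  have sy: "m a b = m b a" "m e b = m b e" "m e a = m a e" using m_sym[of a b] m_sym[of e b] m_sym[of e a] S by auto
  have ae: "m a e = 2"
  proof (rule ccontr)
    assume "m a e \<noteq> 2"
    hence "m a e \<ge> 3" using S ne d by (intro m_ge_3) auto
    thus False by (intro no_triangle[of w a b e]) (use wc S ne d ms sy in auto)
  qed
  have sae: "sim a e"
  proof (rule ccontr)
    assume "\<not> sim a e"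
    hence "m a e \<ge> 3" using S ne d p by (intro psi_fixed(2)) auto
    thus False using ae by simp
  qed
  have "\<not> (m a b \<ge> 4 \<and> m b e \<ge> 4)"
  proof
    assume "m a b \<ge> 4 \<and> m b e \<ge> 4"
    thus False by (intro no_path_44[of w a b e]) (use wc S ne d in auto)
  qed
  hence "m b e = 3 \<or> m b a = 3" using ms sy by linarith
  thus ?thesis
  proof
    assume "m b e = 3"
    thus ?thesis using path_connect_aux[of a b e] S ne d p ms ae sae sy by simp
  next
    assume "m b a = 3"
    hence "sim b e" using path_connect_aux[of e b a] S ne d p ms ae sim_sym[OF sae] sy by auto
    thus ?thesis using sim_trans[of b e a] sim_sym[OF sae] S d by blast
  qed
qed

text \<open>The third descent \<open>r\<close> from \<open>pair_cases\<close> is unconnected to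
  \<open>s\<close> or to \<open>t\<close>. If \<open>w\<close> exchanged a pair, some letter would
  have two partners, against \<open>psi_unique\<close>; so all three are fixed up to \<theta> and
  form a path.\<close>

lemma sim_descents:
  assumes S: "s \<in> S" "t \<in> S" and d: "desc w s" "desc w t"
  shows "sim s t"
proof (rule ccontr)
  assume ns: "\<not> sim s t"
  hence st: "s \<noteq> t" using sim_refl by auto
  obtain r where r: "r \<in> S" "r \<noteq> s" "r \<noteq> t" "desc w r" using pair_cases[OF S st d ns] by auto
  have pst: "psi w s s \<and> psi w t t \<and> m s t \<ge> 3 \<or> psi w s t \<and> psi w t s" using pair_cases[OF S st d ns] by blast
  have "\<not> sim s r \<or> \<not> sim t r" using sim_trans[of s r t] sim_sym r ns by blast
  thus False
  proof
    assume nsr: "\<not> sim s r"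
    have "psi w s s \<and> psi w r r \<and> m s r \<ge> 3 \<or> psi w s r \<and> psi w r s" 
      using pair_cases[OF S(1) r(1) _ d(1) r(4) nsr] r by auto
    hence "psi w s s \<and> psi w t t \<and> m s t \<ge> 3 \<and> psi w r r \<and> m s r \<ge> 3"
      using pst psi_unique[of w s t s] psi_unique[of w s t r] psi_unique[of w s r s] S r st by blast
    thus False using path_connect[of t s r] S r st d ns by auto
  next
    assume ntr: "\<not> sim t r"
    have "psi w t t \<and> psi w r r \<and> m t r \<ge> 3 \<or> psi w t r \<and> psi w r t" 
      using pair_cases[OF S(2) r(1) _ d(2) r(4) ntr] r by auto
    hence "psi w s s \<and> psi w t t \<and> m s t \<ge> 3 \<and> psi w r r \<and> m t r \<ge> 3"
      using pst psi_unique[of w t s t] psi_unique[of w t s r] psi_unique[of w t r t] S r st by blast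
    thus False using path_connect[of s t r] S r st d ns sim_sym m_sym[of s t] by auto
  qed
qed

lemma connected:
  assumes "ascw \<one> us" "acts \<one> us = w" "ascw \<one> vs" "acts \<one> vs = w"
  shows "(us, vs) \<in> M"
proof (cases us rule: rev_cases)
  case Nil
  hence "vs = []" using ascw_length_unique[OF assms(1,3)] assms(2,4) by simp
  thus ?thesis using Nil by simp
next
  case (snoc us' s)
  hence "vs \<noteq> []" using ascw_length_unique[OF assms(1,3)] assms(2,4) by auto
  then obtain vs' t where vs: "vs = vs' @ [t]" by (metis rev_exhaust)
  note us = assms(1,2)[unfolded snoc] and vs' = assms(3,4)[unfolded vs]
  have "sim s t" using sim_descents ascw_snocD(1,3)[OF us] ascw_snocD(1,3)[OF vs'] by blast
  thus ?thesis unfolding snoc vs by (rule simD[OF _ us vs'])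
qed

end

theorem theorem4p1:
  fixes W :: "('a, 'b) monoid_scheme"
    and S :: "'a set"
    and \<theta> :: "'a \<Rightarrow> 'a"
    and lab :: "'a set \<Rightarrow> 'a list"
    and w :: 'a
    and us vs :: "'a list"
  assumes "coxeter_system W S"
    and "involutive_automorphism W S \<theta>"
    and "labelling_choice W S \<theta> lab"
    and "w \<in> twisted_involutions W \<theta>"
    and "reduced_expression W S \<theta> w us"
    and "reduced_expression W S \<theta> w vs"
  shows "(us, vs) \<in> (braid_moves W S \<union> initial_moves W S \<theta> (listed_pairs W S \<theta> lab))\<^sup>*"
proof -
  interpret twisted_coxeter W S \<theta>
    using assms(1,2) by (simp add: twisted_coxeter_def twisted_coxeter_axioms_def)
  let ?M = "(moves (listed_pairs W S \<theta> lab))\<^sup>*"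
  have "(us, vs) \<in> ?M" if "w \<in> \<I>" "ascw \<one>\<^bsub>W\<^esub> us" "acts \<one>\<^bsub>W\<^esub> us = w" "ascw \<one>\<^bsub>W\<^esub> vs" "acts \<one>\<^bsub>W\<^esub> vs = w" for w us vs
    using that
  proof (induction "len w" arbitrary: w us vs rule: less_induct)
    case less
    interpret word_property_step W S \<theta> lab w
      by unfold_locales (use assms(3) less in auto)
    show ?case using connected less by blast
  qed
  hence "(us, vs) \<in> ?M" using assms reduced_expression_iff by blast
  thus ?thesis using moves_subset by blast
qed

end
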